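(* For any compact Hausdorff space $S$, one has $H^i_{\mathrm{cond}}(S,\mathbb R)=0$ for $i>0$, while $H^0_{\mathrm{cond}}(S,\mathbb R)=C(S,\mathbb R)$ is the space of continuous real-valued functions on $S$. More precisely, if $S_\bullet\to S$ is any simplicial hypercover of $S$ by profinite sets $S_i$, then the complex of Banach spaces \[ 0\to C(S,\mathbb R)\to C(S_0,\mathbb R)\to C(S_1,\mathbb R)\to \ldots \] (all equipped with the supremum norm, with differentials the alternating sums of pullbacks along face maps) satisfies: for every $i\geq 0$, every $f\in C(S_i,\mathbb R)$ with $df=0$, and every $\epsilon>0$, there exists $g\in C(S_{i-1},\mathbb R)$ (with $S_{-1}:=S$) such that $dg=f$ and $\|g\|\leq (1+\epsilon)\|f\|$.
   Context: Condensed abelian groups are sheaves of abelian groups on the site of (suitably cardinality-bounded) compact Hausdorff spaces with covers given by finite jointly surjective families; $H^i_{\mathrm{cond}}(S,\mathbb R)$ denotes the $i$-th cohomology of the compact Hausdorff space $S$ on this site with coefficients in the sheaf $T\mapsto C(T,\mathbb R)$ (equivalently $\mathrm{Ext}^i$ in condensed abelian groups from the free condensed abelian group on $S$ to the condensed abelian group $\underline{\mathbb R}$ associated with the topological group $\mathbb R$). A simplicial hypercover $S_\bullet\to S$ is an augmented simplicial compact Hausdorff space such that each map $S_n\to (\mathrm{cosk}_{n-1}S_\bullet)_n$ (with $S_{-1}=S$ as augmentation) is surjective. *)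

theory Defs
  imports "HOL-Analysis.Analysis" "HOL-Algebra.Coset"
begin

section \<open>The site of bounded compact Hausdorff spaces\<close>

text \<open>
  Spaces are abstract topologies on subsets of a type; morphisms are continuous maps in normal form
  (undefined off the source), so that equality of morphisms is equality of functions. They are
  composed with \<^const>\<open>compose\<close>.
\<close>

definition cmap :: "'a topology \<Rightarrow> 'b topology \<Rightarrow> ('a \<Rightarrow> 'b) set"
  where "cmap X Y = {f \<in> extensional (topspace X). continuous_map X Y f}"

context
  includes cardinal_syntax
begin

text \<open>
  The second condition ensures that every compact Hausdorff space of cardinality below
  \<open>\<kappa>\<close> has a homeomorphic copy on the type \<open>'a\<close>. Every infinite \<open>\<kappa>\<close> is allowed,
  in particular the uncountable strong limit cardinals that are customary for condensed sets.
\<close>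

definition cutoff_cardinal :: "'a set rel \<Rightarrow> bool"
  where "cutoff_cardinal \<kappa> \<longleftrightarrow>
    Card_order \<kappa> \<and> infinite (Field \<kappa>) \<and> \<kappa> \<le>o cardSuc |UNIV :: 'a set|"

definition CHaus :: "'a set rel \<Rightarrow> 'a topology set"
  where "CHaus \<kappa> = {X. compact_space X \<and> Hausdorff_space X \<and> |topspace X| <o \<kappa>}"

end

definition finite_cover :: "'a set rel \<Rightarrow> 'a topology \<Rightarrow> ('a topology \<times> ('a \<Rightarrow> 'a)) set \<Rightarrow> bool"
  where "finite_cover \<kappa> X \<U> \<longleftrightarrow>
    finite \<U> \<and> (\<forall>(Y, f) \<in> \<U>. Y \<in> CHaus \<kappa> \<and> f \<in> cmap Y X) \<and>
    (\<Union>(Y, f) \<in> \<U>. f ` topspace Y) = topspace X"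


section \<open>Condensed abelian groups\<close>

text \<open>
  \<open>pull F X Y f\<close> is the map \<open>F(Y) \<rightarrow> F(X)\<close> induced by \<open>f : X \<rightarrow> Y\<close>. Groups are
  those of \<^theory>\<open>HOL-Algebra.Group\<close>, hence written multiplicatively.
\<close>

record ('a, 'g) presheaf =
  sections :: "'a topology \<Rightarrow> 'g monoid"
  pull :: "'a topology \<Rightarrow> 'a topology \<Rightarrow> ('a \<Rightarrow> 'a) \<Rightarrow> 'g \<Rightarrow> 'g"

definition ab_presheaf :: "'a set rel \<Rightarrow> ('a, 'g) presheaf \<Rightarrow> bool"
  where "ab_presheaf \<kappa> F \<longleftrightarrow>
    (\<forall>X \<in> CHaus \<kappa>. comm_group (sections F X)) \<and>
    (\<forall>X \<in> CHaus \<kappa>. \<forall>Y \<in> CHaus \<kappa>. \<forall>f \<in> cmap X Y.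
       pull F X Y f \<in> hom (sections F Y) (sections F X)) \<and>
    (\<forall>X \<in> CHaus \<kappa>. \<forall>s \<in> carrier (sections F X).
       pull F X X (restrict id (topspace X)) s = s) \<and>
    (\<forall>X \<in> CHaus \<kappa>. \<forall>Y \<in> CHaus \<kappa>. \<forall>Z \<in> CHaus \<kappa>. \<forall>f \<in> cmap X Y. \<forall>g \<in> cmap Y Z.
       \<forall>s \<in> carrier (sections F Z).
       pull F X Z (compose (topspace X) g f) s = pull F X Y f (pull F Y Z g s))"

text \<open>
  Agreement on the fibre product of \<open>f : Y \<rightarrow> X\<close> and \<open>g : Z \<rightarrow> X\<close> is expressed by testing on all
  objects \<open>W\<close> mapping to it, which avoids choosing a copy of the fibre product on the type \<open>'a\<close>.
\<close>

definition compatible_family ::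
    "'a set rel \<Rightarrow> ('a, 'g) presheaf \<Rightarrow> ('a topology \<times> ('a \<Rightarrow> 'a)) set \<Rightarrow>
     ('a topology \<times> ('a \<Rightarrow> 'a) \<Rightarrow> 'g) \<Rightarrow> bool"
  where "compatible_family \<kappa> F \<U> s \<longleftrightarrow>
    (\<forall>(Y, f) \<in> \<U>. s (Y, f) \<in> carrier (sections F Y)) \<and>
    (\<forall>(Y, f) \<in> \<U>. \<forall>(Z, g) \<in> \<U>. \<forall>W \<in> CHaus \<kappa>. \<forall>p \<in> cmap W Y. \<forall>q \<in> cmap W Z.
       compose (topspace W) f p = compose (topspace W) g q \<longrightarrow>
       pull F W Y p (s (Y, f)) = pull F W Z q (s (Z, g)))"

definition condensed_ab :: "'a set rel \<Rightarrow> ('a, 'g) presheaf \<Rightarrow> bool"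
  where "condensed_ab \<kappa> F \<longleftrightarrow>
    ab_presheaf \<kappa> F \<and>
    (\<forall>X \<in> CHaus \<kappa>. \<forall>\<U> s. finite_cover \<kappa> X \<U> \<and> compatible_family \<kappa> F \<U> s \<longrightarrow>
       (\<exists>!t. t \<in> carrier (sections F X) \<and> (\<forall>(Y, f) \<in> \<U>. pull F Y X f t = s (Y, f))))"

definition condensed_hom ::
    "'a set rel \<Rightarrow> ('a, 'g) presheaf \<Rightarrow> ('a, 'h) presheaf \<Rightarrow> ('a topology \<Rightarrow> 'g \<Rightarrow> 'h) \<Rightarrow> bool"
  where "condensed_hom \<kappa> F G \<phi> \<longleftrightarrow>
    (\<forall>X \<in> CHaus \<kappa>. \<phi> X \<in> hom (sections F X) (sections G X)) \<and>
    (\<forall>X \<in> CHaus \<kappa>. \<forall>Y \<in> CHaus \<kappa>. \<forall>f \<in> cmap X Y. \<forall>s \<in> carrier (sections F Y).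
       \<phi> X (pull F X Y f s) = pull G X Y f (\<phi> Y s))"

definition condensed_mono ::
    "'a set rel \<Rightarrow> ('a, 'g) presheaf \<Rightarrow> ('a, 'h) presheaf \<Rightarrow> ('a topology \<Rightarrow> 'g \<Rightarrow> 'h) \<Rightarrow> bool"
  where "condensed_mono \<kappa> F G \<phi> \<longleftrightarrow>
    condensed_hom \<kappa> F G \<phi> \<and> (\<forall>X \<in> CHaus \<kappa>. inj_on (\<phi> X) (carrier (sections F X)))"

text \<open>
  Exactness of \<open>F \<rightarrow> G \<rightarrow> H\<close> at \<open>G\<close> in the category of sheaves: sections in the kernel lie
  locally, i.e. on some cover, in the image.
\<close>

definition condensed_exact ::
    "'a set rel \<Rightarrow> ('a, 'f) presheaf \<Rightarrow> ('a, 'g) presheaf \<Rightarrow> ('a, 'h) presheaf \<Rightarrow>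
     ('a topology \<Rightarrow> 'f \<Rightarrow> 'g) \<Rightarrow> ('a topology \<Rightarrow> 'g \<Rightarrow> 'h) \<Rightarrow> bool"
  where "condensed_exact \<kappa> F G H \<phi> \<psi> \<longleftrightarrow>
    (\<forall>X \<in> CHaus \<kappa>. \<forall>s \<in> carrier (sections F X). \<psi> X (\<phi> X s) = \<one>\<^bsub>sections H X\<^esub>) \<and>
    (\<forall>X \<in> CHaus \<kappa>. \<forall>t \<in> carrier (sections G X). \<psi> X t = \<one>\<^bsub>sections H X\<^esub> \<longrightarrow>
       (\<exists>\<U>. finite_cover \<kappa> X \<U> \<and>
         (\<forall>(Y, f) \<in> \<U>. pull G Y X f t \<in> \<phi> Y ` carrier (sections F Y))))"


section \<open>Condensed cohomology\<close>

text \<open>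
  Injectivity is tested in the category of condensed abelian groups whose groups of sections live
  on the type \<open>'g\<close>. As soon as \<open>'g\<close> has at least \<open>2^(2^|'a|)\<close> elements this is the usual
  notion: the subobjects of the generators \<open>\<int>[T]\<close> and of their direct sum over all isomorphism
  classes of \<open>T\<close> have at most \<open>2^|'a|\<close> sections over each object, so that Baer's criterion
  applies. For the same reason a condensed abelian group with at most \<open>2^|'a|\<close> sections over each
  object, such as the real line, then has an injective resolution with values in \<open>'g\<close>.
\<close>

definition condensed_injective :: "'a set rel \<Rightarrow> ('a, 'g) presheaf \<Rightarrow> bool"
  where "condensed_injective \<kappa> J \<longleftrightarrow>
    condensed_ab \<kappa> J \<and>
    (\<forall>(A :: ('a, 'g) presheaf) (B :: ('a, 'g) presheaf) m \<phi>.
       condensed_ab \<kappa> A \<and> condensed_ab \<kappa> B \<and> condensed_mono \<kappa> A B m \<and> condensed_hom \<kappa> A J \<phi> \<longrightarrow>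
       (\<exists>\<psi>. condensed_hom \<kappa> B J \<psi> \<and>
         (\<forall>X \<in> CHaus \<kappa>. \<forall>s \<in> carrier (sections A X). \<psi> X (m X s) = \<phi> X s)))"

definition injective_resolution ::
    "'a set rel \<Rightarrow> ('a, 'f) presheaf \<Rightarrow> (nat \<Rightarrow> ('a, 'g) presheaf) \<Rightarrow>
     (nat \<Rightarrow> 'a topology \<Rightarrow> 'g \<Rightarrow> 'g) \<Rightarrow> ('a topology \<Rightarrow> 'f \<Rightarrow> 'g) \<Rightarrow> bool"
  where "injective_resolution \<kappa> F I \<delta> \<eta> \<longleftrightarrow>
    (\<forall>n. condensed_injective \<kappa> (I n)) \<and>
    condensed_mono \<kappa> F (I 0) \<eta> \<and>
    (\<forall>n. condensed_hom \<kappa> (I n) (I (Suc n)) (\<delta> n)) \<and>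
    condensed_exact \<kappa> F (I 0) (I 1) \<eta> (\<delta> 0) \<and>
    (\<forall>n. condensed_exact \<kappa> (I n) (I (Suc n)) (I (Suc (Suc n))) (\<delta> n) (\<delta> (Suc n)))"

definition cocycles ::
    "(nat \<Rightarrow> ('a, 'g) presheaf) \<Rightarrow> (nat \<Rightarrow> 'a topology \<Rightarrow> 'g \<Rightarrow> 'g) \<Rightarrow> 'a topology \<Rightarrow> nat \<Rightarrow> 'g monoid"
  where "cocycles I \<delta> S i =
    (sections (I i) S)\<lparr>carrier := kernel (sections (I i) S) (sections (I (Suc i)) S) (\<delta> i S)\<rparr>"

fun coboundaries ::
    "(nat \<Rightarrow> ('a, 'g) presheaf) \<Rightarrow> (nat \<Rightarrow> 'a topology \<Rightarrow> 'g \<Rightarrow> 'g) \<Rightarrow> 'a topology \<Rightarrow> nat \<Rightarrow> 'g set"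
  where
    "coboundaries I \<delta> S 0 = {\<one>\<^bsub>sections (I 0) S\<^esub>}"
  | "coboundaries I \<delta> S (Suc i) = \<delta> i S ` carrier (sections (I i) S)"

text \<open>
  The right derived functors of \<open>F \<mapsto> F(S)\<close>, computed from an injective resolution
  \<open>I\<close> of \<open>F\<close>.
\<close>

definition cohomology ::
    "(nat \<Rightarrow> ('a, 'g) presheaf) \<Rightarrow> (nat \<Rightarrow> 'a topology \<Rightarrow> 'g \<Rightarrow> 'g) \<Rightarrow> 'a topology \<Rightarrow> nat \<Rightarrow> 'g set monoid"
  where "cohomology I \<delta> S i = cocycles I \<delta> S i Mod coboundaries I \<delta> S i"

definition cohomology_class ::
    "(nat \<Rightarrow> ('a, 'g) presheaf) \<Rightarrow> (nat \<Rightarrow> 'a topology \<Rightarrow> 'g \<Rightarrow> 'g) \<Rightarrow> 'a topology \<Rightarrow> nat \<Rightarrow> 'g \<Rightarrow> 'g set"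
  where "cohomology_class I \<delta> S i s = coboundaries I \<delta> S i #>\<^bsub>cocycles I \<delta> S i\<^esub> s"

definition real_function_group :: "'a topology \<Rightarrow> ('a \<Rightarrow> real) monoid"
  where "real_function_group X =
    \<lparr>carrier = cmap X euclideanreal,
     mult = (\<lambda>f g. \<lambda>x\<in>topspace X. f x + g x),
     one = (\<lambda>x\<in>topspace X. 0)\<rparr>"

definition real_condensed :: "('a, 'a \<Rightarrow> real) presheaf"
  where "real_condensed =
    \<lparr>sections = real_function_group,
     pull = (\<lambda>X Y f g. compose (topspace X) g f)\<rparr>"


section \<open>Hypercovers\<close>

text \<open>
  An augmented simplicial space is a contravariant functor on the category of all finite ordinals
  \<open>{..<n}\<close>, the empty one included, and monotone maps. The index counts vertices:
  \<open>level A (Suc n)\<close> is \<open>S\<^sub>n\<close> and \<open>level A 0\<close> is \<open>S\<^sub>-\<^sub>1 = S\<close>.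
\<close>

record 'a aug_simplicial =
  level :: "nat \<Rightarrow> 'a topology"
  act :: "nat \<Rightarrow> nat \<Rightarrow> (nat \<Rightarrow> nat) \<Rightarrow> 'a \<Rightarrow> 'a"

definition ord_maps :: "nat \<Rightarrow> nat \<Rightarrow> (nat \<Rightarrow> nat) set"
  where "ord_maps m n = {\<theta> \<in> {..<m} \<rightarrow>\<^sub>E {..<n}. mono_on {..<m} \<theta>}"

definition aug_simplicial_space :: "'a aug_simplicial \<Rightarrow> bool"
  where "aug_simplicial_space A \<longleftrightarrow>
    (\<forall>m n. \<forall>\<theta> \<in> ord_maps m n. act A m n \<theta> \<in> cmap (level A n) (level A m)) \<and>
    (\<forall>n. act A n n (restrict id {..<n}) = restrict id (topspace (level A n))) \<and>
    (\<forall>k m n. \<forall>\<theta> \<in> ord_maps k m. \<forall>\<rho> \<in> ord_maps m n.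
       act A k n (compose {..<k} \<rho> \<theta>) = compose (topspace (level A n)) (act A k m \<theta>) (act A m n \<rho>))"

text \<open>
  The points of the \<open>n\<close>-th level of the coskeleton of the truncation of \<open>A\<close> to levels \<open>\<le> m\<close>,
  given by the limit formula for right Kan extensions. The condition for maps to the empty ordinal
  makes this the coskeleton relative to the augmentation.
\<close>

definition coskeleton :: "'a aug_simplicial \<Rightarrow> nat \<Rightarrow> nat \<Rightarrow> (nat \<times> (nat \<Rightarrow> nat) \<Rightarrow> 'a) set"
  where "coskeleton A m n =
    {x \<in> (\<Pi>\<^sub>E (k, \<theta>) \<in> (SIGMA k:{..m}. ord_maps k n). topspace (level A k)).
       \<forall>k\<le>m. \<forall>l\<le>m. \<forall>\<theta> \<in> ord_maps k n. \<forall>\<alpha> \<in> ord_maps l k.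
         x (l, compose {..<l} \<theta> \<alpha>) = act A l k \<alpha> (x (k, \<theta>))}"

definition to_coskeleton :: "'a aug_simplicial \<Rightarrow> nat \<Rightarrow> nat \<Rightarrow> 'a \<Rightarrow> nat \<times> (nat \<Rightarrow> nat) \<Rightarrow> 'a"
  where "to_coskeleton A m n y = (\<lambda>(k, \<theta>) \<in> (SIGMA k:{..m}. ord_maps k n). act A k n \<theta> y)"

text \<open>
  With the index shift, the condition on \<open>level A (Suc n)\<close> is that \<open>S\<^sub>n\<close> surjects onto level \<open>n\<close>
  of the \<open>(n - 1)\<close>-coskeleton; for \<open>n = 0\<close> it says that \<open>S\<^sub>0\<close> surjects onto \<open>S\<close>.
\<close>

definition hypercover :: "'a topology \<Rightarrow> 'a aug_simplicial \<Rightarrow> bool"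
  where "hypercover S A \<longleftrightarrow>
    aug_simplicial_space A \<and> level A 0 = S \<and>
    (\<forall>n. compact_space (level A n) \<and> Hausdorff_space (level A n)) \<and>
    (\<forall>n. to_coskeleton A n (Suc n) ` topspace (level A (Suc n)) = coskeleton A n (Suc n))"

definition profinite_space :: "'a topology \<Rightarrow> bool"
  where "profinite_space X \<longleftrightarrow>
    compact_space X \<and> Hausdorff_space X \<and> (\<forall>C. connectedin X C \<longrightarrow> (\<exists>x. C \<subseteq> {x}))"

definition coface :: "nat \<Rightarrow> nat \<Rightarrow> nat \<Rightarrow> nat"
  where "coface n i = (\<lambda>j\<in>{..<n}. if j < i then j else Suc j)"

text \<open>The differential \<open>C(S\<^sub>n\<^sub>-\<^sub>1, \<real>) \<rightarrow> C(S\<^sub>n, \<real>)\<close>, where \<open>S\<^sub>n\<^sub>-\<^sub>1 = level A n\<close>.\<close>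

definition differential :: "'a aug_simplicial \<Rightarrow> nat \<Rightarrow> ('a \<Rightarrow> real) \<Rightarrow> 'a \<Rightarrow> real"
  where "differential A n g =
    (\<lambda>y\<in>topspace (level A (Suc n)). \<Sum>i\<le>n. (-1) ^ i * g (act A n (Suc n) (coface n i) y))"

text \<open>Inserting \<open>0\<close> only matters for the empty space.\<close>

definition sup_norm :: "'a topology \<Rightarrow> ('a \<Rightarrow> real) \<Rightarrow> real"
  where "sup_norm X f = Sup (insert 0 ((\<lambda>x. \<bar>f x\<bar>) ` topspace X))"

end

theory Submission
  imports Defs "HOL-Algebra.Free_Abelian_Groups"
begin

text \<open>
  For the second part, a hypercover by profinite spaces has, over a small neighbourhood of each point
  of \<open>S\<close>, an approximate contraction: a locally constant extra degeneracy, built level by level from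
  the surjections onto the coskeleta, whose failure to be a contraction is invisible to \<open>f\<close> up to an
  error \<open>e\<close>. It gives a local solution of \<open>dg = f\<close> up to \<open>e\<close> with \<open>\<parallel>g\<parallel> \<le> \<parallel>f\<parallel>\<close>. The differential is
  linear over \<open>C(S, \<real>)\<close>, so a partition of unity turns local solutions into a global approximate one,
  and iteration on the errors gives an exact one with norm at most \<open>(1 + \<epsilon>)\<parallel>f\<parallel>\<close>.

  The first part is a comparison with Cech cohomology. Cech cocycles of a surjection \<open>Y \<rightarrow> S\<close> with real
  coefficients are coboundaries, by the same approximation argument, and those with coefficients in an
  injective sheaf are coboundaries since the boundaries form a subsheaf of the functions into free
  abelian groups, from which homomorphisms extend. By dimension shifting along the resolution every
  kernel sheaf has vanishing Cech cohomology, so that local preimages under \<open>\<delta>\<close> can be corrected to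
  agree on overlaps and the sections over \<open>S\<close> form an exact complex.
\<close>

section \<open>Norm-controlled solutions over a compact base\<close>

text \<open>The two parts contract fibres differently. Profinite levels admit locally constant
  choices, so a lift chosen for a point of the fibre over \<open>s\<close> serves a whole
  neighbourhood. For Cech cochains the cover is any surjection in the site, and
  \<open>\<kappa>\<close> is not assumed to be a strong limit, so that no profinite cover is at
  hand. There the cone from a point of the fibre is exact on that fibre, and Tietze extension
  carries the resulting function, rather than the contraction, to the fibre power without raising
  its bound.

  For injective coefficients one would map the resolution of the free sheaf on \<open>S\<close> by
  the free sheaves on the fibre powers into the coefficients. To avoid sheafification, the free
  sheaves are replaced by functions without continuity into a single free abelian group on lists of
  points, which form a sheaf for finite jointly surjective covers. The price is that a homomorphism
  on boundaries must be shown to depend on the boundary alone, although simplices that differ as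
  maps may coincide at points. The size condition on \<open>'g\<close> lets this function sheaf
  occur as a test object for injectivity.\<close>

lemma partition_of_unity_compact_Hausdorff:
  assumes S: "compact_space S" "Hausdorff_space S"
    and V: "\<And>s. s \<in> topspace S \<Longrightarrow> openin S (V s) \<and> s \<in> V s"
  obtains J and \<phi> :: "'a \<Rightarrow> 'a \<Rightarrow> real" where
    "finite J" "J \<subseteq> topspace S" "\<And>j. j \<in> J \<Longrightarrow> continuous_map S euclideanreal (\<phi> j)"
    "\<And>j x. x \<in> topspace S \<Longrightarrow> 0 \<le> \<phi> j x"
    "\<And>j x. j \<in> J \<Longrightarrow> x \<in> topspace S \<Longrightarrow> x \<notin> V j \<Longrightarrow> \<phi> j x = 0"
    "\<And>x. x \<in> topspace S \<Longrightarrow> (\<Sum>j\<in>J. \<phi> j x) = 1"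
proof -
  have norm: "normal_space S"
    using S by (simp add: compact_Hausdorff_or_regular_imp_normal_space)
  have "\<exists>u. continuous_map S euclideanreal u \<and> (\<forall>x\<in>topspace S. 0 \<le> u x) \<and> u s = 1 \<and>
          (\<forall>x\<in>topspace S - V s. u x = 0)" if s: "s \<in> topspace S" for s
  proof -
    have "closedin S (topspace S - V s)" "closedin S {s}" "disjnt (topspace S - V s) {s}"
      using V[OF s] S s by (auto simp: disjnt_def closedin_Hausdorff_singleton)
    then obtain f where f: "continuous_map S (top_of_set {0..1::real}) f"
        "f ` (topspace S - V s) \<subseteq> {0}" "f ` {s} \<subseteq> {1}"
      using Urysohn_lemma[OF norm, of "topspace S - V s" "{s}" 0 1] by auto
    show ?thesis
      using f by (intro exI[of _ f]) (auto simp: continuous_map_in_subtopology image_subset_iff)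
  qed
  then obtain u where u: "\<And>s. s \<in> topspace S \<Longrightarrow> continuous_map S euclideanreal (u s)"
      "\<And>s x. s \<in> topspace S \<Longrightarrow> x \<in> topspace S \<Longrightarrow> (0::real) \<le> u s x"
      "\<And>s. s \<in> topspace S \<Longrightarrow> u s s = 1"
      "\<And>s x. s \<in> topspace S \<Longrightarrow> x \<in> topspace S - V s \<Longrightarrow> u s x = 0"
    by metis
  \<comment> \<open>The finite subcover is taken from the sets where a bump is positive, not from
    the \<open>V s\<close>: this keeps the sum of the chosen bumps positive, so that it can be
    divided by.\<close>
  define U where "U s = {x \<in> topspace S. u s x \<in> {0<..}}" for s
  have Uop: "openin S (U s)" if "s \<in> topspace S" for s
    unfolding U_def using u(1)[OF that] by (rule openin_continuous_map_preimage) auto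
  have "topspace S \<subseteq> \<Union> (U ` topspace S)"
    using u(3) by (auto simp: U_def)
  then obtain \<F> where "finite \<F>" "\<F> \<subseteq> U ` topspace S" "topspace S \<subseteq> \<Union>\<F>"
    using S(1) Uop unfolding compact_space_alt by (metis (no_types, lifting) image_iff)
  then obtain J where J: "finite J" "J \<subseteq> topspace S" "topspace S \<subseteq> \<Union>(U ` J)"
    by (metis finite_subset_image)
  define \<sigma> where "\<sigma> x = (\<Sum>j\<in>J. u j x)" for x
  have pos: "\<sigma> x > 0" if x: "x \<in> topspace S" for x
  proof -
    obtain j where "j \<in> J" "x \<in> U j" using J x by blast
    then show ?thesis
      unfolding \<sigma>_def using J u(2) that by (intro sum_pos2[of J j]) (auto simp: U_def)
  qed
  have c\<sigma>: "continuous_map S euclideanreal \<sigma>"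
    unfolding \<sigma>_def using J u(1) by (intro continuous_map_sum) auto
  \<comment> \<open>Setting the functions with index outside \<open>J\<close> to zero makes
    nonnegativity hold for every index.\<close>
  show ?thesis
  proof (rule that[of J "\<lambda>j x. if j \<in> J then u j x / \<sigma> x else 0"])
    show "continuous_map S euclideanreal (\<lambda>x. if j \<in> J then u j x / \<sigma> x else 0)" if "j \<in> J" for j
      using that J u(1) c\<sigma> pos by (auto intro!: continuous_map_real_divide) (metis less_irrefl)
    show "(\<Sum>j\<in>J. if j \<in> J then u j x / \<sigma> x else 0) = 1" if "x \<in> topspace S" for x
      using pos[OF that] by (simp add: \<sigma>_def flip: sum_divide_distrib)
  qed (use J u pos in \<open>auto simp: less_imp_le subset_iff\<close>)
qed

text \<open>Common frame of hypercover complexes, where \<open>A\<close> and \<open>B\<close> are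
  levels, and of Cech complexes, where they are sets of lists of points in a fibre. Linearity of
  \<open>d\<close> over functions pulled back from \<open>S\<close> makes partitions of unity act,
  the bound \<open>K\<close> lets \<open>d\<close> pass to uniform limits, and
  \<open>coc_diff\<close> lets the remaining error be treated as a new cocycle. In
  \<open>approx\<close> the same \<open>M\<close> bounds \<open>f\<close> and \<open>g\<close>; a
  factor there would reappear in the final estimate.\<close>

locale fibrewise_approximation =
  fixes S :: "'s topology" and A :: "'x set" and B :: "'y set"
    and q :: "'x \<Rightarrow> 's" and q' :: "'y \<Rightarrow> 's"
    and cont :: "('x \<Rightarrow> real) \<Rightarrow> bool" and coc :: "('y \<Rightarrow> real) \<Rightarrow> bool"
    and d :: "('x \<Rightarrow> real) \<Rightarrow> 'y \<Rightarrow> real" and K :: real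
  assumes S: "compact_space S" "Hausdorff_space S"
    and q: "\<And>x. x \<in> A \<Longrightarrow> q x \<in> topspace S" and q': "\<And>y. y \<in> B \<Longrightarrow> q' y \<in> topspace S"
    and cont_zero: "cont (\<lambda>x. 0)"
    and cont_add: "\<And>g h. cont g \<Longrightarrow> cont h \<Longrightarrow> cont (\<lambda>x. g x + h x)"
    and cont_scale: "\<And>\<phi> g. continuous_map S euclideanreal \<phi> \<Longrightarrow> cont g \<Longrightarrow> cont (\<lambda>x. \<phi> (q x) * g x)"
    and cont_lim: "\<And>g l. (\<And>n. cont (g n)) \<Longrightarrow> uniform_limit A g l sequentially \<Longrightarrow> cont l"
    and d_add: "\<And>g h y. y \<in> B \<Longrightarrow> d (\<lambda>x. g x + h x) y = d g y + d h y"
    and d_scale: "\<And>\<phi> g y. y \<in> B \<Longrightarrow> d (\<lambda>x. \<phi> (q x) * g x) y = \<phi> (q' y) * d g y"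
    and d_bound: "\<And>g M y. y \<in> B \<Longrightarrow> (\<And>x. x \<in> A \<Longrightarrow> \<bar>g x\<bar> \<le> M) \<Longrightarrow> \<bar>d g y\<bar> \<le> K * M"
    and coc_diff: "\<And>f g. coc f \<Longrightarrow> cont g \<Longrightarrow> coc (\<lambda>y. f y - d g y)"
    and approx: "\<And>f M s \<epsilon>. coc f \<Longrightarrow> (\<And>y. y \<in> B \<Longrightarrow> \<bar>f y\<bar> \<le> M) \<Longrightarrow> 0 \<le> M \<Longrightarrow> s \<in> topspace S \<Longrightarrow> 0 < \<epsilon> \<Longrightarrow>
      \<exists>g V. cont g \<and> (\<forall>x\<in>A. \<bar>g x\<bar> \<le> M) \<and> openin S V \<and> s \<in> V \<and> (\<forall>y\<in>B. q' y \<in> V \<longrightarrow> \<bar>d g y - f y\<bar> \<le> \<epsilon>)"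
begin

text \<open>Scalars enter through \<open>d_scale\<close> with constant \<open>\<phi>\<close>, here 0
  and in the next lemma -1.\<close>

lemma d_zero: "y \<in> B \<Longrightarrow> d (\<lambda>x. 0) y = 0"
  using d_scale[of y "\<lambda>_. 0" "\<lambda>_. 0"] by simp

lemma d_diff: "y \<in> B \<Longrightarrow> d (\<lambda>x. g x - h x) y = d g y - d h y"
  using d_scale[of y "\<lambda>_. -1" h] d_add[of y g "\<lambda>x. - h x"] by simp

lemma d_sum: "finite J \<Longrightarrow> y \<in> B \<Longrightarrow> d (\<lambda>x. \<Sum>j\<in>J. g j x) y = (\<Sum>j\<in>J. d (g j) y)"
  by (induction J rule: finite_induct) (simp_all add: d_zero d_add)

lemma cont_sum: "finite J \<Longrightarrow> (\<And>j. j \<in> J \<Longrightarrow> cont (g j)) \<Longrightarrow> cont (\<lambda>x. \<Sum>j\<in>J. g j x)"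
  by (induction J rule: finite_induct) (simp_all add: cont_zero cont_add)

text \<open>A partition of unity forms convex combinations: value and error at a point are averages
  over those local solutions whose neighbourhood contains its image in \<open>S\<close>, so neither
  estimate deteriorates with the number of pieces.\<close>

lemma global_approx:
  assumes f: "coc f" "\<And>y. y \<in> B \<Longrightarrow> \<bar>f y\<bar> \<le> M" and M: "0 \<le> M" and \<epsilon>: "0 < \<epsilon>"
  shows "\<exists>g. cont g \<and> (\<forall>x\<in>A. \<bar>g x\<bar> \<le> M) \<and> (\<forall>y\<in>B. \<bar>d g y - f y\<bar> \<le> \<epsilon>)"
proof -
  obtain g V where g: "\<And>s. s \<in> topspace S \<Longrightarrow> cont (g s)"
    "\<And>s x. s \<in> topspace S \<Longrightarrow> x \<in> A \<Longrightarrow> \<bar>g s x\<bar> \<le> M"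
    "\<And>s y. s \<in> topspace S \<Longrightarrow> y \<in> B \<Longrightarrow> q' y \<in> V s \<Longrightarrow> \<bar>d (g s) y - f y\<bar> \<le> \<epsilon>"
    and V: "\<And>s. s \<in> topspace S \<Longrightarrow> openin S (V s) \<and> s \<in> V s"
    using approx[OF f M _ \<epsilon>] by metis
  obtain J \<phi> where J: "finite J" "J \<subseteq> topspace S"
    and \<phi>: "\<And>j. j \<in> J \<Longrightarrow> continuous_map S euclideanreal (\<phi> j)" "\<And>j x. x \<in> topspace S \<Longrightarrow> 0 \<le> \<phi> j x"
    "\<And>j x. j \<in> J \<Longrightarrow> x \<in> topspace S \<Longrightarrow> x \<notin> V j \<Longrightarrow> \<phi> j x = 0"
    "\<And>x. x \<in> topspace S \<Longrightarrow> (\<Sum>j\<in>J. \<phi> j x) = 1"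
    using partition_of_unity_compact_Hausdorff[OF S V] by metis
  define h where "h = (\<lambda>x. \<Sum>j\<in>J. \<phi> j (q x) * g j x)"
  have convex: "\<bar>\<Sum>j\<in>J. \<phi> j x * a j\<bar> \<le> C" 
    if "x \<in> topspace S" "\<And>j. j \<in> J \<Longrightarrow> x \<in> V j \<Longrightarrow> \<bar>a j\<bar> \<le> C" for x a C
  proof -
    have "\<bar>\<Sum>j\<in>J. \<phi> j x * a j\<bar> \<le> (\<Sum>j\<in>J. \<bar>\<phi> j x * a j\<bar>)" by (rule sum_abs)
    also have "\<dots> \<le> (\<Sum>j\<in>J. \<phi> j x * C)"
    proof (rule sum_mono)
      fix j assume "j \<in> J"
      then show "\<bar>\<phi> j x * a j\<bar> \<le> \<phi> j x * C"
        using \<phi>(2,3) that by (cases "x \<in> V j") (auto simp: abs_mult intro!: mult_mono)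
    qed
    also have "\<dots> = C" using \<phi>(4) that(1) by (simp flip: sum_distrib_right)
    finally show ?thesis .
  qed
  have "cont h"
    unfolding h_def using J \<phi>(1) g(1) by (intro cont_sum cont_scale) auto
  moreover have "\<bar>h x\<bar> \<le> M" if "x \<in> A" for x
    unfolding h_def using q g(2) J that by (intro convex) auto
  moreover have "\<bar>d h y - f y\<bar> \<le> \<epsilon>" if y: "y \<in> B" for y
  proof -
    \<comment> \<open>The weights at \<open>q' y\<close> sum to 1, so \<open>f y\<close> can be
      distributed over the local solutions.\<close>
    have "d h y - f y = (\<Sum>j\<in>J. \<phi> j (q' y) * d (g j) y) - (\<Sum>j\<in>J. \<phi> j (q' y)) * f y"
      unfolding h_def using J y \<phi>(4) q' by (simp add: d_sum d_scale)
    also have "\<dots> = (\<Sum>j\<in>J. \<phi> j (q' y) * (d (g j) y - f y))"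
      by (simp add: sum_distrib_right sum_subtractf right_diff_distrib)
    also have "\<bar>\<dots>\<bar> \<le> \<epsilon>"
      using q' g(3) J y by (intro convex) auto
    finally show ?thesis .
  qed
  ultimately show ?thesis by blast
qed

text \<open>The geometric series of the errors left by \<open>global_approx\<close> costs the factor \<open>1 + \<epsilon>\<close>.\<close>

theorem exact:
  assumes f: "coc f" "\<And>y. y \<in> B \<Longrightarrow> \<bar>f y\<bar> \<le> M" and M: "0 \<le> M" and \<epsilon>: "0 < \<epsilon>"
  shows "\<exists>g. cont g \<and> (\<forall>x\<in>A. \<bar>g x\<bar> \<le> (1 + \<epsilon>) * M) \<and> (\<forall>y\<in>B. d g y = f y)"
\<comment> \<open>With \<open>M = 0\<close> the tolerances below would vanish, and
  \<open>global_approx\<close> requires positive ones.\<close>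
proof (cases "M = 0")
  case True
  then show ?thesis
    using f d_zero cont_zero by (intro exI[of _ "\<lambda>x. 0"]) force
next
  case False
  with M have M: "M > 0" by simp
  \<comment> \<open>Chosen such that the geometric series in \<open>r\<close> has sum
    \<open>1 / (1 - r) = 1 + \<epsilon>\<close>.\<close>
  define r where "r = \<epsilon> / (1 + \<epsilon>)"
  have r: "0 < r" "r < 1" using \<epsilon> by (auto simp: r_def)
  define good where "good n = (\<lambda>(f, g). coc f \<and> (\<forall>y\<in>B. \<bar>f y\<bar> \<le> r ^ n * M) \<and> cont g \<and>
      (\<forall>x\<in>A. \<bar>g x\<bar> \<le> r ^ n * M) \<and> (\<forall>y\<in>B. \<bar>f y - d g y\<bar> \<le> r ^ Suc n * M))" for n
  have step: "\<exists>g. good n (f, g)" if "coc f" "\<forall>y\<in>B. \<bar>f y\<bar> \<le> r ^ n * M" for f n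
    using global_approx[of f "r ^ n * M" "r ^ Suc n * M"] that r M
    by (auto simp: good_def abs_minus_commute)
  \<comment> \<open>\<open>F n\<close> pairs the n-th error with an approximate solution for it;
    subtracting the differential of the latter gives the next error.\<close>
  have "\<exists>F. \<forall>n. (good n (F n) \<and> (n = 0 \<longrightarrow> fst (F n) = f)) \<and> fst (F (Suc n)) = (\<lambda>y. fst (F n) y - d (snd (F n)) y)"
  proof (rule dependent_nat_choice)
    show "\<exists>x. good 0 x \<and> (0 = 0 \<longrightarrow> fst x = f)"
    proof -
      obtain g where "good 0 (f, g)" using step[of f 0] f by auto
      then show ?thesis by (intro exI[of _ "(f, g)"]) simp
    qed
    show "\<exists>y. (good (Suc n) y \<and> (Suc n = 0 \<longrightarrow> fst y = f)) \<and> fst y = (\<lambda>y. fst x y - d (snd x) y)"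
      if "good n x \<and> (n = 0 \<longrightarrow> fst x = f)" for x n
    proof -
      have "coc (\<lambda>y. fst x y - d (snd x) y)" "\<forall>y\<in>B. \<bar>fst x y - d (snd x) y\<bar> \<le> r ^ Suc n * M"
        using that coc_diff by (auto simp: good_def split: prod.splits)
      then obtain g where "good (Suc n) (\<lambda>y. fst x y - d (snd x) y, g)" using step by blast
      then show ?thesis by (intro exI[of _ "(\<lambda>y. fst x y - d (snd x) y, g)"]) simp
    qed
  qed
  then obtain F where F: "\<And>n. good n (F n)" "fst (F 0) = f"
    "\<And>n. fst (F (Suc n)) = (\<lambda>y. fst (F n) y - d (snd (F n)) y)"
    by metis
  define g where "g n = snd (F n)" for n
  have g: "cont (g n)" "\<And>x. x \<in> A \<Longrightarrow> \<bar>g n x\<bar> \<le> r ^ n * M" for n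
    using F(1)[of n] by (auto simp: good_def g_def split: prod.splits)
  have partial: "fst (F n) y = f y - d (\<lambda>x. \<Sum>k<n. g k x) y" if "y \<in> B" for n y
    by (induction n) (use that in \<open>simp_all add: F(2,3) d_zero d_add flip: g_def\<close>)
  have small: "\<bar>fst (F n) y\<bar> \<le> r ^ n * M" if "y \<in> B" for n y
    using F(1)[of n] that by (auto simp: good_def split: prod.splits)
  have "summable (\<lambda>n. r ^ n * M)"
    using r by (intro summable_mult2 summable_geometric) auto
  then have sums: "(\<lambda>n. r ^ n * M) sums ((1 + \<epsilon>) * M)"
    using geometric_sums[of r] r \<epsilon> sums_mult2[of "\<lambda>n. r ^ n" "1 / (1 - r)" M]
    by (simp add: r_def field_simps)
  define h where "h = (\<lambda>x. suminf (\<lambda>n. g n x))"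
  have lim: "uniform_limit A (\<lambda>n x. \<Sum>k<n. g k x) h sequentially"
    unfolding h_def by (rule Weierstrass_m_test[OF _ sums_summable[OF sums]]) (simp add: g(2))
  have "cont h"
  proof (rule cont_lim[OF _ lim])
    show "cont (\<lambda>x. \<Sum>k<n. g k x)" for n
      using cont_sum[of "{..<n}" g] g(1) by simp
  qed
  moreover have "\<bar>h x\<bar> \<le> (1 + \<epsilon>) * M" if "x \<in> A" for x
  proof -
    have "summable (\<lambda>n. \<bar>g n x\<bar>)"
      by (rule summable_comparison_test'[OF sums_summable[OF sums], of 0]) (simp add: g(2)[OF that])
    then have "\<bar>h x\<bar> \<le> suminf (\<lambda>n. \<bar>g n x\<bar>)"
      using summable_rabs[of "\<lambda>n. g n x"] by (simp add: h_def)
    also have "\<dots> \<le> suminf (\<lambda>n. r ^ n * M)"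
      using suminf_le[of "\<lambda>n. \<bar>g n x\<bar>" "\<lambda>n. r ^ n * M"] g(2)[OF that] \<open>summable (\<lambda>n. \<bar>g n x\<bar>)\<close> sums_summable[OF sums]
      by simp
    finally show ?thesis using sums by (simp add: sums_iff)
  qed
  moreover have "d h y = f y" if y: "y \<in> B" for y
  proof -
    have "(\<lambda>n. d (\<lambda>x. \<Sum>k<n. g k x) y) \<longlonglongrightarrow> d h y"
    proof (rule LIMSEQ_I)
      fix e :: real assume "e > 0"
      \<comment> \<open>\<open>K\<close> carries no sign assumption, hence the positive denominator
        \<open>\<bar>K\<bar> + 1\<close>.\<close>
      define e' where "e' = e / (\<bar>K\<bar> + 1)"
      have e': "e' > 0" "K * e' < e"
        using \<open>e > 0\<close> by (auto simp: e'_def pos_divide_less_eq abs_if algebra_simps split: if_splits)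
      have "\<forall>\<^sub>F n in sequentially. \<forall>x\<in>A. \<bar>(\<Sum>k<n. g k x) - h x\<bar> < e'"
        using uniform_limitD[OF lim e'(1)] by (simp add: dist_real_def)
      then obtain N where N: "\<And>n x. n \<ge> N \<Longrightarrow> x \<in> A \<Longrightarrow> \<bar>(\<Sum>k<n. g k x) - h x\<bar> < e'"
        by (auto simp: eventually_sequentially)
      have "norm (d (\<lambda>x. \<Sum>k<n. g k x) y - d h y) < e" if "n \<ge> N" for n
        using d_bound[OF y, of "\<lambda>x. (\<Sum>k<n. g k x) - h x" e'] N[OF that] e'(2)
        by (force simp: d_diff[OF y] less_imp_le)
      then show "\<exists>N. \<forall>n\<ge>N. norm (d (\<lambda>x. \<Sum>k<n. g k x) y - d h y) < e" by blast
    qed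
    moreover have "(\<lambda>n. d (\<lambda>x. \<Sum>k<n. g k x) y) \<longlonglongrightarrow> f y"
    proof -
      have "(\<lambda>n. r ^ n * M) \<longlonglongrightarrow> 0"
        using r by (intro tendsto_mult_left_zero LIMSEQ_power_zero) auto
      then have "(\<lambda>n. fst (F n) y) \<longlonglongrightarrow> 0"
        by (rule Lim_null_comparison[rotated]) (simp add: small[OF y])
      then have "(\<lambda>n. f y - fst (F n) y) \<longlonglongrightarrow> f y - 0"
        by (intro tendsto_intros)
      then show ?thesis by (simp add: partial[OF y])
    qed
    ultimately show ?thesis by (rule LIMSEQ_unique)
  qed
  ultimately show ?thesis by blast
qed

end

lemma continuous_map_real_uniform_limit:
  fixes g :: "nat \<Rightarrow> 'x \<Rightarrow> real"
  assumes "\<And>n. continuous_map X euclideanreal (g n)" "uniform_limit (topspace X) g l sequentially"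
  shows "continuous_map X euclideanreal l"
proof -
  have "continuous_map X Met_TC.mtopology l"
  proof (rule Met_TC.continuous_map_uniform_limit[where F = sequentially and f = g])
    show "\<forall>\<^sub>F n in sequentially. continuous_map X Met_TC.mtopology (g n)"
      using assms(1) by simp
    show "\<forall>\<^sub>F n in sequentially. \<forall>x\<in>topspace X. l x \<in> UNIV \<and> dist (g n x) (l x) < e" if "0 < e" for e
      using uniform_limitD[OF assms(2) that] by simp
  qed simp
  then show ?thesis by simp
qed

section \<open>Profinite spaces and simplicial identities\<close>

lemma separating_function:
  assumes X: "compact_space X" "Hausdorff_space X" and ab: "a \<in> topspace X" "b \<in> topspace X" "a \<noteq> b"
  obtains \<phi> where "continuous_map X euclideanreal \<phi>" "\<phi> a = 0" "\<phi> b = 1"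
proof -
  have "normal_space X" using X by (simp add: compact_Hausdorff_or_regular_imp_normal_space)
  moreover have "closedin X {a}" "closedin X {b}" "disjnt {a} {b}"
    using X ab by (auto simp: closedin_Hausdorff_singleton)
  ultimately obtain f where "continuous_map X (top_of_set {0..1::real}) f" "f ` {a} \<subseteq> {0}" "f ` {b} \<subseteq> {1}"
    by (metis Urysohn_lemma zero_le_one)
  then show ?thesis using that[of f] by (auto simp: continuous_map_in_subtopology)
qed

text \<open>The target carries no topology: the values are points, sets of centres or tuples of
  points, all treated as discrete.\<close>

definition locally_constant :: "'a topology \<Rightarrow> ('a \<Rightarrow> 'b) \<Rightarrow> bool"
  where "locally_constant X h \<longleftrightarrow> (\<forall>x\<in>topspace X. openin X {y \<in> topspace X. h y = h x})"

lemma locally_constantI: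
  assumes "\<And>x. x \<in> topspace X \<Longrightarrow> \<exists>U. openin X U \<and> x \<in> U \<and> (\<forall>y\<in>U. h y = h x)"
  shows "locally_constant X h"
  unfolding locally_constant_def
proof
  fix x assume "x \<in> topspace X"
  show "openin X {y \<in> topspace X. h y = h x}"
  proof (subst openin_subopen, clarify)
    fix y assume y: "y \<in> topspace X" "h y = h x"
    obtain U where "openin X U" "y \<in> U" "\<forall>z\<in>U. h z = h y" using assms[OF y(1)] by blast
    then show "\<exists>T. openin X T \<and> y \<in> T \<and> T \<subseteq> {y \<in> topspace X. h y = h x}"
      using y(2) openin_subset by (intro exI[of _ U]) fastforce
  qed
qed

lemma openin_locally_constant_preimage:
  assumes "locally_constant X h"
  shows "openin X {x \<in> topspace X. P (h x)}"
  by (subst openin_subopen) (use assms in \<open>force simp: locally_constant_def\<close>)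

text \<open>\<open>f\<close> is arbitrary, since the composite is constant on each open fibre of
  \<open>h\<close>. In this way a cochain composed with an approximate contraction is
  continuous.\<close>

lemma continuous_map_locally_constant:
  assumes "locally_constant X h" "\<And>x. x \<in> topspace X \<Longrightarrow> f (h x) \<in> topspace Y"
  shows "continuous_map X Y (\<lambda>x. f (h x))"
  using assms openin_locally_constant_preimage[OF assms(1), of "\<lambda>z. f z \<in> U" for U]
  by (auto simp: continuous_map_def)

lemma locally_constant_compose:
  assumes "locally_constant Y h" "continuous_map X Y c"
  shows "locally_constant X (\<lambda>x. h (c x))"
  unfolding locally_constant_def
proof
  fix x assume x: "x \<in> topspace X"
  have "openin X {y \<in> topspace X. c y \<in> {z \<in> topspace Y. h z = h (c x)}}"
    using openin_locally_constant_preimage[OF assms(1)] by (rule openin_continuous_map_preimage[OF assms(2)])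
  moreover have "{y \<in> topspace X. c y \<in> {z \<in> topspace Y. h z = h (c x)}} = {y \<in> topspace X. h (c y) = h (c x)}"
    using assms(2) by (auto simp: continuous_map_def)
  ultimately show "openin X {y \<in> topspace X. h (c y) = h (c x)}" by simp
qed

lemma locally_constant_family:
  assumes "finite J" "\<And>j. j \<in> J \<Longrightarrow> locally_constant X (h j)"
  shows "locally_constant X (\<lambda>x. \<lambda>j\<in>J. h j x)"
proof (rule locally_constantI)
  fix x assume x: "x \<in> topspace X"
  have "openin X (\<Inter>(insert (topspace X) ((\<lambda>j. {y \<in> topspace X. h j y = h j x}) ` J)))"
    using assms x by (intro openin_Inter) (auto simp: locally_constant_def)
  then show "\<exists>U. openin X U \<and> x \<in> U \<and> (\<forall>y\<in>U. (\<lambda>j\<in>J. h j y) = (\<lambda>j\<in>J. h j x))"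
    using x by (intro exI[of _ "\<Inter>(insert (topspace X) ((\<lambda>j. {y \<in> topspace X. h j y = h j x}) ` J))"])
      (auto simp: restrict_def fun_eq_iff)
qed

text \<open>In a compact Hausdorff space quasi-components are components, here single points, and a
  quasi-component can be separated by a clopen set from a compact set disjoint from it, such as the
  complement of \<open>W\<close>.\<close>

lemma profinite_clopen_base:
  assumes X: "profinite_space X" and W: "openin X W" "x \<in> W"
  obtains C where "openin X C" "closedin X C" "x \<in> C" "C \<subseteq> W"
proof -
  have c: "compact_space X" "Hausdorff_space X" and tot: "\<And>C. connectedin X C \<Longrightarrow> \<exists>x. C \<subseteq> {x}"
    using X by (auto simp: profinite_space_def)
  have x: "x \<in> topspace X" using W openin_subset by blast
  have eq: "quasi_component_of X x = connected_component_of X x"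
    using c by (intro quasi_eq_connected_component_of) auto
  then have "connectedin X (quasi_component_of_set X x)"
    by (simp add: connectedin_connected_component_of)
  then obtain z where "quasi_component_of_set X x \<subseteq> {z}" using tot by blast
  moreover have "x \<in> quasi_component_of_set X x" using x by simp
  ultimately have "quasi_component_of_set X x = {x}" by blast
  then have "{x} \<in> quasi_components_of X" using x by (auto simp: quasi_components_of_def image_iff intro: bexI[of _ x])
  moreover have "compactin X (topspace X - W)"
    using c W by (intro closedin_compact_space) auto
  ultimately have "separated_between X {x} (topspace X - W)"
    using separated_between_quasi_component_compact W(2) by (metis DiffD2 disjnt_insert1 disjnt_empty1)
  then obtain U where U: "closedin X U" "openin X U" "{x} \<subseteq> U" "topspace X - W \<subseteq> topspace X - U"
    unfolding separated_between by blast
  moreover have "U \<subseteq> W" using U(4) openin_subset[OF U(2)] by blast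
  ultimately show ?thesis using that[of U] by simp
qed

text \<open>Finitely many clopen sets, on each of which every test function stays within
  \<open>\<epsilon> / 2\<close> of its value at a centre, cover the space. The label of a point
  records which of these sets contain it, so points with equal labels share one of them.\<close>

lemma profinite_fine_partition:
  assumes X: "profinite_space X" and \<Phi>: "finite \<Phi>" "\<And>\<phi>. \<phi> \<in> \<Phi> \<Longrightarrow> continuous_map X euclideanreal \<phi>" and \<epsilon>: "0 < \<epsilon>"
  obtains \<iota> :: "'a \<Rightarrow> 'a set" where "locally_constant X \<iota>"
    "\<forall>x\<in>topspace X. \<forall>y\<in>topspace X. \<iota> x = \<iota> y \<longrightarrow> (\<forall>\<phi>\<in>\<Phi>. \<bar>\<phi> x - \<phi> y\<bar> < \<epsilon>)"
proof -
  have "\<exists>C. openin X C \<and> closedin X C \<and> x \<in> C \<and> (\<forall>y\<in>C. \<forall>\<phi>\<in>\<Phi>. \<bar>\<phi> y - \<phi> x\<bar> < \<epsilon> / 2)" if x: "x \<in> topspace X" for x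
  proof -
    define W where "W = \<Inter>(insert (topspace X) ((\<lambda>\<phi>. {y \<in> topspace X. \<bar>\<phi> y - \<phi> x\<bar> \<in> {..<\<epsilon> / 2}}) ` \<Phi>))"
    have "openin X W"
      unfolding W_def using \<Phi>
      by (intro openin_Inter)
         (auto intro!: openin_continuous_map_preimage[where Y = euclideanreal] continuous_intros simp del: lessThan_iff)
    moreover have "x \<in> W" using x \<epsilon> by (auto simp: W_def)
    ultimately obtain C where "openin X C" "closedin X C" "x \<in> C" "C \<subseteq> W"
      using profinite_clopen_base[OF X] by metis
    then show ?thesis by (intro exI[of _ C]) (auto simp: W_def)
  qed
  then obtain C where C: "\<And>x. x \<in> topspace X \<Longrightarrow> openin X (C x) \<and> closedin X (C x) \<and> x \<in> C x"
    "\<And>x y \<phi>. x \<in> topspace X \<Longrightarrow> y \<in> C x \<Longrightarrow> \<phi> \<in> \<Phi> \<Longrightarrow> \<bar>\<phi> y - \<phi> x\<bar> < \<epsilon> / 2"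
    by metis
  have "topspace X \<subseteq> \<Union>(C ` topspace X)" "\<forall>U \<in> C ` topspace X. openin X U" using C by blast+
  then obtain \<F> where "finite \<F>" "\<F> \<subseteq> C ` topspace X" "topspace X \<subseteq> \<Union>\<F>"
    using X unfolding profinite_space_def compact_space_alt by metis
  then obtain F where F: "finite F" "F \<subseteq> topspace X" "topspace X \<subseteq> \<Union>(C ` F)"
    by (metis finite_subset_image)
  show ?thesis
  proof (rule that[of "\<lambda>y. {x \<in> F. y \<in> C x}"])
    show "locally_constant X (\<lambda>y. {x \<in> F. y \<in> C x})"
    proof (rule locally_constantI)
      fix y assume y: "y \<in> topspace X"
      have "openin X (\<Inter>(insert (topspace X) ((\<lambda>x. if y \<in> C x then C x else topspace X - C x) ` F)))"
        using F C by (intro openin_Inter) auto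
      then show "\<exists>U. openin X U \<and> y \<in> U \<and> (\<forall>z\<in>U. {x \<in> F. z \<in> C x} = {x \<in> F. y \<in> C x})"
        using y by (intro exI[of _ "\<Inter>(insert (topspace X) ((\<lambda>x. if y \<in> C x then C x else topspace X - C x) ` F))"])
          (auto split: if_splits)
    qed
    have "\<bar>\<phi> x - \<phi> y\<bar> < \<epsilon>" 
      if xy: "x \<in> topspace X" "y \<in> topspace X" "{z \<in> F. x \<in> C z} = {z \<in> F. y \<in> C z}" "\<phi> \<in> \<Phi>" for x y \<phi>
    proof -
      obtain z where z: "z \<in> F" "x \<in> C z" using F xy(1) by blast
      then have "y \<in> C z" using xy(3) by blast
      have "z \<in> topspace X" using z F by blast
      then have "\<bar>\<phi> x - \<phi> z\<bar> < \<epsilon> / 2" "\<bar>\<phi> y - \<phi> z\<bar> < \<epsilon> / 2"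
        using C(2) z \<open>y \<in> C z\<close> xy(4) by auto
      then show ?thesis by linarith
    qed
    then show "\<forall>x\<in>topspace X. \<forall>y\<in>topspace X. {z \<in> F. x \<in> C z} = {z \<in> F. y \<in> C z} \<longrightarrow>
        (\<forall>\<phi>\<in>\<Phi>. \<bar>\<phi> x - \<phi> y\<bar> < \<epsilon>)" by blast
  qed
qed

text \<open>The tube lemma: a map from a compact to a Hausdorff space is closed, and the set in
  question is the complement of the image of the complement of \<open>W\<close>.\<close>

lemma openin_fibres_in:
  assumes "continuous_map X S q" "compact_space X" "Hausdorff_space S" "openin X W"
  shows "openin S {s \<in> topspace S. \<forall>x\<in>topspace X. q x = s \<longrightarrow> x \<in> W}"
proof -
  have "closedin S (q ` (topspace X - W))"
    using continuous_imp_closed_map[OF assms(1-3)] assms(4) by (auto simp: closed_map_def)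
  then have "openin S (topspace S - q ` (topspace X - W))" by blast
  moreover have "topspace S - q ` (topspace X - W) = {s \<in> topspace S. \<forall>x\<in>topspace X. q x = s \<longrightarrow> x \<in> W}"
    by blast
  ultimately show ?thesis by simp
qed

section \<open>Simplicial identities and the augmentation\<close>

lemma coface_ord_maps: "i \<le> n \<Longrightarrow> coface n i \<in> ord_maps n (Suc n)"
  by (auto simp: ord_maps_def coface_def monotone_on_def)

lemma ord_maps_compose: "\<theta> \<in> ord_maps k m \<Longrightarrow> \<rho> \<in> ord_maps m n \<Longrightarrow> compose {..<k} \<rho> \<theta> \<in> ord_maps k n"
  by (fastforce simp: ord_maps_def monotone_on_def compose_def PiE_iff)

lemma coface_coface:
  assumes "i < j" "j \<le> Suc n"
  shows "compose {..<n} (coface (Suc n) j) (coface n i) = compose {..<n} (coface (Suc n) i) (coface n (j - 1))"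
  using assms by (auto simp: compose_def coface_def fun_eq_iff)

definition face :: "'a aug_simplicial \<Rightarrow> nat \<Rightarrow> nat \<Rightarrow> 'a \<Rightarrow> 'a"
  where "face A n i = act A n (Suc n) (coface n i)"

text \<open>The composite augmentation down to \<open>S\<close>: the action of the unique map from
  the empty ordinal, whose extensional normal form is \<open>\<lambda>_. undefined\<close>.\<close>

definition base :: "'a aug_simplicial \<Rightarrow> nat \<Rightarrow> 'a \<Rightarrow> 'a"
  where "base A n = act A 0 n (\<lambda>_. undefined)"

lemma empty_ord_map: "(\<lambda>_. undefined) \<in> ord_maps 0 n" and ord_maps_0: "\<theta> \<in> ord_maps 0 n \<Longrightarrow> \<theta> = (\<lambda>_. undefined)"
  by (auto simp: ord_maps_def)

context
  fixes A :: "'a aug_simplicial"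
  assumes A: "aug_simplicial_space A"
begin

lemma continuous_map_act: "\<theta> \<in> ord_maps m n \<Longrightarrow> continuous_map (level A n) (level A m) (act A m n \<theta>)"
  using A by (auto simp: aug_simplicial_space_def cmap_def)

lemma act_in: "\<theta> \<in> ord_maps m n \<Longrightarrow> x \<in> topspace (level A n) \<Longrightarrow> act A m n \<theta> x \<in> topspace (level A m)"
  using continuous_map_act by (auto simp: continuous_map_def)

lemma act_compose:
  "\<theta> \<in> ord_maps k m \<Longrightarrow> \<rho> \<in> ord_maps m n \<Longrightarrow> x \<in> topspace (level A n) \<Longrightarrow>
    act A k n (compose {..<k} \<rho> \<theta>) x = act A k m \<theta> (act A m n \<rho> x)"
  using A by (simp add: aug_simplicial_space_def compose_def)

lemma act_id: "x \<in> topspace (level A n) \<Longrightarrow> act A n n (restrict id {..<n}) x = x"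
  using A by (simp add: aug_simplicial_space_def)

lemma continuous_map_face: "i \<le> n \<Longrightarrow> continuous_map (level A (Suc n)) (level A n) (face A n i)"
  unfolding face_def by (intro continuous_map_act coface_ord_maps)

lemma face_in: "i \<le> n \<Longrightarrow> x \<in> topspace (level A (Suc n)) \<Longrightarrow> face A n i x \<in> topspace (level A n)"
  unfolding face_def by (intro act_in coface_ord_maps)

lemma face_face:
  assumes "i < j" "j \<le> Suc n" "x \<in> topspace (level A (Suc (Suc n)))"
  shows "face A n i (face A (Suc n) j x) = face A n (j - 1) (face A (Suc n) i x)"
  using assms coface_coface[OF assms(1,2)] coface_ord_maps[of _ n] coface_ord_maps[of _ "Suc n"]
  by (simp add: face_def flip: act_compose)

lemma continuous_map_base: "continuous_map (level A n) (level A 0) (base A n)"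
  unfolding base_def by (intro continuous_map_act empty_ord_map)

lemma base_in: "x \<in> topspace (level A n) \<Longrightarrow> base A n x \<in> topspace (level A 0)"
  unfolding base_def by (intro act_in empty_ord_map)

lemma base_0: "x \<in> topspace (level A 0) \<Longrightarrow> base A 0 x = x"
  using act_id[of x 0] by (simp add: base_def restrict_def)

lemma base_face: "i \<le> n \<Longrightarrow> x \<in> topspace (level A (Suc n)) \<Longrightarrow> base A n (face A n i x) = base A (Suc n) x"
  using act_compose[OF empty_ord_map coface_ord_maps, of i n x]
  by (simp add: base_def face_def compose_def restrict_def)

end

section \<open>Approximate contractions of hypercovers\<close>

text \<open>For a monotone map missing \<open>j\<close> this is its factor through the coface that
  omits \<open>j\<close>; elsewhere it has no meaning.\<close>

definition skip :: "nat \<Rightarrow> nat \<Rightarrow> (nat \<Rightarrow> nat) \<Rightarrow> nat \<Rightarrow> nat"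
  where "skip k j \<theta> = (\<lambda>i\<in>{..<k}. if \<theta> i < j then \<theta> i else \<theta> i - 1)"

lemma skip_ord_maps:
  assumes "\<theta> \<in> ord_maps k (Suc l)" "j \<le> l" "j \<notin> \<theta> ` {..<k}"
  shows "skip k j \<theta> \<in> ord_maps k l"
proof -
  have "\<theta> i \<le> l" "\<theta> i \<noteq> j" if "i < k" for i
    using assms that by (force simp: ord_maps_def PiE_iff)+
  then show ?thesis
    using assms by (fastforce simp: ord_maps_def skip_def monotone_on_def)
qed

lemma coface_skip:
  assumes "\<theta> \<in> ord_maps k (Suc l)" "j \<le> l" "j \<notin> \<theta> ` {..<k}"
  shows "compose {..<k} (coface l j) (skip k j \<theta>) = \<theta>"
proof
  fix i
  show "compose {..<k} (coface l j) (skip k j \<theta>) i = \<theta> i"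
  proof (cases "i < k")
    case True
    then have "\<theta> i \<le> l" "\<theta> i \<noteq> j" using assms by (force simp: ord_maps_def PiE_iff)+
    then show ?thesis using True assms(2) by (auto simp: compose_def coface_def skip_def)
  next
    case False
    then show ?thesis using assms(1) by (auto simp: compose_def ord_maps_def PiE_iff extensional_def)
  qed
qed

lemma skip_coface: "skip l j (coface l j) = restrict id {..<l}"
  by (auto simp: skip_def coface_def fun_eq_iff)

lemma skip_compose: "\<alpha> \<in> ord_maps m k \<Longrightarrow> skip m j (compose {..<m} \<theta> \<alpha>) = compose {..<m} (skip k j \<theta>) \<alpha>"
  by (auto simp: skip_def compose_def fun_eq_iff ord_maps_def)

text \<open>A point of the coskeleton one level up is a tuple of points with matching faces. A
  monotone map from at most \<open>l\<close> elements into \<open>Suc l\<close> elements misses some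
  \<open>j\<close>, so its coordinate must come from \<open>y j\<close>; if it misses two indices,
  it factors through both cofaces and \<open>match\<close> makes the two prescriptions equal. For
  \<open>l = 0\<close> there is nothing to match.\<close>

lemma hypercover_lift:
  assumes H: "hypercover S A"
    and y: "\<And>j. j \<le> l \<Longrightarrow> y j \<in> topspace (level A l)"
    and match: "\<And>m i j. l = Suc m \<Longrightarrow> i < j \<Longrightarrow> j \<le> l \<Longrightarrow> face A m i (y j) = face A m (j - 1) (y i)"
  shows "\<exists>z\<in>topspace (level A (Suc l)). \<forall>j\<le>l. face A l j z = y j"
proof -
  have A: "aug_simplicial_space A" using H by (simp add: hypercover_def)
  have indep: "act A k l (skip k i \<theta>) (y i) = act A k l (skip k j \<theta>) (y j)"
    if \<theta>: "\<theta> \<in> ord_maps k (Suc l)" and ij: "i < j" "j \<le> l" and miss: "i \<notin> \<theta> ` {..<k}" "j \<notin> \<theta> ` {..<k}" for k \<theta> i j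
  proof -
    obtain m where l: "l = Suc m" using ij by (cases l) auto
    have range: "\<theta> a \<noteq> i" "\<theta> a \<noteq> j" if "a < k" for a using miss that by auto
    \<comment> \<open>The common factor of \<open>\<theta>\<close> after both missed indices are
      removed; removing the smaller one first shifts \<open>j\<close> to
      \<open>j - 1\<close>.\<close>
    define \<rho> where "\<rho> = skip k i (skip k j \<theta>)"
    have \<rho>2: "\<rho> = skip k (j - 1) (skip k i \<theta>)"
      using ij range by (fastforce simp: \<rho>_def skip_def fun_eq_iff)
    have oj: "skip k j \<theta> \<in> ord_maps k (Suc m)" and oi: "skip k i \<theta> \<in> ord_maps k (Suc m)"
      using \<theta> ij miss l by (auto intro: skip_ord_maps)
    have mj: "i \<notin> skip k j \<theta> ` {..<k}"
    proof
      assume "i \<in> skip k j \<theta> ` {..<k}"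
      then obtain a where "a < k" "i = skip k j \<theta> a" by auto
      then show False using range[of a] ij by (auto simp: skip_def split: if_splits)
    qed
    have mi: "j - 1 \<notin> skip k i \<theta> ` {..<k}"
    proof
      assume "j - 1 \<in> skip k i \<theta> ` {..<k}"
      then obtain a where "a < k" "j - 1 = skip k i \<theta> a" by auto
      then show False using range[of a] ij by (auto simp: skip_def split: if_splits)
    qed
    have \<rho>: "\<rho> \<in> ord_maps k m"
      unfolding \<rho>_def using skip_ord_maps[OF oj] mj ij l by simp
    have "act A k l (skip k j \<theta>) (y j) = act A k m \<rho> (face A m i (y j))"
      using coface_skip[OF oj _ mj] act_compose[OF A \<rho> coface_ord_maps, of i "y j"] ij l y
      by (simp add: face_def flip: \<rho>_def)
    also have "\<dots> = act A k m \<rho> (face A m (j - 1) (y i))"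
      using match[OF l] ij by simp
    also have "\<dots> = act A k l (skip k i \<theta>) (y i)"
    proof -
      have "j - 1 \<le> m" using ij l by simp
      then show ?thesis
        using coface_skip[OF oi _ mi, folded \<rho>2] act_compose[OF A \<rho> coface_ord_maps, of "j - 1" "y i"] ij l y
        by (simp add: face_def)
    qed
    finally show ?thesis by simp
  qed
  \<comment> \<open>\<open>k \<le> l\<close> elements cannot hit all \<open>l + 1\<close>
    indices.\<close>
  have missed: "\<exists>j\<le>l. j \<notin> \<theta> ` {..<k}" if "k \<le> l" for k and \<theta> :: "nat \<Rightarrow> nat"
  proof (rule ccontr)
    assume "\<not> (\<exists>j\<le>l. j \<notin> \<theta> ` {..<k})"
    then have "{..l} \<subseteq> \<theta> ` {..<k}" by auto
    then have "card {..l} \<le> card {..<k}" using surj_card_le by blast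
    then show False using that by simp
  qed
  define miss where "miss k \<theta> = (SOME j. j \<le> l \<and> j \<notin> \<theta> ` {..<k})" for k and \<theta> :: "nat \<Rightarrow> nat"
  have miss: "miss k \<theta> \<le> l" "miss k \<theta> \<notin> \<theta> ` {..<k}" if "k \<le> l" for k \<theta>
    using someI_ex[OF missed[OF that, of \<theta>]] by (simp_all add: miss_def)
  \<comment> \<open>The point of the coskeleton to be lifted. By \<open>indep\<close> any other
    missed index gives the same coordinate.\<close>
  define Y where "Y = (\<lambda>(k, \<theta>) \<in> (SIGMA k:{..l}. ord_maps k (Suc l)). act A k l (skip k (miss k \<theta>) \<theta>) (y (miss k \<theta>)))"
  have Y: "Y (k, \<theta>) = act A k l (skip k j \<theta>) (y j)"
    if "k \<le> l" "\<theta> \<in> ord_maps k (Suc l)" "j \<le> l" "j \<notin> \<theta> ` {..<k}" for k \<theta> j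
  proof -
    have "Y (k, \<theta>) = act A k l (skip k (miss k \<theta>) \<theta>) (y (miss k \<theta>))"
      using that(1,2) by (simp add: Y_def)
    also have "\<dots> = act A k l (skip k j \<theta>) (y j)"
    proof (cases "miss k \<theta>" j rule: linorder_cases)
      case less
      then show ?thesis by (rule indep[OF that(2) _ that(3) miss(2)[OF that(1)] that(4)])
    next
      case greater
      then show ?thesis by (rule indep[OF that(2) _ miss(1)[OF that(1)] that(4) miss(2)[OF that(1)], symmetric])
    qed simp
    finally show ?thesis .
  qed
  have "Y \<in> coskeleton A l (Suc l)"
    unfolding coskeleton_def
  proof (intro CollectI conjI allI impI ballI)
    show "Y \<in> (\<Pi>\<^sub>E (k, \<theta>) \<in> (SIGMA k:{..l}. ord_maps k (Suc l)). topspace (level A k))"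
    proof -
      have "act A k l (skip k (miss k \<theta>) \<theta>) (y (miss k \<theta>)) \<in> topspace (level A k)"
        if "k \<le> l" "\<theta> \<in> ord_maps k (Suc l)" for k \<theta>
        by (rule act_in[OF A skip_ord_maps[OF that(2) miss[OF that(1)]] y[OF miss(1)[OF that(1)]]])
      then show ?thesis by (auto simp: Y_def)
    qed
    fix k m \<theta> \<alpha> assume k: "k \<le> l" "m \<le> l" and \<theta>: "\<theta> \<in> ord_maps k (Suc l)" "\<alpha> \<in> ord_maps m k"
    obtain j where j: "j \<le> l" "j \<notin> \<theta> ` {..<k}" using missed[OF k(1)] by blast
    have "\<alpha> a < k" if "a < m" for a using \<theta>(2) that by (auto simp: ord_maps_def)
    then have j': "j \<notin> compose {..<m} \<theta> \<alpha> ` {..<m}" using j by (auto simp: compose_def)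
    show "Y (m, compose {..<m} \<theta> \<alpha>) = act A m k \<alpha> (Y (k, \<theta>))"
      using Y[OF k(2) ord_maps_compose[OF \<theta>(2,1)] j(1) j'] Y[OF k(1) \<theta>(1) j] 
        act_compose[OF A \<theta>(2) skip_ord_maps[OF \<theta>(1) j] y[OF j(1)]] skip_compose[OF \<theta>(2)]
      by simp
  qed
  then obtain z where z: "z \<in> topspace (level A (Suc l))" "to_coskeleton A l (Suc l) z = Y"
    using H unfolding hypercover_def by (metis imageE)
  have "face A l j z = y j" if "j \<le> l" for j
  proof -
    have "face A l j z = Y (l, coface l j)"
      using that coface_ord_maps unfolding z(2)[symmetric] by (simp add: to_coskeleton_def face_def)
    also have "\<dots> = y j"
    proof -
      have "j \<notin> coface l j ` {..<l}" by (auto simp: coface_def)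
      then show ?thesis
        using Y[OF order.refl coface_ord_maps[OF that] that] y[OF that] by (simp add: skip_coface act_id[OF A])
    qed
    finally show ?thesis .
  qed
  with z show ?thesis by blast
qed

text \<open>By compactness, a tuple of simplices whose faces almost match is close to one whose faces match.\<close>

lemma hypercover_approximate_lift:
  assumes H: "hypercover S A" and \<Phi>: "finite \<Phi>" "\<And>\<phi>. \<phi> \<in> \<Phi> \<Longrightarrow> continuous_map (level A (Suc m)) euclideanreal \<phi>"
    and \<epsilon>: "0 < \<epsilon>"
  obtains \<Psi> where "finite \<Psi>" "\<And>\<psi>. \<psi> \<in> \<Psi> \<Longrightarrow> continuous_map (level A m) euclideanreal \<psi>"
    "\<And>y. (\<And>j. j \<le> Suc m \<Longrightarrow> y j \<in> topspace (level A (Suc m))) \<Longrightarrow>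
       (\<And>i j \<psi>. i < j \<Longrightarrow> j \<le> Suc m \<Longrightarrow> \<psi> \<in> \<Psi> \<Longrightarrow> \<bar>\<psi> (face A m i (y j)) - \<psi> (face A m (j - 1) (y i))\<bar> < 1 / 2) \<Longrightarrow>
       \<exists>z\<in>topspace (level A (Suc (Suc m))). \<forall>j\<le>Suc m. \<forall>\<phi>\<in>\<Phi>. \<bar>\<phi> (face A (Suc m) j z) - \<phi> (y j)\<bar> < \<epsilon>"
proof -
  let ?L = "level A (Suc m)" and ?P = "product_topology (\<lambda>_. level A (Suc m)) {..Suc m}"
  have A: "aug_simplicial_space A" and cpt: "\<And>n. compact_space (level A n)" "\<And>n. Hausdorff_space (level A n)"
    using H by (auto simp: hypercover_def)
  define good where "good y z \<longleftrightarrow> (\<forall>j\<le>Suc m. \<forall>\<phi>\<in>\<Phi>. \<bar>\<phi> (face A (Suc m) j z) - \<phi> (y j)\<bar> < \<epsilon>)" for y z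
  define gap where "gap \<psi> i j y = \<bar>\<psi> (face A m i (y j)) - \<psi> (face A m (j - 1) (y i))\<bar>"
    for \<psi> :: "'a \<Rightarrow> real" and i j y
  have cont_coord: "continuous_map ?P euclideanreal (\<lambda>y. \<phi> (y j))" 
    if "continuous_map ?L euclideanreal \<phi>" "j \<le> Suc m" for \<phi> j
    using continuous_map_compose[of ?P ?L "\<lambda>y. y j", OF _ that(1)] that(2)
      continuous_map_product_projection[of j "{..Suc m}" "\<lambda>_. ?L"]
    by (simp add: o_def)
  have open_good: "openin ?P {y \<in> topspace ?P. good y z}" if z: "z \<in> topspace (level A (Suc (Suc m)))" for z
  proof -
    have eq: "{y \<in> topspace ?P. good y z} =
       \<Inter>(insert (topspace ?P) ((\<lambda>(j, \<phi>). {y \<in> topspace ?P. \<bar>\<phi> (face A (Suc m) j z) - \<phi> (y j)\<bar> \<in> {..<\<epsilon>}}) ` ({..Suc m} \<times> \<Phi>)))"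
      by (auto simp: good_def)
    show ?thesis
      unfolding eq using \<Phi>
      by (intro openin_Inter)
         (auto intro!: openin_continuous_map_preimage[where Y = euclideanreal] continuous_intros cont_coord simp del: lessThan_iff topspace_product_topology)
  qed
  \<comment> \<open>Near each tuple one witness works uniformly: either one simplex \<open>z\<close>
    whose faces are close to the tuple, or one function \<open>\<psi>\<close> that sees a mismatch
    of faces. By compactness finitely many functions \<open>\<psi>\<close> then suffice.\<close>
  define nbhd where "nbhd y U \<psi> \<longleftrightarrow> openin ?P U \<and> y \<in> U \<and> continuous_map (level A m) euclideanreal \<psi> \<and>
      (\<forall>w\<in>U. (\<exists>z\<in>topspace (level A (Suc (Suc m))). good w z) \<or> (\<exists>i j. i < j \<and> j \<le> Suc m \<and> \<not> gap \<psi> i j w < 1 / 2))"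
    for y U \<psi>
  have "\<exists>U \<psi>. nbhd y U \<psi>" if y: "y \<in> topspace ?P" for y
  proof (cases "\<exists>z\<in>topspace (level A (Suc (Suc m))). good y z")
    case True
    then obtain z where "z \<in> topspace (level A (Suc (Suc m)))" "good y z" by blast
    then show ?thesis
      using open_good y unfolding nbhd_def
      by (intro exI[of _ "{y \<in> topspace ?P. good y z}"] exI[of _ "\<lambda>_. 0"]) auto
  next
    case False
    have yj: "y j \<in> topspace ?L" if "j \<le> Suc m" for j using y that by (auto simp: PiE_iff)
    \<comment> \<open>If all faces matched, \<open>hypercover_lift\<close> would give an exact lift,
      which is certainly good.\<close>
    have "\<exists>i j. i < j \<and> j \<le> Suc m \<and> face A m i (y j) \<noteq> face A m (j - 1) (y i)"
    proof (rule ccontr)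
      assume "\<not> ?thesis"
      then have "\<exists>z\<in>topspace (level A (Suc (Suc m))). \<forall>j\<le>Suc m. face A (Suc m) j z = y j"
        using yj by (intro hypercover_lift[OF H]) auto
      then show False using False \<epsilon> by (auto simp: good_def)
    qed
    then obtain i j where ij: "i < j" "j \<le> Suc m" "face A m i (y j) \<noteq> face A m (j - 1) (y i)" by blast
    have "face A m i (y j) \<in> topspace (level A m)" "face A m (j - 1) (y i) \<in> topspace (level A m)"
      using ij yj by (auto intro!: face_in[OF A])
    \<comment> \<open>The gap equals 1 at \<open>y\<close> and hence stays above 1/2 nearby; this is
      where the threshold 1/2 comes from.\<close>
    then obtain \<psi> where \<psi>: "continuous_map (level A m) euclideanreal \<psi>"
      "\<psi> (face A m i (y j)) = 0" "\<psi> (face A m (j - 1) (y i)) = 1"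
      using separating_function[OF cpt] ij(3) by metis
    have cf: "continuous_map ?L euclideanreal (\<lambda>x. \<psi> (face A m a x))" if "a \<le> m" for a
      using continuous_map_compose[OF continuous_map_face[OF A that] \<psi>(1)] by (simp add: o_def)
    have "continuous_map ?P euclideanreal (gap \<psi> i j)"
      unfolding gap_def using ij cont_coord[OF cf, of i j] cont_coord[OF cf, of "j - 1" i]
      by (intro continuous_intros) auto
    then have "openin ?P {w \<in> topspace ?P. gap \<psi> i j w \<in> {1/2<..}}"
      by (rule openin_continuous_map_preimage) auto
    moreover have "y \<in> {w \<in> topspace ?P. gap \<psi> i j w \<in> {1/2<..}}"
      using \<psi> y by (simp add: gap_def)
    moreover have "\<not> gap \<psi> i j w < 1 / 2" if "w \<in> {w \<in> topspace ?P. gap \<psi> i j w \<in> {1/2<..}}" for w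
      using that by simp
    ultimately show ?thesis
      unfolding nbhd_def using ij(1,2) \<psi>(1)
      by (intro exI[of _ "{w \<in> topspace ?P. gap \<psi> i j w \<in> {1/2<..}}"] exI[of _ \<psi>]) blast
  qed
  then obtain U \<psi> where nbhd: "\<And>y. y \<in> topspace ?P \<Longrightarrow> nbhd y (U y) (\<psi> y)" by metis
  have U: "openin ?P (U y) \<and> y \<in> U y" and \<psi>: "continuous_map (level A m) euclideanreal (\<psi> y)"
    if "y \<in> topspace ?P" for y
    using nbhd[OF that] unfolding nbhd_def by simp_all
  have alt: "(\<exists>z\<in>topspace (level A (Suc (Suc m))). good w z) \<or> (\<exists>i j. i < j \<and> j \<le> Suc m \<and> \<not> gap (\<psi> y) i j w < 1 / 2)"
    if "y \<in> topspace ?P" "w \<in> U y" for y w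
    using nbhd[OF that(1)] that(2) unfolding nbhd_def by blast
  have "compact_space ?P" using cpt by (simp add: compact_space_product_topology)
  moreover have "topspace ?P \<subseteq> \<Union>(U ` topspace ?P)" "\<forall>V\<in>U ` topspace ?P. openin ?P V" using U by blast+
  ultimately obtain \<F> where "finite \<F>" "\<F> \<subseteq> U ` topspace ?P" "topspace ?P \<subseteq> \<Union>\<F>"
    unfolding compact_space_alt by metis
  then obtain F where F: "finite F" "F \<subseteq> topspace ?P" "topspace ?P \<subseteq> \<Union>(U ` F)"
    by (metis finite_subset_image)
  show ?thesis
  proof (rule that[of "\<psi> ` F"])
    fix y
    assume y: "\<And>j. j \<le> Suc m \<Longrightarrow> y j \<in> topspace ?L"
      and small: "\<And>i j \<psi>'. i < j \<Longrightarrow> j \<le> Suc m \<Longrightarrow> \<psi>' \<in> \<psi> ` F \<Longrightarrow>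
         \<bar>\<psi>' (face A m i (y j)) - \<psi>' (face A m (j - 1) (y i))\<bar> < 1 / 2"
    define w where "w = restrict y {..Suc m}"
    have "w \<in> topspace ?P" using y by (auto simp: w_def)
    then obtain v where v: "v \<in> F" "w \<in> U v" using F by blast
    have "gap (\<psi> v) i j w < 1 / 2" if "i < j" "j \<le> Suc m" for i j
      using small[OF that] v that by (simp add: gap_def w_def)
    then obtain z where "z \<in> topspace (level A (Suc (Suc m)))" "good w z"
      using alt[of v w] v F by blast
    then show "\<exists>z\<in>topspace (level A (Suc (Suc m))). \<forall>j\<le>Suc m. \<forall>\<phi>\<in>\<Phi>. \<bar>\<phi> (face A (Suc m) j z) - \<phi> (y j)\<bar> < \<epsilon>"
      by (auto simp: good_def w_def)
  qed (use F \<psi> in auto)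
qed

text \<open>
  A simplicial contraction of the fibre over \<open>s\<close> exists only up to arbitrarily small errors. Over
  profinite levels the approximate contraction can be chosen locally constant, and it then works
  over a neighbourhood of \<open>s\<close>.
\<close>

definition near_contraction ::
    "'a aug_simplicial \<Rightarrow> (nat \<Rightarrow> ('a \<Rightarrow> real) set) \<Rightarrow> real \<Rightarrow> 'a set \<Rightarrow> (nat \<Rightarrow> 'a \<Rightarrow> 'a) \<Rightarrow> nat \<Rightarrow> bool"
  where "near_contraction A \<Phi> \<epsilon> V h l \<longleftrightarrow>
    (\<forall>k\<le>l. locally_constant (level A k) (h k) \<and> h k ` topspace (level A k) \<subseteq> topspace (level A (Suc k))) \<and>
    (\<forall>k\<le>l. \<forall>x\<in>topspace (level A k). base A k x \<in> V \<longrightarrow>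
       (\<forall>\<phi>\<in>\<Phi> k. \<bar>\<phi> (face A k 0 (h k x)) - \<phi> x\<bar> < \<epsilon> \<and>
         (\<forall>m j. k = Suc m \<longrightarrow> j \<le> m \<longrightarrow> \<bar>\<phi> (face A k (Suc j) (h k x)) - \<phi> (h m (face A m j x))\<bar> < \<epsilon>)))"

lemma near_contractionD:
  assumes "near_contraction A \<Phi> \<epsilon> V h l" "k \<le> l"
  shows "locally_constant (level A k) (h k)"
    and "x \<in> topspace (level A k) \<Longrightarrow> h k x \<in> topspace (level A (Suc k))"
    and "x \<in> topspace (level A k) \<Longrightarrow> base A k x \<in> V \<Longrightarrow> \<phi> \<in> \<Phi> k \<Longrightarrow> \<bar>\<phi> (face A k 0 (h k x)) - \<phi> x\<bar> < \<epsilon>"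
    and "x \<in> topspace (level A k) \<Longrightarrow> base A k x \<in> V \<Longrightarrow> \<phi> \<in> \<Phi> k \<Longrightarrow> k = Suc m \<Longrightarrow> j \<le> m \<Longrightarrow>
      \<bar>\<phi> (face A k (Suc j) (h k x)) - \<phi> (h m (face A m j x))\<bar> < \<epsilon>"
  using assms unfolding near_contraction_def image_subset_iff by blast+

text \<open>Induction on the level, with tests and tolerance varying. Extending to the next level
  requires lifting a tuple built from \<open>h l\<close> whose faces match only approximately, so
  the inductive contraction must already satisfy the tests \<open>\<Psi>\<close> on level
  \<open>l\<close> under which approximate lifting works. The lifts over the fibre above
  \<open>s\<close> are then spread to a neighbourhood by a fine partition.\<close>

lemma approximate_contraction:
  assumes H: "hypercover S A" and pro: "\<And>n. profinite_space (level A (Suc n))" and s: "s \<in> topspace S"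
  shows "(\<And>k. finite (\<Phi> k)) \<Longrightarrow> (\<And>k \<phi>. \<phi> \<in> \<Phi> k \<Longrightarrow> continuous_map (level A k) euclideanreal \<phi>) \<Longrightarrow> 0 < \<epsilon> \<Longrightarrow>
    \<exists>h V. openin S V \<and> s \<in> V \<and> near_contraction A \<Phi> \<epsilon> V h l"
proof (induction l arbitrary: \<Phi> \<epsilon>)
  have A: "aug_simplicial_space A" "level A 0 = S" using H by (auto simp: hypercover_def)
  {
    case 0
    obtain z where z: "z \<in> topspace (level A (Suc 0))" "face A 0 0 z = s"
      using hypercover_lift[OF H, of 0 "\<lambda>_. s"] s A by auto
    \<comment> \<open>At the bottom the contraction is the constant map to a point \<open>z\<close>
      of \<open>S_0\<close> over \<open>s\<close>, and \<open>V\<close> is the region where no test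
      on \<open>S\<close> moves by \<open>\<epsilon>\<close>.\<close>
    define V where "V = \<Inter>(insert (topspace S) ((\<lambda>\<phi>. {x \<in> topspace S. \<bar>\<phi> s - \<phi> x\<bar> \<in> {..<\<epsilon>}}) ` \<Phi> 0))"
    have "openin S V"
      unfolding V_def using 0(1)[of 0] 0(2)[of _ 0] A(2)
      by (intro openin_Inter)
         (auto intro!: openin_continuous_map_preimage[where Y = euclideanreal] continuous_intros simp del: lessThan_iff)
    moreover have "s \<in> V" using s 0(3) by (auto simp: V_def)
    moreover have "locally_constant (level A 0) (\<lambda>_. z)" by (auto simp: locally_constant_def)
    ultimately show ?case
      using z A base_0[OF A(1)] by (intro exI[of _ "\<lambda>_ _. z"] exI[of _ V]) (auto simp: V_def near_contraction_def)
  next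
    case (Suc l)
    let ?L = "level A (Suc l)"
    define F where "F = {x \<in> topspace ?L. base A (Suc l) x = s}"
    obtain \<Psi> where \<Psi>: "finite \<Psi>" "\<And>\<psi>. \<psi> \<in> \<Psi> \<Longrightarrow> continuous_map (level A l) euclideanreal \<psi>"
      and lift: "\<And>y. (\<And>j. j \<le> Suc l \<Longrightarrow> y j \<in> topspace ?L) \<Longrightarrow>
       (\<And>i j \<psi>. i < j \<Longrightarrow> j \<le> Suc l \<Longrightarrow> \<psi> \<in> \<Psi> \<Longrightarrow> \<bar>\<psi> (face A l i (y j)) - \<psi> (face A l (j - 1) (y i))\<bar> < 1 / 2) \<Longrightarrow>
       \<exists>z\<in>topspace (level A (Suc (Suc l))). \<forall>j\<le>Suc l. \<forall>\<phi>\<in>\<Phi> (Suc l). \<bar>\<phi> (face A (Suc l) j z) - \<phi> (y j)\<bar> < \<epsilon> / 2"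
      using hypercover_approximate_lift[OF H, of "\<Phi> (Suc l)" l "\<epsilon> / 2"] Suc.prems by (smt (verit, best) half_gt_zero)
    \<comment> \<open>Tolerance 1/4 because each comparison of two faces below collects at most two
      errors, and the lifting asks for less than 1/2.\<close>
    have "\<exists>h V. openin S V \<and> s \<in> V \<and> near_contraction A (\<Phi>(l := \<Phi> l \<union> \<Psi>)) (min \<epsilon> (1 / 4)) V h l"
      by (rule Suc.IH) (use Suc.prems \<Psi> in \<open>auto split: if_splits\<close>)
    then obtain h V where V: "openin S V" "s \<in> V"
      and nc: "near_contraction A (\<Phi>(l := \<Phi> l \<union> \<Psi>)) (min \<epsilon> (1 / 4)) V h l" by blast
    note h = near_contractionD(1,2)[OF nc]
    have near0: "\<bar>\<psi> (face A l 0 (h l x)) - \<psi> x\<bar> < 1 / 4"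
      if "x \<in> topspace (level A l)" "base A l x \<in> V" "\<psi> \<in> \<Psi>" for x \<psi>
      using near_contractionD(3)[OF nc order.refl that(1,2), of \<psi>] that by simp
    have near1: "\<bar>\<psi> (face A l (Suc j) (h l x)) - \<psi> (h m (face A m j x))\<bar> < 1 / 4"
      if "x \<in> topspace (level A l)" "base A l x \<in> V" "\<psi> \<in> \<Psi>" "l = Suc m" "j \<le> m" for x \<psi> m j
      using near_contractionD(4)[OF nc order.refl that(1,2) _ that(4,5), of \<psi>] that by simp
    have ex_lift: "\<exists>z\<in>topspace (level A (Suc (Suc l))). \<forall>\<phi>\<in>\<Phi> (Suc l). \<bar>\<phi> (face A (Suc l) 0 z) - \<phi> x\<bar> < \<epsilon> / 2 \<and>
        (\<forall>j\<le>l. \<bar>\<phi> (face A (Suc l) (Suc j) z) - \<phi> (h l (face A l j x))\<bar> < \<epsilon> / 2)" if x: "x \<in> F" for x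
    proof -
      \<comment> \<open>The faces prescribed for the new simplex over \<open>x\<close>, as for an
        extra degeneracy: face 0 is \<open>x\<close> itself, face \<open>j + 1\<close> is the
        contraction applied to the j-th face of \<open>x\<close>.\<close>
      define y where "y = case_nat x (\<lambda>j. h l (face A l j x))"
      have xL: "x \<in> topspace ?L" and bx: "base A (Suc l) x = s" using x by (auto simp: F_def)
      have fx: "face A l j x \<in> topspace (level A l)" "base A l (face A l j x) \<in> V" if "j \<le> l" for j
        using that xL bx V(2) by (auto simp: face_in[OF A(1)] base_face[OF A(1)])
      have "y j \<in> topspace ?L" if "j \<le> Suc l" for j
        using that xL fx h(2) by (auto simp: y_def split: nat.split)
      moreover have "\<bar>\<psi> (face A l i (y j)) - \<psi> (face A l (j - 1) (y i))\<bar> < 1 / 2"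
        if ij: "i < j" "j \<le> Suc l" and \<psi>: "\<psi> \<in> \<Psi>" for i j \<psi>
      proof -
        obtain j' where j': "j = Suc j'" "j' \<le> l" using ij by (cases j) auto
        show ?thesis
        proof (cases i)
          case 0
          then show ?thesis using near0[OF fx[OF j'(2)] \<psi>] j' by (simp add: y_def)
        next
          case (Suc i')
          then obtain m where m: "l = Suc m" "i' \<le> m" using ij j' by (cases l) auto
          obtain j'' where j'': "j' = Suc j''" "j'' \<le> m" using Suc ij j' m by (cases j') auto
          \<comment> \<open>By the simplicial identity both faces to be compared are close to the
            image under \<open>h m\<close> of the same point.\<close>
          have eq: "face A m i' (face A l j' x) = face A m j'' (face A l i' x)"
            using face_face[OF A(1), of i' j' m x] Suc ij j' j'' m xL by simp
          have "i' \<le> l" using m by simp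
          have "\<bar>\<psi> (face A l (Suc i') (h l (face A l j' x))) - \<psi> (face A l (Suc j'') (h l (face A l i' x)))\<bar> < 1 / 2"
            using near1[OF fx[OF j'(2)] \<psi> m] near1[OF fx[OF \<open>i' \<le> l\<close>] \<psi> m(1) j''(2)] unfolding eq by linarith
          then show ?thesis using Suc j' j''(1) by (simp add: y_def)
        qed
      qed
      ultimately obtain z where z: "z \<in> topspace (level A (Suc (Suc l)))"
        "\<And>j \<phi>. j \<le> Suc l \<Longrightarrow> \<phi> \<in> \<Phi> (Suc l) \<Longrightarrow> \<bar>\<phi> (face A (Suc l) j z) - \<phi> (y j)\<bar> < \<epsilon> / 2"
        using lift[of y] by blast
      show ?thesis
        by (intro bexI[OF _ z(1)] ballI conjI allI impI)
           (use z(2)[of 0] z(2)[of "Suc _"] in \<open>auto simp: y_def\<close>)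
    qed
    then obtain Z where Z: "\<And>x. x \<in> F \<Longrightarrow> Z x \<in> topspace (level A (Suc (Suc l)))"
      "\<And>x \<phi>. x \<in> F \<Longrightarrow> \<phi> \<in> \<Phi> (Suc l) \<Longrightarrow> \<bar>\<phi> (face A (Suc l) 0 (Z x)) - \<phi> x\<bar> < \<epsilon> / 2"
      "\<And>x \<phi> j. x \<in> F \<Longrightarrow> \<phi> \<in> \<Phi> (Suc l) \<Longrightarrow> j \<le> l \<Longrightarrow> 
          \<bar>\<phi> (face A (Suc l) (Suc j) (Z x)) - \<phi> (h l (face A l j x))\<bar> < \<epsilon> / 2"
      by metis
    obtain \<iota> :: "'a \<Rightarrow> 'a set" where \<iota>: "locally_constant ?L \<iota>"
      "\<forall>x\<in>topspace ?L. \<forall>y\<in>topspace ?L. \<iota> x = \<iota> y \<longrightarrow> (\<forall>\<phi>\<in>\<Phi> (Suc l). \<bar>\<phi> x - \<phi> y\<bar> < \<epsilon> / 2)"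
    proof (rule profinite_fine_partition[OF pro[of l] Suc.prems(1)[of "Suc l"] Suc.prems(2)[of _ "Suc l"], of "\<epsilon> / 2"])
      show "0 < \<epsilon> / 2" using Suc.prems(3) by simp
    qed
    \<comment> \<open>The label fixes \<open>x\<close> up to \<open>\<epsilon> / 2\<close> under the
      tests and the values \<open>h l (face A l j x)\<close> exactly. Hence a lift chosen for one
      point of the fibre serves all points with its label, the change of point costing
      \<open>\<epsilon> / 2\<close> in face 0 and nothing in the others.\<close>
    define \<kappa> where "\<kappa> x = (\<iota> x, \<lambda>j\<in>{..l}. h l (face A l j x))" for x
    have lc2: "locally_constant ?L (\<lambda>x. \<lambda>j\<in>{..l}. h l (face A l j x))"
    proof (rule locally_constant_family)
      show "locally_constant ?L (\<lambda>x. h l (face A l j x))" if "j \<in> {..l}" for j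
        using that by (intro locally_constant_compose[OF h(1)[OF order.refl]] continuous_map_face[OF A(1)]) simp
    qed simp
    have lc: "locally_constant ?L \<kappa>"
    proof (rule locally_constantI)
      fix x assume "x \<in> topspace ?L"
      then show "\<exists>U. openin ?L U \<and> x \<in> U \<and> (\<forall>y\<in>U. \<kappa> y = \<kappa> x)"
        using \<iota>(1) lc2 unfolding locally_constant_def \<kappa>_def
        by (intro exI[of _ "{y \<in> topspace ?L. \<iota> y = \<iota> x} \<inter>
              {y \<in> topspace ?L. (\<lambda>j\<in>{..l}. h l (face A l j y)) = (\<lambda>j\<in>{..l}. h l (face A l j x))}"]) auto
    qed
    \<comment> \<open>A value for labels that do not occur over \<open>s\<close>; a degenerate
      simplex is available once the level is nonempty.\<close>
    obtain e where e: "topspace ?L = {} \<or> e \<in> topspace (level A (Suc (Suc l)))"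
    proof -
      have "(\<lambda>j\<in>{..<Suc (Suc l)}. 0) \<in> ord_maps (Suc (Suc l)) (Suc l)"
        by (auto simp: ord_maps_def monotone_on_def)
      then show ?thesis using act_in[OF A(1)] that by blast
    qed
    define pick where "pick c = (if c \<in> \<kappa> ` F then Z (SOME x. x \<in> F \<and> \<kappa> x = c) else e)" for c
    have pick: "\<exists>x\<in>F. \<kappa> x = \<kappa> y \<and> pick (\<kappa> y) = Z x" if "\<kappa> y \<in> \<kappa> ` F" for y
    proof -
      have "\<exists>x. x \<in> F \<and> \<kappa> x = \<kappa> y" using that by (metis imageE)
      from someI_ex[OF this] show ?thesis using that by (intro bexI[of _ "SOME x. x \<in> F \<and> \<kappa> x = \<kappa> y"]) (auto simp: pick_def)
    qed
    define W where "W = {x \<in> topspace ?L. \<kappa> x \<in> \<kappa> ` F}"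
    have "openin ?L W" unfolding W_def by (rule openin_locally_constant_preimage[OF lc])
    \<comment> \<open>\<open>W\<close> is open and contains the fibre over \<open>s\<close>, so over
      a neighbourhood of \<open>s\<close> only labels occurring in that fibre are met.\<close>
    define V' where "V' = V \<inter> {t \<in> topspace S. \<forall>x\<in>topspace ?L. base A (Suc l) x = t \<longrightarrow> x \<in> W}"
    have "openin S V'"
      unfolding V'_def using V H continuous_map_base[OF A(1), of "Suc l"] \<open>openin ?L W\<close> A(2)
      by (intro openin_Int openin_fibres_in) (auto simp: hypercover_def)
    moreover have "s \<in> V'" using V s by (auto simp: V'_def W_def F_def)
    moreover have "locally_constant ?L (\<lambda>x. pick (\<kappa> x))"
      using lc by (force intro!: locally_constantI simp: locally_constant_def)
    moreover have "pick (\<kappa> x) \<in> topspace (level A (Suc (Suc l)))" if "x \<in> topspace ?L" for x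
      using pick[of x] Z(1) e that by (cases "\<kappa> x \<in> \<kappa> ` F") (auto simp: pick_def)
    moreover have "\<bar>\<phi> (face A (Suc l) 0 (pick (\<kappa> x))) - \<phi> x\<bar> < \<epsilon> \<and>
        (\<forall>j\<le>l. \<bar>\<phi> (face A (Suc l) (Suc j) (pick (\<kappa> x))) - \<phi> (h l (face A l j x))\<bar> < \<epsilon>)"
      if x: "x \<in> topspace ?L" "base A (Suc l) x \<in> V'" and \<phi>: "\<phi> \<in> \<Phi> (Suc l)" for x \<phi>
    proof -
      have "\<kappa> x \<in> \<kappa> ` F" using x by (auto simp: V'_def W_def)
      then obtain x0 where x0: "x0 \<in> F" "\<kappa> x0 = \<kappa> x" "pick (\<kappa> x) = Z x0" using pick by blast
      have "\<bar>\<phi> x0 - \<phi> x\<bar> < \<epsilon> / 2" using \<iota>(2) x0 x \<phi> by (simp add: \<kappa>_def F_def)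
      then have "\<bar>\<phi> (face A (Suc l) 0 (Z x0)) - \<phi> x\<bar> < \<epsilon>" using Z(2)[OF x0(1) \<phi>] by linarith
      moreover have "\<bar>\<phi> (face A (Suc l) (Suc j) (Z x0)) - \<phi> (h l (face A l j x))\<bar> < \<epsilon>" if j: "j \<le> l" for j
      proof -
        have "(\<lambda>j\<in>{..l}. h l (face A l j x0)) j = (\<lambda>j\<in>{..l}. h l (face A l j x)) j"
          using x0(2) by (simp add: \<kappa>_def)
        then have "h l (face A l j x0) = h l (face A l j x)" using j by simp
        then show ?thesis using Z(3)[OF x0(1) \<phi> j] Suc.prems(3) by simp
      qed
      ultimately show ?thesis unfolding x0(3) by blast
    qed
    moreover have "near_contraction A \<Phi> \<epsilon> V' h l"
      using nc unfolding near_contraction_def V'_def by (auto split: if_splits)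
    ultimately show ?case
      by (intro exI[of _ "h(Suc l := (\<lambda>x. pick (\<kappa> x)))"] exI[of _ V'])
         (auto simp: near_contraction_def le_Suc_eq)
  }
qed

section \<open>The complex of a hypercover\<close>

lemma compact_space_bounded_above:
  assumes "compact_space X" "continuous_map X euclideanreal f"
  shows "bdd_above (insert 0 ((\<lambda>x. \<bar>f x\<bar>) ` topspace X))"
proof -
  have "compactin euclideanreal ((\<lambda>x. \<bar>f x\<bar>) ` topspace X)"
    using assms by (intro image_compactin[of X]) (auto simp: compact_space_def intro: continuous_intros)
  then show ?thesis by (simp add: compact_imp_bounded bounded_imp_bdd_above)
qed

lemma sup_norm_upper:
  assumes "compact_space X" "continuous_map X euclideanreal f"
  shows "x \<in> topspace X \<Longrightarrow> \<bar>f x\<bar> \<le> sup_norm X f" and "0 \<le> sup_norm X f"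
  unfolding sup_norm_def by (rule cSup_upper[OF _ compact_space_bounded_above[OF assms]]; simp)+

lemma sup_norm_least:
  assumes "\<And>x. x \<in> topspace X \<Longrightarrow> \<bar>f x\<bar> \<le> M" "0 \<le> M"
  shows "sup_norm X f \<le> M"
  unfolding sup_norm_def using assms by (intro cSup_least) auto

text \<open>The term of a pair \<open>(j, k)\<close> with \<open>k < j\<close> cancels that of
  \<open>(k, j - 1)\<close>: the simplicial identity makes the values equal and the signs are
  opposite.\<close>

lemma alternating_face_sum_twice:
  fixes g :: "'a \<Rightarrow> real"
  assumes A: "aug_simplicial_space A" and y: "y \<in> topspace (level A (Suc (Suc n)))"
  shows "(\<Sum>j\<le>Suc n. (-1) ^ j * (\<Sum>k\<le>n. (-1) ^ k * g (face A n k (face A (Suc n) j y)))) = 0"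
proof -
  define G where "G = (\<lambda>(j, k). (-1) ^ (j + k) * g (face A n k (face A (Suc n) j y)))"
  define P Q where "P = {(j, k). k < j \<and> j \<le> Suc n}" and "Q = {(j, k). j \<le> k \<and> k \<le> n}"
  have fin: "finite P" "finite Q"
    by (rule finite_subset[of _ "{..Suc n} \<times> {..Suc n}"]; force simp: P_def Q_def)+
  have "(\<Sum>j\<le>Suc n. (-1) ^ j * (\<Sum>k\<le>n. (-1) ^ k * g (face A n k (face A (Suc n) j y)))) = sum G ({..Suc n} \<times> {..n})"
  proof -
    have "(-1) ^ j * (\<Sum>k\<le>n. (-1) ^ k * g (face A n k (face A (Suc n) j y))) = (\<Sum>k\<le>n. G (j, k))" for j
      by (simp add: G_def sum_distrib_left power_add mult.assoc)
    then show ?thesis using sum.cartesian_product[of "\<lambda>j k. G (j, k)" "{..n}" "{..Suc n}"] by simp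
  qed
  also have "\<dots> = sum G (P \<union> Q)"
    by (rule arg_cong[where f = "sum G"]) (auto simp: P_def Q_def)
  also have "\<dots> = sum G P + sum G Q"
    by (rule sum.union_disjoint[OF fin]) (auto simp: P_def Q_def)
  also have "\<dots> = 0"
  proof -
    have "sum G P = (\<Sum>p\<in>Q. - G p)"
    proof (rule sum.reindex_bij_witness[of _ "\<lambda>(j, k). (Suc k, j)" "\<lambda>(j, k). (k, j - 1)"])
      fix p assume "p \<in> P"
      then obtain j k where p: "p = (j, k)" "k < j" "j \<le> Suc n" by (auto simp: P_def)
      then obtain j' where j': "j = Suc j'" by (cases j) auto
      show "- G (case p of (j, k) \<Rightarrow> (k, j - 1)) = G p"
        using face_face[OF A p(2,3) y] by (simp add: p G_def j' add.commute)
    qed (auto simp: P_def Q_def)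
    then show ?thesis by (simp add: sum_negf)
  qed
  finally show ?thesis .
qed

text \<open>The local solution is \<open>f\<close> composed with an approximate contraction
  \<open>h\<close> over \<open>s\<close>, and composing does not raise the bound. For an exact
  contraction the cocycle relation at the simplex \<open>h y\<close> would say that the differential
  of this function at \<open>y\<close> is \<open>f y\<close>. Gluing and iteration come from the
  locale.\<close>

theorem hypercover_complex_exact:
  assumes S: "compact_space S" "Hausdorff_space S" and H: "hypercover S A"
    and pro: "\<And>n. profinite_space (level A (Suc n))"
    and f: "f \<in> cmap (level A (Suc i)) euclideanreal"
    and df: "differential A (Suc i) f = (\<lambda>x\<in>topspace (level A (Suc (Suc i))). 0)"
    and \<epsilon>: "0 < \<epsilon>"
  shows "\<exists>g \<in> cmap (level A i) euclideanreal. differential A i g = f \<and>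
    sup_norm (level A i) g \<le> (1 + \<epsilon>) * sup_norm (level A (Suc i)) f"
proof -
  have A: "aug_simplicial_space A" "level A 0 = S" and cpt: "\<And>n. compact_space (level A n)"
    using H by (auto simp: hypercover_def)
  define d where "d g y = (\<Sum>j\<le>i. (-1) ^ j * g (face A i j y))" for g :: "'a \<Rightarrow> real" and y
  define coc where "coc f \<longleftrightarrow> continuous_map (level A (Suc i)) euclideanreal f \<and>
      (\<forall>y\<in>topspace (level A (Suc (Suc i))). (\<Sum>j\<le>Suc i. (-1) ^ j * f (face A (Suc i) j y)) = 0)" for f
  interpret fibrewise_approximation S "topspace (level A i)" "topspace (level A (Suc i))" "base A i" "base A (Suc i)"
    "continuous_map (level A i) euclideanreal" coc d "real (Suc i)"
  proof
    show "base A i x \<in> topspace S" if "x \<in> topspace (level A i)" for x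
      using base_in[OF A(1) that] A(2) by simp
    show "base A (Suc i) x \<in> topspace S" if "x \<in> topspace (level A (Suc i))" for x
      using base_in[OF A(1) that] A(2) by simp
    show "continuous_map (level A i) euclideanreal (\<lambda>x. g x + h x)"
      if "continuous_map (level A i) euclideanreal g" "continuous_map (level A i) euclideanreal h" for g h
      using that by (rule continuous_map_add)
    show "continuous_map (level A i) euclideanreal (\<lambda>x. \<phi> (base A i x) * g x)"
      if "continuous_map S euclideanreal \<phi>" "continuous_map (level A i) euclideanreal g" for \<phi> g
      using continuous_map_compose[OF continuous_map_base[OF A(1), of i]] that A(2)
      by (intro continuous_map_real_mult) (auto simp: o_def)
    show "continuous_map (level A i) euclideanreal l"
      if "\<And>n. continuous_map (level A i) euclideanreal (g n)" "uniform_limit (topspace (level A i)) g l sequentially"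
      for g l
      using that by (rule continuous_map_real_uniform_limit)
    show "d (\<lambda>x. g x + h x) y = d g y + d h y" for g h y
      by (simp add: d_def algebra_simps sum.distrib)
    show "d (\<lambda>x. \<phi> (base A i x) * g x) y = \<phi> (base A (Suc i) y) * d g y"
      if "y \<in> topspace (level A (Suc i))" for \<phi> g y
      using that by (simp add: d_def base_face[OF A(1)] sum_distrib_left mult.left_commute)
    show "\<bar>d g y\<bar> \<le> real (Suc i) * M"
      if "y \<in> topspace (level A (Suc i))" "\<And>x. x \<in> topspace (level A i) \<Longrightarrow> \<bar>g x\<bar> \<le> M" for g M y
    proof -
      have "\<bar>d g y\<bar> \<le> (\<Sum>j\<le>i. \<bar>(-1) ^ j * g (face A i j y)\<bar>)" unfolding d_def by (rule sum_abs)
      also have "\<dots> \<le> (\<Sum>j\<le>i. M)"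
        using that face_in[OF A(1)] by (intro sum_mono) (auto simp: abs_mult power_abs)
      finally show ?thesis by simp
    qed
    show "coc (\<lambda>y. f y - d g y)" if "coc f" "continuous_map (level A i) euclideanreal g" for f g
    proof -
      have "continuous_map (level A (Suc i)) euclideanreal (\<lambda>y. g (face A i j y))" if "j \<le> i" for j
        using continuous_map_compose[OF continuous_map_face[OF A(1) that] \<open>continuous_map _ _ g\<close>] by (simp add: o_def)
      then have "continuous_map (level A (Suc i)) euclideanreal (d g)"
        unfolding d_def by (intro continuous_map_sum continuous_map_real_mult) auto
      then have "continuous_map (level A (Suc i)) euclideanreal (\<lambda>y. f y - d g y)"
        using that(1) by (auto simp: coc_def intro: continuous_map_diff)
      then show ?thesis
        using that(1) alternating_face_sum_twice[OF A(1), of _ i g]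
        by (auto simp: coc_def d_def right_diff_distrib sum_subtractf simp del: sum.atMost_Suc)
    qed
    show "\<exists>g V. continuous_map (level A i) euclideanreal g \<and> (\<forall>x\<in>topspace (level A i). \<bar>g x\<bar> \<le> M) \<and> openin S V \<and> s \<in> V \<and>
        (\<forall>y\<in>topspace (level A (Suc i)). base A (Suc i) y \<in> V \<longrightarrow> \<bar>d g y - f y\<bar> \<le> e)"
      if f: "coc f" "\<And>y. y \<in> topspace (level A (Suc i)) \<Longrightarrow> \<bar>f y\<bar> \<le> M" and s: "s \<in> topspace S" and e: "0 < e" for f M s e
    proof -
      \<comment> \<open>The estimate collects \<open>i + 2\<close> errors: one for each of the faces
        1 to \<open>i + 1\<close> of the contracted simplex and one for its face 0.\<close>
      define e' where "e' = e / (real i + 2)"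
      \<comment> \<open>The only test is \<open>f\<close> itself on \<open>S_i\<close>; tests on
        lower levels are added inside the induction that builds the contraction.\<close>
      define \<Phi> where "\<Phi> k = (if k = Suc i then {f} else {})" for k
      have "0 < e'" using e by (simp add: e'_def)
      then have "\<exists>h V. openin S V \<and> s \<in> V \<and> near_contraction A \<Phi> e' V h (Suc i)"
        using f(1) by (intro approximate_contraction[OF H pro s]) (auto simp: \<Phi>_def coc_def split: if_splits)
      then obtain h V where V: "openin S V" "s \<in> V" and nc: "near_contraction A \<Phi> e' V h (Suc i)" by blast
      have i: "i \<le> Suc i" by simp
      note h = near_contractionD[OF nc]
      have "continuous_map (level A i) euclideanreal (\<lambda>x. f (h i x))"
        by (rule continuous_map_locally_constant[OF h(1)]) auto
      moreover have "\<bar>f (h i x)\<bar> \<le> M" if "x \<in> topspace (level A i)" for x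
        using f(2) h(2)[OF i that] .
      moreover have "\<bar>d (\<lambda>x. f (h i x)) y - f y\<bar> \<le> e"
        if y: "y \<in> topspace (level A (Suc i))" "base A (Suc i) y \<in> V" for y
      proof -
        define z where "z = h (Suc i) y"
        have "z \<in> topspace (level A (Suc (Suc i)))" using h(2)[OF order.refl y(1)] by (simp add: z_def)
        \<comment> \<open>The cocycle relation at \<open>z\<close>, solved for face 0. As far as
          \<open>f\<close> can tell, that face is nearly \<open>y\<close> and the others are nearly
          the contracted faces of \<open>y\<close>.\<close>
        then have "f (face A (Suc i) 0 z) = (\<Sum>j\<le>i. (-1) ^ j * f (face A (Suc i) (Suc j) z))"
          using f(1) by (simp add: coc_def sum.atMost_Suc_shift sum_negf del: sum.atMost_Suc)
        then have "d (\<lambda>x. f (h i x)) y - f y =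
            (\<Sum>j\<le>i. (-1) ^ j * (f (h i (face A i j y)) - f (face A (Suc i) (Suc j) z))) + (f (face A (Suc i) 0 z) - f y)"
          by (simp add: d_def right_diff_distrib sum_subtractf)
        also have "\<bar>\<dots>\<bar> \<le> (\<Sum>j\<le>i. \<bar>(-1) ^ j * (f (h i (face A i j y)) - f (face A (Suc i) (Suc j) z))\<bar>) + \<bar>f (face A (Suc i) 0 z) - f y\<bar>"
          by (rule order_trans[OF abs_triangle_ineq add_right_mono[OF sum_abs]])
        also have "\<dots> \<le> (\<Sum>j\<le>i. e') + e'"
          using h(3,4)[OF order.refl y, of f]
          by (intro add_mono sum_mono) (auto simp: \<Phi>_def z_def abs_mult power_abs abs_minus_commute intro: less_imp_le)
        also have "\<dots> = (real i + 2) * e'" by (simp add: algebra_simps)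
        also have "\<dots> = e" by (simp add: e'_def)
        finally show ?thesis .
      qed
      ultimately show ?thesis using V by blast
    qed
  qed (use S in auto)
  have cf: "continuous_map (level A (Suc i)) euclideanreal f" using f by (simp add: cmap_def)
  have "coc f"
    unfolding coc_def
  proof (intro conjI ballI cf)
    fix y assume y: "y \<in> topspace (level A (Suc (Suc i)))"
    show "(\<Sum>j\<le>Suc i. (-1) ^ j * f (face A (Suc i) j y)) = 0"
      using fun_cong[OF df, of y] y by (simp add: differential_def face_def del: sum.atMost_Suc)
  qed
  then obtain g where g: "continuous_map (level A i) euclideanreal g"
    "\<And>x. x \<in> topspace (level A i) \<Longrightarrow> \<bar>g x\<bar> \<le> (1 + \<epsilon>) * sup_norm (level A (Suc i)) f"
    "\<And>y. y \<in> topspace (level A (Suc i)) \<Longrightarrow> d g y = f y"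
    using exact[of f "sup_norm (level A (Suc i)) f" \<epsilon>] sup_norm_upper[OF cpt cf] \<epsilon> by blast
  define g' where "g' = restrict g (topspace (level A i))"
  have "g' \<in> cmap (level A i) euclideanreal"
    using g(1) by (auto simp: cmap_def g'_def intro: continuous_map_eq)
  moreover have "differential A i g' = f"
  proof
    fix y
    show "differential A i g' y = f y"
    proof (cases "y \<in> topspace (level A (Suc i))")
      case True
      then show ?thesis
        using g(3)[OF True] face_in[OF A(1) _ True] by (simp add: differential_def d_def g'_def flip: face_def)
    next
      case False
      then show ?thesis using f by (simp add: differential_def cmap_def extensional_def)
    qed
  qed
  moreover have "sup_norm (level A i) g' \<le> (1 + \<epsilon>) * sup_norm (level A (Suc i)) f"
    using g(2) sup_norm_upper(2)[OF cpt cf] \<epsilon> by (intro sup_norm_least) (auto simp: g'_def)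
  ultimately show ?thesis by blast
qed

section \<open>Constructions in the site\<close>

lemma cmap_in: "f \<in> cmap X Y \<Longrightarrow> x \<in> topspace X \<Longrightarrow> f x \<in> topspace Y"
  by (auto simp: cmap_def continuous_map_def)

lemma cmap_continuous: "f \<in> cmap X Y \<Longrightarrow> continuous_map X Y f"
  by (simp add: cmap_def)

lemma cmap_restrict: "continuous_map X Y f \<Longrightarrow> restrict f (topspace X) \<in> cmap X Y"
  by (auto simp: cmap_def intro: continuous_map_eq)

lemma cmap_compose: "f \<in> cmap X Y \<Longrightarrow> g \<in> cmap Y Z \<Longrightarrow> compose (topspace X) g f \<in> cmap X Z"
  using cmap_restrict[OF continuous_map_compose[OF cmap_continuous cmap_continuous], of f X Y g Z]
  by (simp add: compose_def o_def)

lemma cmap_id: "restrict id (topspace X) \<in> cmap X X"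
  by (rule cmap_restrict) simp

lemma cmap_eqI: "f \<in> cmap X Y \<Longrightarrow> g \<in> cmap X Y \<Longrightarrow> (\<And>x. x \<in> topspace X \<Longrightarrow> f x = g x) \<Longrightarrow> f = g"
  by (auto simp: cmap_def intro: extensionalityI)

lemma cmap_id_compose: "f \<in> cmap X Y \<Longrightarrow> compose (topspace X) (restrict id (topspace Y)) f = f"
  by (rule cmap_eqI[OF cmap_compose[OF _ cmap_id]]) (auto simp: compose_def cmap_in)

lemma cmap_compose_assoc:
  "f \<in> cmap X Y \<Longrightarrow> compose (topspace X) h (compose (topspace X) g f) = compose (topspace X) (compose (topspace Y) h g) f"
  by (auto simp: compose_def cmap_in fun_eq_iff)

lemma compact_space_sum_topology:
  assumes "finite I" "\<And>i. i \<in> I \<Longrightarrow> compact_space (X i)"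
  shows "compact_space (sum_topology X I)"
proof -
  have "topspace (sum_topology X I) = (\<Union>i\<in>I. (\<lambda>x. (i, x)) ` topspace (X i))" by auto
  moreover have "compactin (sum_topology X I) ((\<lambda>x. (i, x)) ` topspace (X i))" if "i \<in> I" for i
    using assms(2)[OF that] continuous_map_component_injection[OF that, of X]
    unfolding compact_space_def by (rule image_compactin)
  ultimately show ?thesis
    unfolding compact_space_def using assms(1) by (auto intro!: compactin_Union simp del: topspace_sum_topology)
qed

lemma Hausdorff_space_sum_topology:
  assumes "\<And>i. i \<in> I \<Longrightarrow> Hausdorff_space (X i)"
  shows "Hausdorff_space (sum_topology X I)"
  unfolding Hausdorff_space_def
proof (intro allI impI)
  fix p q assume pq: "p \<in> topspace (sum_topology X I) \<and> q \<in> topspace (sum_topology X I) \<and> p \<noteq> q"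
  then have ne: "p \<noteq> q" by simp
  obtain i x where p: "p = (i, x)" "i \<in> I" "x \<in> topspace (X i)" using pq by auto
  obtain j y where q: "q = (j, y)" "j \<in> I" "y \<in> topspace (X j)" using pq by auto
  have op: "openin (sum_topology X I) ((\<lambda>x. (k, x)) ` U)" if "k \<in> I" "openin (X k) U" for k U
    using open_map_component_injection[OF that(1), of X] that(2) by (auto simp: open_map_def)
  show "\<exists>U V. openin (sum_topology X I) U \<and> openin (sum_topology X I) V \<and> p \<in> U \<and> q \<in> V \<and> disjnt U V"
  proof (cases "i = j")
    case True
    then obtain U V where "openin (X i) U" "openin (X i) V" "x \<in> U" "y \<in> V" "disjnt U V"
      using assms[OF p(2)] p q ne unfolding Hausdorff_space_def by metis
    then show ?thesis
      using op[OF p(2)] p q True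
      by (intro exI[of _ "(\<lambda>x. (i, x)) ` U"] exI[of _ "(\<lambda>x. (i, x)) ` V"]) (auto simp: disjnt_def)
  next
    case False
    then show ?thesis
      using op[OF p(2) openin_topspace] op[OF q(2) openin_topspace] p q
      by (intro exI[of _ "(\<lambda>x. (i, x)) ` topspace (X i)"] exI[of _ "(\<lambda>x. (j, x)) ` topspace (X j)"]) (auto simp: disjnt_def)
  qed
qed

lemma continuous_map_from_sum_topology:
  assumes "\<And>i. i \<in> I \<Longrightarrow> continuous_map (X i) Y (\<lambda>x. g (i, x))"
  shows "continuous_map (sum_topology X I) Y g"
  unfolding continuous_map_def
proof (intro conjI allI impI)
  show "g \<in> topspace (sum_topology X I) \<rightarrow> topspace Y"
    using assms by (fastforce simp: continuous_map_def)
  fix U assume U: "openin Y U"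
  show "openin (sum_topology X I) {x \<in> topspace (sum_topology X I). g x \<in> U}"
    unfolding openin_sum_topology
  proof (intro conjI ballI)
    fix i assume i: "i \<in> I"
    have "{x. (i, x) \<in> {x \<in> topspace (sum_topology X I). g x \<in> U}} = {x \<in> topspace (X i). g (i, x) \<in> U}"
      using i by auto
    then show "openin (X i) {x. (i, x) \<in> {x \<in> topspace (sum_topology X I). g x \<in> U}}"
      using openin_continuous_map_preimage[OF assms[OF i] U] by simp
  qed auto
qed

text \<open>Describes a copy of the fibre product on \<open>'a\<close> both by its points and by its
  universal property, the latter with respect to every topology on \<open>'a\<close>, in the site or
  not.\<close>

definition is_fibre_product ::
    "'a topology \<Rightarrow> 'a topology \<Rightarrow> ('a \<Rightarrow> 's) \<Rightarrow> ('a \<Rightarrow> 's) \<Rightarrow> 'a topology \<Rightarrow> ('a \<Rightarrow> 'a) \<Rightarrow> ('a \<Rightarrow> 'a) \<Rightarrow> bool"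
  where "is_fibre_product X Y f g P p q \<longleftrightarrow> p \<in> cmap P X \<and> q \<in> cmap P Y \<and>
    (\<forall>z\<in>topspace P. f (p z) = g (q z)) \<and>
    (\<forall>x\<in>topspace X. \<forall>y\<in>topspace Y. f x = g y \<longrightarrow> (\<exists>z\<in>topspace P. p z = x \<and> q z = y)) \<and>
    (\<forall>z\<in>topspace P. \<forall>z'\<in>topspace P. p z = p z' \<longrightarrow> q z = q z' \<longrightarrow> z = z') \<and>
    (\<forall>T::'a topology. \<forall>u\<in>cmap T X. \<forall>v\<in>cmap T Y. (\<forall>t\<in>topspace T. f (u t) = g (v t)) \<longrightarrow>
       (\<exists>h\<in>cmap T P. compose (topspace T) p h = u \<and> compose (topspace T) q h = v))"

text \<open>The summands are indexed by the members \<open>(Z, f)\<close> of the cover, so a space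
  that occurs with two maps is taken twice.\<close>

definition is_disjoint_union ::
    "('a topology \<times> ('a \<Rightarrow> 'a)) set \<Rightarrow> 'a topology \<Rightarrow> 'a topology \<Rightarrow> ('a \<Rightarrow> 'a) \<Rightarrow> ('a topology \<times> ('a \<Rightarrow> 'a) \<Rightarrow> 'a \<Rightarrow> 'a) \<Rightarrow> bool"
  where "is_disjoint_union \<U> X Y q j \<longleftrightarrow> q \<in> cmap Y X \<and> q ` topspace Y = topspace X \<and>
    (\<forall>(Z, f) \<in> \<U>. j (Z, f) \<in> cmap Z Y \<and> compose (topspace Z) q (j (Z, f)) = f) \<and>
    (\<forall>(Z, f) \<in> \<U>. \<forall>(Z', f') \<in> \<U>. \<forall>z\<in>topspace Z. \<forall>z'\<in>topspace Z'. j (Z, f) z = j (Z', f') z' \<longrightarrow> Z = Z' \<and> f = f' \<and> z = z') \<and>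
    (\<forall>y\<in>topspace Y. \<exists>Z f z. (Z, f) \<in> \<U> \<and> z \<in> topspace Z \<and> y = j (Z, f) z)"

locale cutoff =
  fixes \<kappa> :: "'a set rel"
  assumes cutoff: "cutoff_cardinal \<kappa>"
begin

abbreviation "\<C> \<equiv> CHaus \<kappa>"

context
  includes cardinal_syntax
begin

lemma infinite_cutoff: "Card_order \<kappa>" "infinite (Field \<kappa>)"
  using cutoff by (auto simp: cutoff_cardinal_def)

lemma CHausD: "X \<in> \<C> \<Longrightarrow> compact_space X" "X \<in> \<C> \<Longrightarrow> Hausdorff_space X" "X \<in> \<C> \<Longrightarrow> |topspace X| <o \<kappa>"
  by (auto simp: CHaus_def)

text \<open>The product embeds in the square of the disjoint sum. An infinite sum has the size of
  its square and stays below \<open>\<kappa>\<close>; a finite product is below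
  \<open>\<kappa>\<close> because \<open>\<kappa>\<close> is infinite.\<close>

lemma small_Times:
  assumes "|A| <o \<kappa>" "|B| <o \<kappa>"
  shows "|A \<times> B| <o \<kappa>"
proof (cases "finite (A \<times> B)")
  case True
  then show ?thesis
    using infinite_cutoff by (metis card_of_Field_ordIso finite_ordLess_infinite2 ordLess_ordIso_trans)
next
  case False
  then have inf: "infinite (A <+> B)" using finite_cartesian_product by (auto simp: finite_Plus_iff)
  have "|A \<times> B| \<le>o |(A <+> B) \<times> (A <+> B)|"
    by (rule ordLeq_transitive[OF card_of_Times_mono1[OF card_of_Plus1] card_of_Times_mono2[OF card_of_Plus2]])
  also have "|(A <+> B) \<times> (A <+> B)| =o |A <+> B|"
    using inf by (rule card_of_Times_same_infinite)
  also have "|A <+> B| <o \<kappa>"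
    using card_of_Plus_ordLess_infinite_Field[OF infinite_cutoff(2,1) assms] .
  finally show ?thesis .
qed

lemma small_Sigma:
  assumes "finite I" "\<And>i. i \<in> I \<Longrightarrow> |B i| <o \<kappa>"
  shows "|Sigma I B| <o \<kappa>"
  using assms
proof (induction I rule: finite_induct)
  case empty
  have "|{}| <o \<kappa>"
    using infinite_cutoff by (metis card_of_Field_ordIso finite_ordLess_infinite2 ordLess_ordIso_trans finite.emptyI)
  then show ?case by simp
next
  case (insert i I)
  have "|{i} \<times> B i| <o \<kappa>"
  proof -
    have "{i} \<times> B i = Pair i ` B i" by auto
    then show ?thesis using ordLeq_ordLess_trans[OF card_of_image insert.prems[of i], of "Pair i"] by simp
  qed
  moreover have "|Sigma I B| <o \<kappa>" using insert by simp
  moreover have "Sigma (insert i I) B = ({i} \<times> B i) \<union> Sigma I B" by auto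
  ultimately show ?case
    using card_of_Un_ordLess_infinite_Field[OF infinite_cutoff(2,1)] by simp
qed

text \<open>Here the bound of \<open>\<kappa>\<close> by the successor of the size of
  \<open>'a\<close> is used: a smaller space injects into \<open>'a\<close>, and its topology is
  transported along the injection. Products and sums leave the type \<open>'a\<close> and are
  brought back in this way.\<close>

lemma small_copy:
  fixes X :: "'b topology"
  assumes X: "compact_space X" "Hausdorff_space X" "|topspace X| <o \<kappa>"
  obtains X' f g where "X' \<in> \<C>" "homeomorphic_maps X X' f g"
proof -
  have "|topspace X| \<le>o |UNIV :: 'a set|"
    using cutoff X(3) unfolding cutoff_cardinal_def
    by (metis card_of_Card_order cardSuc_ordLeq_ordLess ordLess_ordLeq_trans)
  then obtain f :: "'b \<Rightarrow> 'a" where f: "inj_on f (topspace X)"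
    using card_of_ordLeq[of "topspace X" "UNIV :: 'a set"] by blast
  define g where "g = inv_into (topspace X) f"
  define X' where "X' = pullback_topology (f ` topspace X) g X"
  have gf: "g (f x) = x" if "x \<in> topspace X" for x using f that by (simp add: g_def)
  have top: "topspace X' = f ` topspace X"
    by (auto simp: X'_def topspace_pullback_topology gf)
  have "continuous_map X X' f"
    unfolding continuous_map_def
  proof (intro conjI allI impI)
    show "f \<in> topspace X \<rightarrow> topspace X'" by (simp add: top)
    fix U assume "openin X' U"
    then obtain V where V: "openin X V" "U = g -` V \<inter> f ` topspace X" by (auto simp: X'_def openin_pullback_topology)
    have "f x \<in> U \<longleftrightarrow> x \<in> V" if "x \<in> topspace X" for x
      using V(2) gf[OF that] that by simp
    then have "{x \<in> topspace X. f x \<in> U} = V" using openin_subset[OF V(1)] by blast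
    then show "openin X {x \<in> topspace X. f x \<in> U}" using V(1) by simp
  qed
  moreover have "continuous_map X' X g"
    unfolding continuous_map_def
  proof (intro conjI allI impI)
    show "g \<in> topspace X' \<rightarrow> topspace X" by (auto simp: top gf)
    fix U assume "openin X U"
    then show "openin X' {x \<in> topspace X'. g x \<in> U}"
      unfolding top unfolding X'_def openin_pullback_topology by (intro exI[of _ U]) auto
  qed
  ultimately have hom: "homeomorphic_maps X X' f g"
    using gf by (auto simp: homeomorphic_maps_def top)
  then have "X homeomorphic_space X'" by (auto simp: homeomorphic_space_def)
  moreover have "|topspace X'| <o \<kappa>"
    unfolding top using ordLeq_ordLess_trans[OF card_of_image X(3)] .
  ultimately have "X' \<in> \<C>"
    using X homeomorphic_compact_space homeomorphic_Hausdorff_space by (auto simp: CHaus_def)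
  then show ?thesis using hom that by blast
qed

lemma closed_subspace_CHaus: "X \<in> \<C> \<Longrightarrow> closedin X E \<Longrightarrow> subtopology X E \<in> \<C>"
  by (auto simp: CHaus_def closedin_compact_space compact_space_subtopology Hausdorff_space_subtopology topspace_subtopology
      intro: ordLeq_ordLess_trans[OF card_of_mono1])

lemma singleton_CHaus: "X \<in> \<C> \<Longrightarrow> x \<in> topspace X \<Longrightarrow> subtopology X {x} \<in> \<C>"
  by (rule closed_subspace_CHaus) (auto simp: closedin_Hausdorff_singleton CHausD)

text \<open>Since \<open>S\<close> is Hausdorff, the pairs with equal image form a closed subspace
  of the product, which is therefore compact and has a copy in the site.\<close>

lemma fibre_product:
  assumes X: "X \<in> \<C>" and Y: "Y \<in> \<C>" and S: "Hausdorff_space S" and f: "f \<in> cmap X S" and g: "g \<in> cmap Y S"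
  obtains P p q where "P \<in> \<C>" "is_fibre_product X Y f g P p q"
proof -
  define E where "E = {z \<in> topspace (prod_topology X Y). f (fst z) = g (snd z)}"
  define Q where "Q = subtopology (prod_topology X Y) E"
  have tQ: "topspace Q = E" by (auto simp: Q_def E_def)
  have "continuous_map (prod_topology X Y) S (\<lambda>z. f (fst z))" "continuous_map (prod_topology X Y) S (\<lambda>z. g (snd z))"
    using continuous_map_compose[OF continuous_map_fst cmap_continuous[OF f]]
      continuous_map_compose[OF continuous_map_snd cmap_continuous[OF g]] by (simp_all add: o_def)
  then have "closedin (prod_topology X Y) E"
    unfolding E_def by (rule closedin_continuous_maps_eq[OF S])
  then have "compact_space Q" "Hausdorff_space Q"
    using X Y by (auto simp: Q_def CHaus_def compact_space_subtopology closedin_compact_space compact_space_prod_topology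
        Hausdorff_space_subtopology Hausdorff_space_prod_topology)
  moreover have "|topspace Q| <o \<kappa>"
  proof -
    have "E \<subseteq> topspace X \<times> topspace Y" by (auto simp: E_def)
    then show ?thesis
      unfolding tQ using small_Times[OF CHausD(3)[OF X] CHausD(3)[OF Y]] ordLeq_ordLess_trans[OF card_of_mono1] by blast
  qed
  ultimately obtain P a b where P: "P \<in> \<C>" "homeomorphic_maps Q P a b" by (rule small_copy)
  have b: "b z \<in> E" if "z \<in> topspace P" for z
    using P(2) that tQ by (auto simp: homeomorphic_maps_def continuous_map_def)
  have a: "a w \<in> topspace P" "b (a w) = w" if "w \<in> E" for w
    using P(2) that tQ by (auto simp: homeomorphic_maps_def continuous_map_def)
  have cb: "continuous_map P (prod_topology X Y) b"
    using P(2) by (simp add: homeomorphic_maps_def Q_def continuous_map_in_subtopology)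
  define p q where "p = restrict (fst \<circ> b) (topspace P)" and "q = restrict (snd \<circ> b) (topspace P)"
  show ?thesis
  proof (rule that[OF P(1)], unfold is_fibre_product_def, intro conjI ballI allI impI)
    show p: "p \<in> cmap P X" and q: "q \<in> cmap P Y"
      unfolding p_def q_def using cb by (auto intro!: cmap_restrict continuous_map_compose continuous_map_fst continuous_map_snd)
    show "f (p z) = g (q z)" if "z \<in> topspace P" for z using b[OF that] that by (simp add: p_def q_def E_def)
    show "\<exists>z\<in>topspace P. p z = x \<and> q z = y" if "x \<in> topspace X" "y \<in> topspace Y" "f x = g y" for x y
      using a[of "(x, y)"] that by (intro bexI[of _ "a (x, y)"]) (auto simp: p_def q_def E_def)
    show "z = z'" if "z \<in> topspace P" "z' \<in> topspace P" "p z = p z'" "q z = q z'" for z z'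
    proof -
      have "b z = b z'" using that by (simp add: p_def q_def prod_eq_iff)
      then show ?thesis using P(2) that(1,2) by (metis homeomorphic_maps_def)
    qed
    show "\<exists>h\<in>cmap T P. compose (topspace T) p h = u \<and> compose (topspace T) q h = v"
      if u: "u \<in> cmap T X" and v: "v \<in> cmap T Y" and uv: "\<forall>t\<in>topspace T. f (u t) = g (v t)" for T :: "'a topology" and u v
    proof -
      have E: "(u t, v t) \<in> E" if "t \<in> topspace T" for t
        using uv that cmap_in[OF u that] cmap_in[OF v that] by (simp add: E_def)
      have "continuous_map T Q (\<lambda>t. (u t, v t))"
        using E cmap_continuous[OF u] cmap_continuous[OF v]
        by (auto simp: Q_def continuous_map_in_subtopology continuous_map_pairedI)
      then have "continuous_map T P (a \<circ> (\<lambda>t. (u t, v t)))"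
        using P(2) by (auto simp: homeomorphic_maps_def intro: continuous_map_compose)
      then have h: "restrict (a \<circ> (\<lambda>t. (u t, v t))) (topspace T) \<in> cmap T P" by (rule cmap_restrict)
      show ?thesis
        using a E by (intro bexI[OF _ h] conjI cmap_eqI[OF cmap_compose[OF h p] u] cmap_eqI[OF cmap_compose[OF h q] v])
          (auto simp: compose_def p_def q_def)
    qed
  qed
qed

text \<open>Turns a finite cover into a single surjection, the only kind of cover for which Cech
  cochains are defined here.\<close>

lemma disjoint_union:
  assumes X: "X \<in> \<C>" and \<U>: "finite_cover \<kappa> X \<U>"
  obtains Y q j where "Y \<in> \<C>" "is_disjoint_union \<U> X Y q j"
proof -
  have U: "finite \<U>" "\<And>Z f. (Z, f) \<in> \<U> \<Longrightarrow> Z \<in> \<C>" "\<And>Z f. (Z, f) \<in> \<U> \<Longrightarrow> f \<in> cmap Z X"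
    and sur: "(\<Union>(Y, f) \<in> \<U>. f ` topspace Y) = topspace X"
    using \<U> by (auto simp: finite_cover_def)
  define Q where "Q = sum_topology fst \<U>"
  have tQ: "topspace Q = {((Z, f), z). (Z, f) \<in> \<U> \<and> z \<in> topspace Z}" by (auto simp: Q_def)
  have "compact_space Q" "Hausdorff_space Q"
    using U by (auto simp: Q_def CHaus_def intro!: compact_space_sum_topology Hausdorff_space_sum_topology)
  moreover have "|topspace Q| <o \<kappa>"
    using small_Sigma[OF U(1), of "topspace \<circ> fst"] U(2) CHausD(3) by (fastforce simp: Q_def)
  ultimately obtain Y a b where Y: "Y \<in> \<C>" "homeomorphic_maps Q Y a b" by (rule small_copy)
  have b: "b y \<in> topspace Q" "a (b y) = y" if "y \<in> topspace Y" for y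
    using Y(2) that by (auto simp: homeomorphic_maps_def continuous_map_def)
  have a: "a w \<in> topspace Y" "b (a w) = w" if "w \<in> topspace Q" for w
    using Y(2) that by (auto simp: homeomorphic_maps_def continuous_map_def)
  define ev where "ev = (\<lambda>((Z :: 'a topology, f :: 'a \<Rightarrow> 'a), z). f z)"
  have ev: "continuous_map Q X ev"
    unfolding Q_def by (rule continuous_map_from_sum_topology) (use U(3) in \<open>auto simp: ev_def cmap_def\<close>)
  define q where "q = restrict (ev \<circ> b) (topspace Y)"
  define j where "j i = restrict (\<lambda>z. a (i, z)) (topspace (fst i))" for i
  have q: "q \<in> cmap Y X"
    unfolding q_def using Y(2) ev by (auto simp: homeomorphic_maps_def intro!: cmap_restrict continuous_map_compose)
  have j: "j (Z, f) \<in> cmap Z Y" if "(Z, f) \<in> \<U>" for Z f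
  proof -
    have "continuous_map Z Q (\<lambda>z. ((Z, f), z))"
      using continuous_map_component_injection[OF that, of fst] by (simp add: Q_def)
    then have "continuous_map Z Y (a \<circ> (\<lambda>z. ((Z, f), z)))"
      using Y(2) by (auto simp: homeomorphic_maps_def intro: continuous_map_compose)
    then show ?thesis using cmap_restrict by (fastforce simp: j_def o_def)
  qed
  have "q ` topspace Y = topspace X"
    proof
      show "q ` topspace Y \<subseteq> topspace X" using cmap_in[OF q] by blast
      show "topspace X \<subseteq> q ` topspace Y"
      proof
        fix x assume "x \<in> topspace X"
        then obtain Z f z where z: "(Z, f) \<in> \<U>" "z \<in> topspace Z" "x = f z" using sur by blast
        then have "((Z, f), z) \<in> topspace Q" by (simp add: tQ)
        then show "x \<in> q ` topspace Y"
          using a z by (intro image_eqI[of _ _ "a ((Z, f), z)"]) (auto simp: q_def ev_def)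
      qed
    qed
  moreover have "compose (topspace Z) q (j (Z, f)) = f" if "(Z, f) \<in> \<U>" for Z f
      using that a by (intro cmap_eqI[OF cmap_compose[OF j[OF that] q] U(3)[OF that]]) (auto simp: compose_def j_def q_def ev_def tQ)
  moreover have "Z = Z' \<and> f = f' \<and> z = z'"
      if "(Z, f) \<in> \<U>" "(Z', f') \<in> \<U>" "z \<in> topspace Z" "z' \<in> topspace Z'" "j (Z, f) z = j (Z', f') z'" for Z f Z' f' z z'
    proof -
      have "b (a ((Z, f), z)) = b (a ((Z', f'), z'))" using that by (simp add: j_def)
      then show ?thesis using that a(2)[of "((Z, f), z)"] a(2)[of "((Z', f'), z')"] by (simp add: tQ)
    qed
  moreover have "\<exists>Z f z. (Z, f) \<in> \<U> \<and> z \<in> topspace Z \<and> y = j (Z, f) z" if y: "y \<in> topspace Y" for y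
    proof -
      obtain Z f z where z: "b y = ((Z, f), z)" "(Z, f) \<in> \<U>" "z \<in> topspace Z" using b(1)[OF y] by (auto simp: tQ)
      then show ?thesis using b(2)[OF y] by (intro exI[of _ Z] exI[of _ f] exI[of _ z]) (simp add: j_def)
    qed
  ultimately have "is_disjoint_union \<U> X Y q j"
    unfolding is_disjoint_union_def using q j by auto
  then show ?thesis by (rule that[OF Y(1)])
qed

end

end

section \<open>Cech cochains\<close>

text \<open>The product of the \<open>c (d\<^sub>i us)\<close> with exponents \<open>(-1)\<^sup>i\<close>, where \<open>d\<^sub>i\<close> omits the \<open>i\<close>-th entry.\<close>

fun cech :: "('g, 'm) monoid_scheme \<Rightarrow> ('u list \<Rightarrow> 'g) \<Rightarrow> 'u list \<Rightarrow> 'g"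
  where
    "cech G c [] = \<one>\<^bsub>G\<^esub>"
  | "cech G c (u # us) = c us \<otimes>\<^bsub>G\<^esub> inv\<^bsub>G\<^esub> cech G (\<lambda>vs. c (u # vs)) us"

lemma cech_map: "cech G c (map f us) = cech G (\<lambda>vs. c (map f vs)) us"
  by (induction us arbitrary: c) simp_all

text \<open>The lists at which \<open>c\<close> is evaluated are described by entries and length
  alone. This admits more lists than the faces of \<open>us\<close>, but it is a condition that
  passes through the recursion.\<close>

lemma cech_cong:
  assumes "\<And>vs. set vs \<subseteq> set us \<Longrightarrow> Suc (length vs) = length us \<Longrightarrow> c vs = e vs"
  shows "cech G c us = cech G e us"
  using assms
proof (induction us arbitrary: c e)
  case (Cons u us)
  have "c us = e us" by (rule Cons.prems) auto
  moreover have "cech G (\<lambda>vs. c (u # vs)) us = cech G (\<lambda>vs. e (u # vs)) us"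
    by (intro Cons.IH Cons.prems) auto
  ultimately show ?case by simp
qed simp

context comm_group
begin

lemma cech_closed:
  assumes "\<And>vs. set vs \<subseteq> set us \<Longrightarrow> Suc (length vs) = length us \<Longrightarrow> c vs \<in> carrier G"
  shows "cech G c us \<in> carrier G"
  using assms
proof (induction us arbitrary: c)
  case (Cons u us)
  have "c us \<in> carrier G" by (rule Cons.prems) auto
  moreover have "cech G (\<lambda>vs. c (u # vs)) us \<in> carrier G"
    by (intro Cons.IH Cons.prems) auto
  ultimately show ?case by simp
qed simp

lemma cech_mult:
  assumes "\<And>vs. set vs \<subseteq> set us \<Longrightarrow> Suc (length vs) = length us \<Longrightarrow> c vs \<in> carrier G"
    and "\<And>vs. set vs \<subseteq> set us \<Longrightarrow> Suc (length vs) = length us \<Longrightarrow> e vs \<in> carrier G"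
  shows "cech G (\<lambda>vs. c vs \<otimes> e vs) us = cech G c us \<otimes> cech G e us"
  using assms
proof (induction us arbitrary: c e)
  case (Cons u us)
  have 1: "c us \<in> carrier G" "e us \<in> carrier G" by (auto intro: Cons.prems)
  have 2: "cech G (\<lambda>vs. c (u # vs)) us \<in> carrier G" "cech G (\<lambda>vs. e (u # vs)) us \<in> carrier G"
    by (auto intro!: cech_closed Cons.prems)
  have "cech G (\<lambda>vs. c (u # vs) \<otimes> e (u # vs)) us = cech G (\<lambda>vs. c (u # vs)) us \<otimes> cech G (\<lambda>vs. e (u # vs)) us"
    by (intro Cons.IH Cons.prems) auto
  then show ?case using 1 2 by (simp add: inv_mult m_ac)
qed simp

lemma cech_inv:
  assumes "\<And>vs. set vs \<subseteq> set us \<Longrightarrow> Suc (length vs) = length us \<Longrightarrow> c vs \<in> carrier G"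
  shows "cech G (\<lambda>vs. inv c vs) us = inv cech G c us"
  using assms
proof (induction us arbitrary: c)
  case (Cons u us)
  have 1: "c us \<in> carrier G" by (auto intro: Cons.prems)
  have 2: "cech G (\<lambda>vs. c (u # vs)) us \<in> carrier G"
    by (auto intro!: cech_closed Cons.prems)
  have "cech G (\<lambda>vs. inv c (u # vs)) us = inv cech G (\<lambda>vs. c (u # vs)) us"
    by (intro Cons.IH Cons.prems) auto
  then show ?case using 1 2 by (simp add: inv_mult)
qed simp

text \<open>Unfolding the recursion twice at the first entry produces \<open>cech G c us\<close>
  once with each sign; what remains is the same expression for the function with that entry put in
  front, to which the induction applies.\<close>

lemma cech_cech:
  assumes "\<And>vs. set vs \<subseteq> set us \<Longrightarrow> Suc (Suc (length vs)) = length us \<Longrightarrow> c vs \<in> carrier G"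
  shows "cech G (cech G c) us = \<one>"
  using assms
proof (induction us arbitrary: c)
  case (Cons u us)
  have cl: "cech G c us \<in> carrier G"
    by (auto intro!: cech_closed Cons.prems)
  have cu: "cech G (\<lambda>vs. c (u # vs)) vs \<in> carrier G" if "set vs \<subseteq> set us" "Suc (length vs) = length us" for vs
    using that by (intro cech_closed Cons.prems) auto
  have "cech G (\<lambda>vs. cech G c (u # vs)) us = cech G (\<lambda>vs. c vs \<otimes> inv cech G (\<lambda>vs. c (u # vs)) vs) us"
    by simp
  also have "\<dots> = cech G c us \<otimes> cech G (\<lambda>vs. inv cech G (\<lambda>vs. c (u # vs)) vs) us"
  proof (rule cech_mult)
    show "c vs \<in> carrier G" if "set vs \<subseteq> set us" "Suc (length vs) = length us" for vs
      by (rule Cons.prems) (use that in auto)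
  qed (use cu in simp)
  also have "\<dots> = cech G c us \<otimes> inv cech G (cech G (\<lambda>vs. c (u # vs))) us"
    using cu by (simp add: cech_inv)
  also have "cech G (cech G (\<lambda>vs. c (u # vs))) us = \<one>"
    by (intro Cons.IH Cons.prems) auto
  finally show ?case using cl by simp
qed simp

end

lemma (in group_hom) cech_hom:
  assumes "comm_group G" "\<And>vs. set vs \<subseteq> set us \<Longrightarrow> Suc (length vs) = length us \<Longrightarrow> c vs \<in> carrier G"
  shows "h (cech G c us) = cech H (\<lambda>vs. h (c vs)) us"
  using assms(2)
proof (induction us arbitrary: c)
  case (Cons u us)
  have "c us \<in> carrier G" by (auto intro: Cons.prems)
  moreover have "cech G (\<lambda>vs. c (u # vs)) us \<in> carrier G"
    by (auto intro!: comm_group.cech_closed[OF assms(1)] Cons.prems)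
  moreover have "h (cech G (\<lambda>vs. c (u # vs)) us) = cech H (\<lambda>vs. h (c (u # vs))) us"
    by (intro Cons.IH Cons.prems) auto
  ultimately show ?case by simp
qed simp

section \<open>Gluing and local properties in the site\<close>

context cutoff
begin

context
  fixes F :: "('a, 'g) presheaf"
  assumes F: "ab_presheaf \<kappa> F"
begin

lemma sections_comm_group: "X \<in> \<C> \<Longrightarrow> comm_group (sections F X)"
  using F by (simp add: ab_presheaf_def)

lemma pull_hom: "X \<in> \<C> \<Longrightarrow> Y \<in> \<C> \<Longrightarrow> f \<in> cmap X Y \<Longrightarrow> pull F X Y f \<in> hom (sections F Y) (sections F X)"
  using F by (simp add: ab_presheaf_def)

lemma pull_group_hom:
  assumes "X \<in> \<C>" "Y \<in> \<C>" "f \<in> cmap X Y"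
  shows "group_hom (sections F Y) (sections F X) (pull F X Y f)"
  using assms sections_comm_group pull_hom
  by (auto simp: group_hom_def group_hom_axioms_def comm_group_def)

lemma pull_closed:
  "X \<in> \<C> \<Longrightarrow> Y \<in> \<C> \<Longrightarrow> f \<in> cmap X Y \<Longrightarrow> s \<in> carrier (sections F Y) \<Longrightarrow> pull F X Y f s \<in> carrier (sections F X)"
  using pull_hom by (auto simp: hom_def)

lemma pull_id: "X \<in> \<C> \<Longrightarrow> s \<in> carrier (sections F X) \<Longrightarrow> pull F X X (restrict id (topspace X)) s = s"
  using F by (simp add: ab_presheaf_def)

lemma pull_compose:
  "X \<in> \<C> \<Longrightarrow> Y \<in> \<C> \<Longrightarrow> Z \<in> \<C> \<Longrightarrow> f \<in> cmap X Y \<Longrightarrow> g \<in> cmap Y Z \<Longrightarrow> s \<in> carrier (sections F Z) \<Longrightarrow>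
    pull F X Z (compose (topspace X) g f) s = pull F X Y f (pull F Y Z g s)"
  using F by (simp add: ab_presheaf_def)

end

lemma condensed_ab_presheaf: "condensed_ab \<kappa> F \<Longrightarrow> ab_presheaf \<kappa> F"
  by (simp add: condensed_ab_def)

lemma finite_coverD:
  assumes "finite_cover \<kappa> X \<U>"
  shows "finite \<U>" "(Z, f) \<in> \<U> \<Longrightarrow> Z \<in> \<C>" "(Z, f) \<in> \<U> \<Longrightarrow> f \<in> cmap Z X"
    "x \<in> topspace X \<Longrightarrow> \<exists>Z f z. (Z, f) \<in> \<U> \<and> z \<in> topspace Z \<and> f z = x"
proof -
  show "finite \<U>" "(Z, f) \<in> \<U> \<Longrightarrow> Z \<in> \<C>" "(Z, f) \<in> \<U> \<Longrightarrow> f \<in> cmap Z X"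
    using assms unfolding finite_cover_def by blast+
  assume "x \<in> topspace X"
  then have "x \<in> (\<Union>(Y, f) \<in> \<U>. f ` topspace Y)" using assms unfolding finite_cover_def by simp
  then show "\<exists>Z f z. (Z, f) \<in> \<U> \<and> z \<in> topspace Z \<and> f z = x" by auto
qed

lemma finite_coverI:
  assumes "finite \<U>" "\<And>Z f. (Z, f) \<in> \<U> \<Longrightarrow> Z \<in> \<C> \<and> f \<in> cmap Z X"
    "\<And>x. x \<in> topspace X \<Longrightarrow> \<exists>Z f z. (Z, f) \<in> \<U> \<and> z \<in> topspace Z \<and> f z = x"
  shows "finite_cover \<kappa> X \<U>"
  unfolding finite_cover_def
proof (intro conjI)
  show "(\<Union>(Y, f)\<in>\<U>. f ` topspace Y) = topspace X"
  proof
    show "(\<Union>(Y, f)\<in>\<U>. f ` topspace Y) \<subseteq> topspace X" using assms(2) cmap_in by fastforce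
    show "topspace X \<subseteq> (\<Union>(Y, f)\<in>\<U>. f ` topspace Y)"
    proof
      fix x assume "x \<in> topspace X"
      then obtain Z f z where "(Z, f) \<in> \<U>" "z \<in> topspace Z" "f z = x" using assms(3) by blast
      then show "x \<in> (\<Union>(Y, f)\<in>\<U>. f ` topspace Y)" by (intro UN_I[of "(Z, f)"]) auto
    qed
  qed
qed (use assms in auto)

lemma sheaf_separated:
  assumes F: "condensed_ab \<kappa> F" and X: "X \<in> \<C>" and \<U>: "finite_cover \<kappa> X \<U>"
    and s: "s \<in> carrier (sections F X)" and t: "t \<in> carrier (sections F X)"
    and eq: "\<And>Z f. (Z, f) \<in> \<U> \<Longrightarrow> pull F Z X f s = pull F Z X f t"
  shows "s = t"
proof -
  note P = condensed_ab_presheaf[OF F]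
  define r where "r = (\<lambda>(Z, f). pull F Z X f s)"
  have "compatible_family \<kappa> F \<U> r"
    unfolding compatible_family_def
  proof (intro conjI ballI; clarify)
    fix Z f assume i: "(Z, f) \<in> \<U>"
    show "r (Z, f) \<in> carrier (sections F Z)"
      using finite_coverD(2,3)[OF \<U> i] X s by (simp add: r_def pull_closed[OF P])
    fix Z' f' W p q assume i': "(Z', f') \<in> \<U>" and W: "W \<in> \<C>" and p: "p \<in> cmap W Z" and q: "q \<in> cmap W Z'"
      and eq: "compose (topspace W) f p = compose (topspace W) f' q"
    show "pull F W Z p (r (Z, f)) = pull F W Z' q (r (Z', f'))"
      using pull_compose[OF P W finite_coverD(2)[OF \<U> i] X p finite_coverD(3)[OF \<U> i] s]
        pull_compose[OF P W finite_coverD(2)[OF \<U> i'] X q finite_coverD(3)[OF \<U> i'] s] eq by (simp add: r_def)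
  qed
  then have "\<exists>!t. t \<in> carrier (sections F X) \<and> (\<forall>(Y, f) \<in> \<U>. pull F Y X f t = r (Y, f))"
    using F X \<U> by (simp add: condensed_ab_def)
  moreover have "s \<in> carrier (sections F X) \<and> (\<forall>(Y, f) \<in> \<U>. pull F Y X f s = r (Y, f))"
    using s by (auto simp: r_def)
  moreover have "t \<in> carrier (sections F X) \<and> (\<forall>(Y, f) \<in> \<U>. pull F Y X f t = r (Y, f))"
    using t eq by (auto simp: r_def)
  ultimately show ?thesis by blast
qed

lemma sheaf_glue:
  assumes F: "condensed_ab \<kappa> F" and X: "X \<in> \<C>" and \<U>: "finite_cover \<kappa> X \<U>"
    and s: "\<And>Z f. (Z, f) \<in> \<U> \<Longrightarrow> s (Z, f) \<in> carrier (sections F Z)"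
    and compat: "\<And>Z f Z' f' W p q. (Z, f) \<in> \<U> \<Longrightarrow> (Z', f') \<in> \<U> \<Longrightarrow> W \<in> \<C> \<Longrightarrow> p \<in> cmap W Z \<Longrightarrow> q \<in> cmap W Z' \<Longrightarrow>
      compose (topspace W) f p = compose (topspace W) f' q \<Longrightarrow> pull F W Z p (s (Z, f)) = pull F W Z' q (s (Z', f'))"
  obtains t where "t \<in> carrier (sections F X)" "\<And>Z f. (Z, f) \<in> \<U> \<Longrightarrow> pull F Z X f t = s (Z, f)"
proof -
  have "compatible_family \<kappa> F \<U> s"
    unfolding compatible_family_def using s compat by (intro conjI ballI; clarify)
  then obtain t where "t \<in> carrier (sections F X)" "\<forall>(Z, f) \<in> \<U>. pull F Z X f t = s (Z, f)"
    using F X \<U> unfolding condensed_ab_def by blast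
  then show ?thesis using that by fastforce
qed

lemma finite_cover_single: "Y \<in> \<C> \<Longrightarrow> p \<in> cmap Y X \<Longrightarrow> p ` topspace Y = topspace X \<Longrightarrow> finite_cover \<kappa> X {(Y, p)}"
  by (simp add: finite_cover_def)

text \<open>Exactness and the boundary sheaf are statements up to passing to a cover. Refinement
  arguments are carried out once, for a predicate on objects over \<open>X\<close>.\<close>

definition locally :: "'a topology \<Rightarrow> ('a topology \<Rightarrow> ('a \<Rightarrow> 'a) \<Rightarrow> bool) \<Rightarrow> bool"
  where "locally X P \<longleftrightarrow> (\<exists>\<U>. finite_cover \<kappa> X \<U> \<and> (\<forall>(Z, f) \<in> \<U>. P Z f))"

definition stable :: "'a topology \<Rightarrow> ('a topology \<Rightarrow> ('a \<Rightarrow> 'a) \<Rightarrow> bool) \<Rightarrow> bool"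
  where "stable X P \<longleftrightarrow> (\<forall>Z\<in>\<C>. \<forall>f\<in>cmap Z X. \<forall>V\<in>\<C>. \<forall>k\<in>cmap V Z. P Z f \<longrightarrow> P V (compose (topspace V) f k))"

lemma locallyE:
  assumes "locally X P"
  obtains \<U> where "finite_cover \<kappa> X \<U>" "\<forall>(Z, f) \<in> \<U>. P Z f"
  using assms unfolding locally_def by blast

lemma locallyI: "finite_cover \<kappa> X \<U> \<Longrightarrow> (\<And>Z f. (Z, f) \<in> \<U> \<Longrightarrow> P Z f) \<Longrightarrow> locally X P"
  unfolding locally_def by blast

lemma locally_mono:
  assumes "locally X P" "\<And>Z f. Z \<in> \<C> \<Longrightarrow> f \<in> cmap Z X \<Longrightarrow> P Z f \<Longrightarrow> Q Z f"
  shows "locally X Q"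
proof -
  obtain \<U> where \<U>: "finite_cover \<kappa> X \<U>" "\<forall>(Z, f) \<in> \<U>. P Z f" using assms(1) by (rule locallyE)
  show ?thesis
    using \<U> assms(2) finite_coverD(2,3)[OF \<U>(1)] by (intro locallyI[OF \<U>(1)]) blast
qed

lemma locally_id: "X \<in> \<C> \<Longrightarrow> P X (restrict id (topspace X)) \<Longrightarrow> locally X P"
  by (rule locallyI[OF finite_cover_single[OF _ cmap_id]]) auto

text \<open>The cover is pulled back along \<open>h\<close> by fibre products. Each new member maps
  to an old one with the same composite to \<open>X\<close>, which is where stability
  enters.\<close>

lemma locally_pull:
  assumes X: "X \<in> \<C>" and T: "T \<in> \<C>" and h: "h \<in> cmap T X" and P: "stable X P" "locally X P"
  shows "locally T (\<lambda>V g. P V (compose (topspace V) h g))"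
proof -
  obtain \<U> where U: "finite_cover \<kappa> X \<U>" "\<forall>(Z, f) \<in> \<U>. P Z f" using P(2) by (rule locallyE)
  note U1 = U(1)
  have U2: "P Z f" if "(Z, f) \<in> \<U>" for Z f using U that by auto
  note \<U> = U1 U2
  have "\<exists>V q. V \<in> \<C> \<and> q \<in> cmap V T \<and> P V (compose (topspace V) h q) \<and>
      (\<forall>z t. z \<in> topspace Z \<longrightarrow> t \<in> topspace T \<longrightarrow> f z = h t \<longrightarrow> t \<in> q ` topspace V)" if i: "(Z, f) \<in> \<U>" for Z f
  proof -
    obtain V p q where V1: "V \<in> \<C>" and fp: "is_fibre_product Z T f h V p q"
      by (rule fibre_product[OF finite_coverD(2)[OF \<U>(1) i] T CHausD(2)[OF X] finite_coverD(3)[OF \<U>(1) i] h])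
    then have V: "V \<in> \<C>" "p \<in> cmap V Z" "q \<in> cmap V T" "\<forall>z\<in>topspace V. f (p z) = h (q z)"
      and sur: "\<forall>x\<in>topspace Z. \<forall>y\<in>topspace T. f x = h y \<longrightarrow> (\<exists>z\<in>topspace V. p z = x \<and> q z = y)"
      by (simp_all add: is_fibre_product_def)
    have "compose (topspace V) f p = compose (topspace V) h q" using V(4) by (auto simp: compose_def)
    then have "P V (compose (topspace V) h q)"
      using P(1) \<U>(2)[OF i] V(1,2) finite_coverD(2,3)[OF \<U>(1) i] unfolding stable_def by metis
    moreover have "\<forall>z t. z \<in> topspace Z \<longrightarrow> t \<in> topspace T \<longrightarrow> f z = h t \<longrightarrow> t \<in> q ` topspace V"
      using sur by (metis imageI)
    ultimately show ?thesis using V(1,3) by blast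
  qed
  then have "\<exists>v. \<forall>i\<in>\<U>. fst (v i) \<in> \<C> \<and> snd (v i) \<in> cmap (fst (v i)) T \<and> P (fst (v i)) (compose (topspace (fst (v i))) h (snd (v i))) \<and>
      (\<forall>z t. z \<in> topspace (fst i) \<longrightarrow> t \<in> topspace T \<longrightarrow> snd i z = h t \<longrightarrow> t \<in> snd (v i) ` topspace (fst (v i)))"
    by (intro bchoice) force
  then obtain v where v: "\<And>i. i \<in> \<U> \<Longrightarrow> fst (v i) \<in> \<C> \<and> snd (v i) \<in> cmap (fst (v i)) T \<and> P (fst (v i)) (compose (topspace (fst (v i))) h (snd (v i)))"
    and sur: "\<And>i z t. i \<in> \<U> \<Longrightarrow> z \<in> topspace (fst i) \<Longrightarrow> t \<in> topspace T \<Longrightarrow> snd i z = h t \<Longrightarrow> t \<in> snd (v i) ` topspace (fst (v i))"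
    by blast
  have "finite_cover \<kappa> T (v ` \<U>)"
  proof (rule finite_coverI)
    show "finite (v ` \<U>)" using finite_coverD(1)[OF \<U>(1)] by simp
    show "Z \<in> \<C> \<and> f \<in> cmap Z T" if "(Z, f) \<in> v ` \<U>" for Z f using that v by (metis fst_conv imageE snd_conv)
    show "\<exists>Z f z. (Z, f) \<in> v ` \<U> \<and> z \<in> topspace Z \<and> f z = t" if t: "t \<in> topspace T" for t
    proof -
      obtain Z f z where z: "(Z, f) \<in> \<U>" "z \<in> topspace Z" "f z = h t"
        using finite_coverD(4)[OF \<U>(1) cmap_in[OF h t]] by blast
      then obtain y where y: "y \<in> topspace (fst (v (Z, f)))" "t = snd (v (Z, f)) y" using sur[of "(Z, f)" z t] t by auto
      have "(fst (v (Z, f)), snd (v (Z, f))) \<in> v ` \<U>" using z(1) by simp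
      then show ?thesis using y by blast
    qed
  qed
  then show ?thesis by (rule locallyI) (use v in \<open>metis fst_conv imageE snd_conv\<close>)
qed

text \<open>Covers of the members of a cover compose to a cover, which is again finite.\<close>

lemma locally_trans:
  assumes X: "X \<in> \<C>" and P: "locally X (\<lambda>Z f. locally Z (\<lambda>V g. P V (compose (topspace V) f g)))"
  shows "locally X P"
proof -
  obtain \<U> where \<U>: "finite_cover \<kappa> X \<U>" "\<forall>(Z, f) \<in> \<U>. locally Z (\<lambda>V g. P V (compose (topspace V) f g))"
    using P by (rule locallyE)
  have "\<exists>\<V>. \<forall>i\<in>\<U>. finite_cover \<kappa> (fst i) (\<V> i) \<and> (\<forall>(V, g) \<in> \<V> i. P V (compose (topspace V) (snd i) g))"
    using \<U>(2) unfolding locally_def by (intro bchoice) fastforce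
  then obtain \<V> where \<V>: "\<And>i. i \<in> \<U> \<Longrightarrow> finite_cover \<kappa> (fst i) (\<V> i)"
    "\<And>i V g. i \<in> \<U> \<Longrightarrow> (V, g) \<in> \<V> i \<Longrightarrow> P V (compose (topspace V) (snd i) g)" by blast
  define \<W> where "\<W> = (\<Union>i\<in>\<U>. (\<lambda>(V, g). (V, compose (topspace V) (snd i) g)) ` \<V> i)"
  have mem: "(V, k) \<in> \<W> \<longleftrightarrow> (\<exists>i g. i \<in> \<U> \<and> (V, g) \<in> \<V> i \<and> k = compose (topspace V) (snd i) g)" for V k
    by (force simp: \<W>_def)
  show ?thesis
  proof (rule locallyI[OF finite_coverI])
    show "finite \<W>"
      unfolding \<W>_def by (intro finite_UN_I finite_imageI finite_coverD(1)[OF \<U>(1)] finite_coverD(1)[OF \<V>(1)])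
    show "Z \<in> \<C> \<and> f \<in> cmap Z X" if m: "(Z, f) \<in> \<W>" for Z f
    proof -
      obtain i g where i: "i \<in> \<U>" "(Z, g) \<in> \<V> i" "f = compose (topspace Z) (snd i) g" using m unfolding mem by blast
      have "snd i \<in> cmap (fst i) X" using i(1) by (intro finite_coverD(3)[OF \<U>(1)]) simp
      then show ?thesis
        using finite_coverD(2,3)[OF \<V>(1)[OF i(1)] i(2)] unfolding i(3) by (blast intro: cmap_compose)
    qed
    show "\<exists>Z f z. (Z, f) \<in> \<W> \<and> z \<in> topspace Z \<and> f z = x" if x: "x \<in> topspace X" for x
    proof -
      obtain Z f z where z: "(Z, f) \<in> \<U>" "z \<in> topspace Z" "f z = x" using finite_coverD(4)[OF \<U>(1) x] by blast
      then obtain V g y where y: "(V, g) \<in> \<V> (Z, f)" "y \<in> topspace V" "g y = z"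
        using finite_coverD(4)[OF \<V>(1)[OF z(1)], of z] by auto
      have "(V, compose (topspace V) f g) \<in> \<W>" unfolding mem using z(1) y(1) by (metis snd_conv)
      then show ?thesis using y z by (metis compose_eq)
    qed
    show "P Z f" if m: "(Z, f) \<in> \<W>" for Z f
    proof -
      obtain i g where i: "i \<in> \<U>" "(Z, g) \<in> \<V> i" "f = compose (topspace Z) (snd i) g" using m unfolding mem by blast
      show ?thesis unfolding i(3) by (rule \<V>(2)[OF i(1,2)])
    qed
  qed
qed

text \<open>A common refinement: the cover for \<open>Q\<close> is pulled back to each member of the
  cover for \<open>P\<close>.\<close>

lemma locally_conj:
  assumes X: "X \<in> \<C>" and P: "stable X P" "locally X P" and Q: "stable X Q" "locally X Q"
  shows "locally X (\<lambda>Z f. P Z f \<and> Q Z f)"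
proof (rule locally_trans[OF X], rule locally_mono[OF P(2)])
  fix Z f assume Z: "Z \<in> \<C>" "f \<in> cmap Z X" "P Z f"
  have "P V (compose (topspace V) f g)" if "V \<in> \<C>" "g \<in> cmap V Z" for V g
    using P(1) Z that unfolding stable_def by blast
  then show "locally Z (\<lambda>V g. P V (compose (topspace V) f g) \<and> Q V (compose (topspace V) f g))"
    by (intro locally_mono[OF locally_pull[OF X Z(1,2) Q]]) auto
qed

text \<open>
  The \<open>T\<close>-valued points of the \<open>n\<close>-fold fibre power of \<open>p : Y \<rightarrow> S\<close>. Cochains are natural functions
  of such points, which avoids choosing a copy of the fibre power on the type \<open>'a\<close>.
\<close>

definition simplices :: "'a topology \<Rightarrow> ('a \<Rightarrow> 'a) \<Rightarrow> 'a topology \<Rightarrow> nat \<Rightarrow> ('a \<Rightarrow> 'a) list set"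
  where "simplices Y p T n = {us. length us = n \<and> set us \<subseteq> cmap T Y \<and>
    (\<forall>u\<in>set us. \<forall>v\<in>set us. compose (topspace T) p u = compose (topspace T) p v)}"

abbreviation precomp :: "'a topology \<Rightarrow> ('a \<Rightarrow> 'a) \<Rightarrow> ('a \<Rightarrow> 'a) list \<Rightarrow> ('a \<Rightarrow> 'a) list"
  where "precomp T h \<equiv> map (\<lambda>u. compose (topspace T) u h)"

definition cochain :: "('a, 'g) presheaf \<Rightarrow> 'a topology \<Rightarrow> ('a \<Rightarrow> 'a) \<Rightarrow> nat \<Rightarrow> ('a topology \<Rightarrow> ('a \<Rightarrow> 'a) list \<Rightarrow> 'g) \<Rightarrow> bool"
  where "cochain F Y p n c \<longleftrightarrow>
    (\<forall>T\<in>\<C>. \<forall>us\<in>simplices Y p T n. c T us \<in> carrier (sections F T)) \<and>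
    (\<forall>T\<in>\<C>. \<forall>T'\<in>\<C>. \<forall>h\<in>cmap T' T. \<forall>us\<in>simplices Y p T n. c T' (precomp T' h us) = pull F T' T h (c T us))"

lemma cochainD:
  assumes "cochain F Y p n c" "T \<in> \<C>" "us \<in> simplices Y p T n"
  shows "c T us \<in> carrier (sections F T)"
    and "T' \<in> \<C> \<Longrightarrow> h \<in> cmap T' T \<Longrightarrow> c T' (precomp T' h us) = pull F T' T h (c T us)"
proof -
  show "c T us \<in> carrier (sections F T)"
    using assms(1)[unfolded cochain_def, THEN conjunct1, rule_format, OF assms(2,3)] .
  assume "T' \<in> \<C>" "h \<in> cmap T' T"
  then show "c T' (precomp T' h us) = pull F T' T h (c T us)"
    by (rule assms(1)[unfolded cochain_def, THEN conjunct2, rule_format, OF assms(2) _ _ assms(3)])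
qed

lemma simplices_base:
  "us \<in> simplices Y p T n \<Longrightarrow> u \<in> set us \<Longrightarrow> v \<in> set us \<Longrightarrow> compose (topspace T) p u = compose (topspace T) p v"
  unfolding simplices_def by blast

lemma simplicesD:
  assumes "us \<in> simplices Y p T n"
  shows "length us = n" "u \<in> set us \<Longrightarrow> u \<in> cmap T Y"
  using assms unfolding simplices_def by blast+

lemma simplicesI:
  "length us = n \<Longrightarrow> (\<And>u. u \<in> set us \<Longrightarrow> u \<in> cmap T Y) \<Longrightarrow>
    (\<And>u v. u \<in> set us \<Longrightarrow> v \<in> set us \<Longrightarrow> compose (topspace T) p u = compose (topspace T) p v) \<Longrightarrow> us \<in> simplices Y p T n"
  unfolding simplices_def by blast

lemma simplices_precomp:
  assumes "us \<in> simplices Y p T n" "h \<in> cmap T' T"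
  shows "precomp T' h us \<in> simplices Y p T' n"
proof (rule simplicesI)
  show "length (precomp T' h us) = n" using simplicesD(1)[OF assms(1)] by simp
  show "u \<in> cmap T' Y" if "u \<in> set (precomp T' h us)" for u
    using that simplicesD(2)[OF assms(1)] cmap_compose[OF assms(2)] by auto
  fix u v assume "u \<in> set (precomp T' h us)" "v \<in> set (precomp T' h us)"
  then obtain a b where ab: "a \<in> set us" "b \<in> set us" "u = compose (topspace T') a h" "v = compose (topspace T') b h"
    by auto
  show "compose (topspace T') p u = compose (topspace T') p v"
    unfolding ab(3,4) cmap_compose_assoc[OF assms(2)] simplices_base[OF assms(1) ab(1,2)] ..
qed

lemma simplices_face:
  "us \<in> simplices Y p T (Suc n) \<Longrightarrow> set vs \<subseteq> set us \<Longrightarrow> Suc (length vs) = length us \<Longrightarrow> vs \<in> simplices Y p T n"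
  unfolding simplices_def by auto

lemma cochain_cech:
  assumes F: "ab_presheaf \<kappa> F" and c: "cochain F Y p n c"
  shows "cochain F Y p (Suc n) (\<lambda>T. cech (sections F T) (c T))"
  unfolding cochain_def
proof (intro conjI ballI)
  fix T us assume T: "T \<in> \<C>" and us: "us \<in> simplices Y p T (Suc n)"
  show "cech (sections F T) (c T) us \<in> carrier (sections F T)"
    by (intro comm_group.cech_closed sections_comm_group[OF F T] cochainD[OF c T] simplices_face[OF us])
next
  fix T T' h us assume T: "T \<in> \<C>" "T' \<in> \<C>" and h: "h \<in> cmap T' T" and us: "us \<in> simplices Y p T (Suc n)"
  have "cech (sections F T') (c T') (precomp T' h us) = cech (sections F T') (\<lambda>vs. pull F T' T h (c T vs)) us"
    unfolding cech_map by (intro cech_cong cochainD(2)[OF c T(1) _ T(2) h] simplices_face[OF us])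
  also have "\<dots> = pull F T' T h (cech (sections F T) (c T) us)"
    by (rule group_hom.cech_hom[OF pull_group_hom[OF F T(2,1) h] sections_comm_group[OF F T(1)], symmetric])
       (intro cochainD[OF c T(1)] simplices_face[OF us])
  finally show "cech (sections F T') (c T') (precomp T' h us) = pull F T' T h (cech (sections F T) (c T) us)" .
qed

end

section \<open>Continuous Cech cochains\<close>

abbreviation real_group :: "real monoid"
  where "real_group \<equiv> \<lparr>carrier = UNIV, mult = (+), one = 0\<rparr>"

lemma comm_group_real_group: "comm_group real_group"
  by (rule comm_groupI) (auto intro: exI[of _ "- x" for x] simp: add.commute[of "- _"])

lemma inv_real_group: "inv\<^bsub>real_group\<^esub> x = - x"
  using comm_group.axioms(2)[OF comm_group_real_group] by (intro group.inv_equality) auto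

lemma cech_real_Nil: "cech real_group c [] = 0"
  and cech_real_Cons: "cech real_group c (u # us) = c us - cech real_group (\<lambda>vs. c (u # vs)) us"
  by (simp_all add: inv_real_group)

lemmas cech_real = cech_real_Nil cech_real_Cons
declare cech.simps [simp del]

lemma cech_real_add: "cech real_group (\<lambda>vs. c vs + e vs) us = cech real_group c us + cech real_group e us"
  by (induction us arbitrary: c e) (simp_all add: cech_real)

lemma cech_real_diff: "cech real_group (\<lambda>vs. c vs - e vs) us = cech real_group c us - cech real_group e us"
  by (induction us arbitrary: c e) (simp_all add: cech_real)

lemma cech_real_scale: "cech real_group (\<lambda>vs. a * c vs) us = a * cech real_group c us"
  by (induction us arbitrary: c) (simp_all add: cech_real right_diff_distrib)

lemma cech_real_bound:
  assumes "\<And>vs. set vs \<subseteq> set us \<Longrightarrow> Suc (length vs) = length us \<Longrightarrow> \<bar>c vs\<bar> \<le> M"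
  shows "\<bar>cech real_group c us\<bar> \<le> real (length us) * M"
  using assms
proof (induction us arbitrary: c)
  case (Cons u us)
  have "\<bar>c us\<bar> \<le> M" by (rule Cons.prems) auto
  moreover have "\<bar>cech real_group (\<lambda>vs. c (u # vs)) us\<bar> \<le> real (length us) * M"
    by (intro Cons.IH Cons.prems) auto
  ultimately show ?case by (simp add: cech_real algebra_simps)
qed (simp add: cech_real)

lemma continuous_map_cech_real:
  assumes "\<And>vs. set vs \<subseteq> set us \<Longrightarrow> Suc (length vs) = length us \<Longrightarrow> continuous_map T euclideanreal (c vs)"
  shows "continuous_map T euclideanreal (\<lambda>t. cech real_group (\<lambda>vs. c vs t) us)"
  using assms
proof (induction us arbitrary: c)
  case (Cons u us)
  have "continuous_map T euclideanreal (c us)" by (rule Cons.prems) auto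
  moreover have "continuous_map T euclideanreal (\<lambda>t. cech real_group (\<lambda>vs. c (u # vs) t) us)"
    by (rule Cons.IH, rule Cons.prems) auto
  ultimately show ?case unfolding cech_real by (rule continuous_map_diff)
qed (simp add: cech_real)

abbreviation evaluate :: "('a \<Rightarrow> 'b) list \<Rightarrow> 'a \<Rightarrow> 'b list"
  where "evaluate us t \<equiv> map (\<lambda>u. u t) us"

text \<open>The points of the fibre power without a topology; continuity of a function on them is
  tested after \<open>evaluate us\<close> for all families \<open>us\<close>.\<close>

definition fibre_lists :: "'a topology \<Rightarrow> ('a \<Rightarrow> 'a) \<Rightarrow> nat \<Rightarrow> 'a list set"
  where "fibre_lists Y p n = {ys. length ys = n \<and> set ys \<subseteq> topspace Y \<and> (\<forall>y\<in>set ys. \<forall>z\<in>set ys. p y = p z)}"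

lemma fibre_listsI:
  "length ys = n \<Longrightarrow> set ys \<subseteq> topspace Y \<Longrightarrow> (\<And>y z. y \<in> set ys \<Longrightarrow> z \<in> set ys \<Longrightarrow> p y = p z) \<Longrightarrow> ys \<in> fibre_lists Y p n"
  unfolding fibre_lists_def by blast

lemma fibre_listsD:
  assumes "ys \<in> fibre_lists Y p n"
  shows "length ys = n" "set ys \<subseteq> topspace Y" "y \<in> set ys \<Longrightarrow> z \<in> set ys \<Longrightarrow> p y = p z"
  using assms unfolding fibre_lists_def by blast+

lemma fibre_lists_hd:
  assumes "ys \<in> fibre_lists Y p (Suc n)" "y \<in> set ys"
  shows "p y = p (hd ys)"
  using fibre_listsD(3)[OF assms(1,2) hd_in_set] assms(2) by (metis empty_iff empty_set)

lemma fibre_lists_face: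
  assumes "ys \<in> fibre_lists Y p (Suc n)" "set vs \<subseteq> set ys" "Suc (length vs) = length ys"
  shows "vs \<in> fibre_lists Y p n"
  using assms(2,3) fibre_listsD(1,2)[OF assms(1)] by (intro fibre_listsI fibre_listsD(3)[OF assms(1)]) auto

lemma constant_cmap: "y \<in> topspace Y \<Longrightarrow> (\<lambda>_\<in>topspace T. y) \<in> cmap T Y"
  by (rule cmap_restrict) simp

context cutoff
begin

lemma evaluate_simplices:
  assumes "us \<in> simplices Y p T n" "t \<in> topspace T"
  shows "evaluate us t \<in> fibre_lists Y p n"
proof (rule fibre_listsI)
  show "length (evaluate us t) = n" using simplicesD(1)[OF assms(1)] by simp
  show "set (evaluate us t) \<subseteq> topspace Y" using simplicesD(2)[OF assms(1)] cmap_in assms(2) by fastforce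
  fix y z assume "y \<in> set (evaluate us t)" "z \<in> set (evaluate us t)"
  then obtain u v where uv: "u \<in> set us" "v \<in> set us" "y = u t" "z = v t" by auto
  show "p y = p z"
    using fun_cong[OF simplices_base[OF assms(1) uv(1,2)], of t] assms(2) uv(3,4) by (simp add: compose_def)
qed

lemma evaluate_precomp: "t \<in> topspace T \<Longrightarrow> evaluate (precomp T h us) t = evaluate us (h t)"
  by (simp add: compose_def)

lemma constant_simplices:
  assumes "ys \<in> fibre_lists Y p n"
  shows "map (\<lambda>y. \<lambda>_\<in>topspace T. y) ys \<in> simplices Y p T n"
proof (rule simplicesI)
  show "length (map (\<lambda>y. \<lambda>_\<in>topspace T. y) ys) = n" using fibre_listsD(1)[OF assms] by simp
  show "u \<in> cmap T Y" if u: "u \<in> set (map (\<lambda>y. \<lambda>_\<in>topspace T. y) ys)" for u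
  proof -
    obtain y where y: "y \<in> set ys" "u = (\<lambda>_\<in>topspace T. y)" using u by auto
    then show ?thesis unfolding y(2) using fibre_listsD(2)[OF assms] by (intro constant_cmap) blast
  qed
  fix u v assume "u \<in> set (map (\<lambda>y. \<lambda>_\<in>topspace T. y) ys)" "v \<in> set (map (\<lambda>y. \<lambda>_\<in>topspace T. y) ys)"
  then obtain y z where yz: "y \<in> set ys" "z \<in> set ys" "u = (\<lambda>_\<in>topspace T. y)" "v = (\<lambda>_\<in>topspace T. z)" by auto
  show "compose (topspace T) p u = compose (topspace T) p v"
    using fibre_listsD(3)[OF assms yz(1,2)] by (auto simp: yz(3,4) compose_def restrict_def fun_eq_iff)
qed

text \<open>\<open>P\<close> is a copy of the n-fold fibre power and \<open>us\<close> lists its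
  projections; by Yoneda, cochains become sections over \<open>P\<close>.\<close>

definition universal :: "'a topology \<Rightarrow> ('a \<Rightarrow> 'a) \<Rightarrow> nat \<Rightarrow> 'a topology \<Rightarrow> ('a \<Rightarrow> 'a) list \<Rightarrow> bool"
  where "universal Y p n P us \<longleftrightarrow> us \<in> simplices Y p P n \<and>
    (\<forall>T. \<forall>vs\<in>simplices Y p T n. \<exists>h\<in>cmap T P. precomp T h us = vs) \<and>
    (\<forall>T. \<forall>h\<in>cmap T P. \<forall>k\<in>cmap T P. precomp T h us = precomp T k us \<longrightarrow> h = k)"

lemma precomp_precomp: "h \<in> cmap T Q \<Longrightarrow> precomp T h (precomp Q b us) = precomp T (compose (topspace T) b h) us"
  by (simp add: cmap_compose_assoc)

text \<open>One factor is attached at a time by a fibre product over \<open>S\<close>. At least one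
  factor is required: an empty list of maps does not remember a map to \<open>S\<close>, so the
  power with no factors would be a point.\<close>

lemma universal_exists:
  assumes Y: "Y \<in> \<C>" and S: "S \<in> \<C>" and p: "p \<in> cmap Y S"
  shows "\<exists>P us. P \<in> \<C> \<and> universal Y p (Suc n) P us"
proof (induction n)
  case 0
  have "universal Y p (Suc 0) Y [restrict id (topspace Y)]"
    unfolding universal_def
  proof (intro conjI allI ballI impI)
    show "[restrict id (topspace Y)] \<in> simplices Y p Y (Suc 0)"
      using cmap_id by (intro simplicesI) auto
    show "\<exists>h\<in>cmap T Y. precomp T h [restrict id (topspace Y)] = vs" if vs: "vs \<in> simplices Y p T (Suc 0)" for T vs
    proof -
      obtain v where "vs = [v]" "v \<in> cmap T Y" using simplicesD[OF vs] by (auto simp: length_Suc_conv)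
      then show ?thesis using cmap_id_compose by fastforce
    qed
    show "h = k" if "h \<in> cmap T Y" "k \<in> cmap T Y"
      "precomp T h [restrict id (topspace Y)] = precomp T k [restrict id (topspace Y)]" for T h k
      using that by (simp add: cmap_id_compose)
  qed
  then show ?case using Y by blast
next
  case (Suc n)
  then obtain P us where P: "P \<in> \<C>" and U: "universal Y p (Suc n) P us" by blast
  have us: "us \<in> simplices Y p P (Suc n)" using U by (simp add: universal_def)
  obtain u us' where us': "us = u # us'" using simplicesD(1)[OF us] by (auto simp: length_Suc_conv)
  have u: "u \<in> cmap P Y" using simplicesD(2)[OF us] us' by simp
  \<comment> \<open>All projections have the same image in \<open>S\<close>; that of
    \<open>u\<close> is the map over which the new factor \<open>Y\<close> is attached.\<close>
  define w where "w = compose (topspace P) p u"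
  have w: "w \<in> cmap P S" unfolding w_def using u p by (rule cmap_compose)
  obtain Q a b where Q: "Q \<in> \<C>" and fp: "is_fibre_product Y P p w Q a b"
    by (rule fibre_product[OF Y P CHausD(2)[OF S] p w])
  have a: "a \<in> cmap Q Y" and b: "b \<in> cmap Q P" and ab: "\<And>z. z \<in> topspace Q \<Longrightarrow> p (a z) = w (b z)"
    using fp by (auto simp: is_fibre_product_def)
  have bus: "precomp Q b us \<in> simplices Y p Q (Suc n)" by (rule simplices_precomp[OF us b])
  have "universal Y p (Suc (Suc n)) Q (a # precomp Q b us)"
    unfolding universal_def
  proof (intro conjI allI ballI impI)
    have "compose (topspace Q) p a = compose (topspace Q) p (compose (topspace Q) u b)"
      using ab cmap_in[OF b] by (auto simp: compose_def w_def fun_eq_iff)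
    moreover have "compose (topspace Q) p v = compose (topspace Q) p (compose (topspace Q) u b)" if "v \<in> set (precomp Q b us)" for v
    proof -
      have "compose (topspace Q) u b \<in> set (precomp Q b us)" by (simp add: us')
      then show ?thesis by (rule simplices_base[OF bus that])
    qed
    ultimately have "compose (topspace Q) p v = compose (topspace Q) p (compose (topspace Q) u b)"
      if "v \<in> set (a # precomp Q b us)" for v
      using that unfolding set_simps insert_iff by blast
    then show "a # precomp Q b us \<in> simplices Y p Q (Suc (Suc n))"
      using a simplicesD[OF bus] by (intro simplicesI) (auto simp del: set_map)
    show "\<exists>h\<in>cmap T Q. precomp T h (a # precomp Q b us) = vs" if vs: "vs \<in> simplices Y p T (Suc (Suc n))" for T vs
    proof -
      obtain v vs' where v: "vs = v # vs'" using simplicesD(1)[OF vs] by (auto simp: length_Suc_conv)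
      have vs': "vs' \<in> simplices Y p T (Suc n)" by (rule simplices_face[OF vs]) (auto simp: v)
      then obtain k where k: "k \<in> cmap T P" "precomp T k us = vs'" using U unfolding universal_def by blast
      have "p (v t) = w (k t)" if t: "t \<in> topspace T" for t
      proof -
        have "compose (topspace T) u k \<in> set vs" using k(2) by (auto simp: v us')
        then have "compose (topspace T) p v = compose (topspace T) p (compose (topspace T) u k)"
          by (intro simplices_base[OF vs]) (simp_all add: v)
        from fun_cong[OF this, of t] show ?thesis using t cmap_in[OF k(1) t] by (simp add: compose_def w_def)
      qed
      moreover have "v \<in> cmap T Y" using simplicesD(2)[OF vs] by (simp add: v)
      ultimately obtain h where h: "h \<in> cmap T Q" "compose (topspace T) a h = v" "compose (topspace T) b h = k"
        using fp k(1) unfolding is_fibre_product_def by blast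
      then have "precomp T h (a # precomp Q b us) = vs"
        using k(2) precomp_precomp[OF h(1), of b us] by (simp add: v)
      then show ?thesis using h(1) by blast
    qed
    show "h = k" if h: "h \<in> cmap T Q" and k: "k \<in> cmap T Q"
      and eq: "precomp T h (a # precomp Q b us) = precomp T k (a # precomp Q b us)" for T h k
    proof -
      have ea: "compose (topspace T) a h = compose (topspace T) a k" using eq by simp
      have "precomp T (compose (topspace T) b h) us = precomp T (compose (topspace T) b k) us"
        using eq precomp_precomp[OF h, of b us] precomp_precomp[OF k, of b us] by simp
      then have eb: "compose (topspace T) b h = compose (topspace T) b k"
        using U cmap_compose[OF h b] cmap_compose[OF k b] unfolding universal_def by blast
      have "a (h t) = a (k t)" "b (h t) = b (k t)" if "t \<in> topspace T" for t
        using that fun_cong[OF ea, of t] fun_cong[OF eb, of t] by (simp_all add: compose_def)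
      moreover have "\<forall>z\<in>topspace Q. \<forall>z'\<in>topspace Q. a z = a z' \<longrightarrow> b z = b z' \<longrightarrow> z = z'"
        using fp by (simp add: is_fibre_product_def)
      ultimately show ?thesis
        using cmap_in[OF h] cmap_in[OF k] by (intro cmap_eqI[OF h k]) simp
    qed
  qed
  then show ?case using Q by blast
qed

text \<open>Points are maps from a one-point space, to which \<open>universal\<close> applies
  because it quantifies over all topologies on \<open>'a\<close>.\<close>

lemma universal_points:
  assumes U: "universal Y p n P us"
  shows "ys \<in> fibre_lists Y p n \<Longrightarrow> \<exists>z\<in>topspace P. evaluate us z = ys"
    and "z \<in> topspace P \<Longrightarrow> z' \<in> topspace P \<Longrightarrow> evaluate us z = evaluate us z' \<Longrightarrow> z = z'"
proof -
  define pt where "pt = discrete_topology {undefined :: 'a}"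
  have top: "topspace pt = {undefined}" by (simp add: pt_def)
  {
    assume "ys \<in> fibre_lists Y p n"
    then have "map (\<lambda>y. \<lambda>_\<in>topspace pt. y) ys \<in> simplices Y p pt n" by (rule constant_simplices)
    then obtain h where h: "h \<in> cmap pt P" "precomp pt h us = map (\<lambda>y. \<lambda>_\<in>topspace pt. y) ys"
      using U unfolding universal_def by blast
    have "evaluate us (h undefined) = evaluate (precomp pt h us) undefined" 
      by (rule evaluate_precomp[symmetric]) (simp add: top)
    also have "\<dots> = ys" unfolding h(2) by (simp add: top o_def)
    finally show "\<exists>z\<in>topspace P. evaluate us z = ys" using cmap_in[OF h(1), of undefined] by (auto simp: top)
  }
  {
    assume z: "z \<in> topspace P" "z' \<in> topspace P" "evaluate us z = evaluate us z'"
    have "precomp pt (\<lambda>_\<in>topspace pt. z) us = precomp pt (\<lambda>_\<in>topspace pt. z') us"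
      using z(3) by (auto simp: compose_def top)
    then have "(\<lambda>_\<in>topspace pt. z) = (\<lambda>_\<in>topspace pt. z')"
      using U constant_cmap[OF z(1)] constant_cmap[OF z(2)] unfolding universal_def by blast
    from fun_cong[OF this, of undefined] show "z = z'" by (simp add: top)
  }
qed

definition continuous_cochain :: "'a topology \<Rightarrow> ('a \<Rightarrow> 'a) \<Rightarrow> nat \<Rightarrow> ('a list \<Rightarrow> real) \<Rightarrow> bool"
  where "continuous_cochain Y p n f \<longleftrightarrow>
    (\<forall>T\<in>\<C>. \<forall>us\<in>simplices Y p T n. continuous_map T euclideanreal (\<lambda>t. f (evaluate us t)))"

lemma continuous_cochain_cech:
  assumes "continuous_cochain Y p n g"
  shows "continuous_cochain Y p (Suc n) (cech real_group g)"
  unfolding continuous_cochain_def cech_map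
  by (intro ballI continuous_map_cech_real)
     (use assms in \<open>auto simp: continuous_cochain_def dest: simplices_face\<close>)

text \<open>Over a single point \<open>s\<close>, inserting a fixed \<open>y0\<close> of its fibre
  in front of a list is an exact contraction. The function it produces lives on a closed subset of
  the fibre power and is extended by Tietze within \<open>{-M..M}\<close>; its failure to solve the
  equation is small near the fibre by continuity and compactness. The locale does the rest.\<close>

lemma real_cech_exact:
  assumes Y: "Y \<in> \<C>" and S: "S \<in> \<C>" and p: "p \<in> cmap Y S" "p ` topspace Y = topspace S"
    and f: "continuous_cochain Y p (Suc (Suc n)) f"
    and df: "\<And>ys. ys \<in> fibre_lists Y p (Suc (Suc (Suc n))) \<Longrightarrow> cech real_group f ys = 0"
  shows "\<exists>g. continuous_cochain Y p (Suc n) g \<and> (\<forall>ys\<in>fibre_lists Y p (Suc (Suc n)). cech real_group g ys = f ys)"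
proof -
  let ?b = "\<lambda>ys. p (hd ys)"
  define coc where "coc f \<longleftrightarrow> continuous_cochain Y p (Suc (Suc n)) f \<and>
     (\<forall>ys \<in> fibre_lists Y p (Suc (Suc (Suc n))). cech real_group f ys = 0)" for f
  obtain P us where P: "P \<in> \<C>" and U: "universal Y p (Suc n) P us" using universal_exists[OF Y S p(1)] by blast
  \<comment> \<open>\<open>g\<close> will be constructed on \<open>P\<close>, while its differential
    is compared with \<open>f\<close> on \<open>Q\<close>, which has one factor more.\<close>
  obtain Q vs where Q: "Q \<in> \<C>" and V: "universal Y p (Suc (Suc n)) Q vs" using universal_exists[OF Y S p(1)] by blast
  have us: "us \<in> simplices Y p P (Suc n)" and vs: "vs \<in> simplices Y p Q (Suc (Suc n))"
    using U V by (auto simp: universal_def)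
  have base_in: "?b ys \<in> topspace S" if "ys \<in> fibre_lists Y p (Suc m)" for ys m
  proof -
    have "hd ys \<in> set ys" using fibre_listsD(1)[OF that] by (cases ys) auto
    then show ?thesis using fibre_listsD(2)[OF that] cmap_in[OF p(1)] by blast
  qed
  have base_face: "?b zs = ?b ys" if "ys \<in> fibre_lists Y p (Suc (Suc n))" "set zs \<subseteq> set ys" "Suc (length zs) = length ys" for ys zs
  proof (rule fibre_lists_hd[OF that(1)])
    have "zs \<noteq> []" using that(3) fibre_listsD(1)[OF that(1)] by auto
    then show "hd zs \<in> set ys" using that(2) hd_in_set by blast
  qed
  have cont_base: "continuous_map T S (\<lambda>t. ?b (evaluate ws t))" if ws: "ws \<in> simplices Y p T (Suc m)" for T ws m
  proof -
    obtain w ws' where "ws = w # ws'" "w \<in> cmap T Y" using simplicesD[OF ws] by (auto simp: length_Suc_conv)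
    then show ?thesis
      using continuous_map_compose[OF cmap_continuous cmap_continuous[OF p(1)], of w T] by (simp add: o_def)
  qed
  interpret fibrewise_approximation S "fibre_lists Y p (Suc n)" "fibre_lists Y p (Suc (Suc n))" ?b ?b
    "continuous_cochain Y p (Suc n)" coc "cech real_group" "real (Suc (Suc n))"
  proof
    show "continuous_cochain Y p (Suc n) (\<lambda>x. 0)" by (simp add: continuous_cochain_def)
    show "continuous_cochain Y p (Suc n) (\<lambda>x. g x + h x)"
      if "continuous_cochain Y p (Suc n) g" "continuous_cochain Y p (Suc n) h" for g h
      using that by (auto simp: continuous_cochain_def intro: continuous_map_add)
    show "continuous_cochain Y p (Suc n) (\<lambda>x. \<phi> (?b x) * g x)"
      if "continuous_map S euclideanreal \<phi>" "continuous_cochain Y p (Suc n) g" for \<phi> g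
      unfolding continuous_cochain_def
    proof (intro ballI continuous_map_real_mult)
      fix T ws assume "T \<in> \<C>" "ws \<in> simplices Y p T (Suc n)"
      then show "continuous_map T euclideanreal (\<lambda>t. g (evaluate ws t))" 
        using that(2) by (simp add: continuous_cochain_def)
      show "continuous_map T euclideanreal (\<lambda>t. \<phi> (?b (evaluate ws t)))"
        using continuous_map_compose[OF cont_base that(1)] \<open>ws \<in> simplices Y p T (Suc n)\<close> by (fastforce simp: o_def)
    qed
    show "continuous_cochain Y p (Suc n) l"
      if g: "\<And>k. continuous_cochain Y p (Suc n) (g k)" and lim: "uniform_limit (fibre_lists Y p (Suc n)) g l sequentially" for g l
      unfolding continuous_cochain_def
    proof (intro ballI)
      fix T ws assume T: "T \<in> \<C>" and ws: "ws \<in> simplices Y p T (Suc n)"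
      show "continuous_map T euclideanreal (\<lambda>t. l (evaluate ws t))"
      proof (rule continuous_map_real_uniform_limit)
        show "continuous_map T euclideanreal (\<lambda>t. g k (evaluate ws t))" for k
          using g[of k] T ws by (simp add: continuous_cochain_def)
        show "uniform_limit (topspace T) (\<lambda>k t. g k (evaluate ws t)) (\<lambda>t. l (evaluate ws t)) sequentially"
        proof (rule uniform_limitI)
          fix e :: real assume "0 < e"
          from uniform_limitD[OF lim this]
          show "\<forall>\<^sub>F k in sequentially. \<forall>t\<in>topspace T. dist (g k (evaluate ws t)) (l (evaluate ws t)) < e"
            by (rule eventually_mono) (use evaluate_simplices[OF ws] in blast)
        qed
      qed
    qed
    show "cech real_group (\<lambda>x. g x + h x) y = cech real_group g y + cech real_group h y" for g h y
      by (rule cech_real_add)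
    show "cech real_group (\<lambda>x. \<phi> (?b x) * g x) y = \<phi> (?b y) * cech real_group g y"
      if "y \<in> fibre_lists Y p (Suc (Suc n))" for \<phi> g y
      unfolding cech_real_scale[symmetric] using base_face[OF that] by (intro cech_cong) simp
    show "\<bar>cech real_group g y\<bar> \<le> real (Suc (Suc n)) * M"
      if y: "y \<in> fibre_lists Y p (Suc (Suc n))" and g: "\<And>x. x \<in> fibre_lists Y p (Suc n) \<Longrightarrow> \<bar>g x\<bar> \<le> M" for g M y
    proof -
      have "length y = Suc (Suc n)" using y by (simp add: fibre_lists_def)
      then show ?thesis using cech_real_bound[of y g M] fibre_lists_face[OF y] g by simp
    qed
    show "coc (\<lambda>y. f y - cech real_group g y)" if "coc f" "continuous_cochain Y p (Suc n) g" for f g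
    proof -
      have "cech real_group (cech real_group g) ys = 0" for ys :: "'a list"
        using comm_group.cech_cech[OF comm_group_real_group, of ys g] by simp
      moreover have "continuous_cochain Y p (Suc (Suc n)) (\<lambda>y. f y - cech real_group g y)"
        unfolding continuous_cochain_def
      proof (intro ballI continuous_map_diff)
        fix T ws assume "T \<in> \<C>" "ws \<in> simplices Y p T (Suc (Suc n))"
        then show "continuous_map T euclideanreal (\<lambda>t. f (evaluate ws t))"
          "continuous_map T euclideanreal (\<lambda>t. cech real_group g (evaluate ws t))"
          using that(1) continuous_cochain_cech[OF that(2)] unfolding coc_def continuous_cochain_def by blast+
      qed
      ultimately show ?thesis
        using that(1) by (simp add: coc_def cech_real_diff)
    qed
    show "\<exists>g V. continuous_cochain Y p (Suc n) g \<and> (\<forall>x\<in>fibre_lists Y p (Suc n). \<bar>g x\<bar> \<le> M) \<and> openin S V \<and> s \<in> V \<and>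
        (\<forall>y\<in>fibre_lists Y p (Suc (Suc n)). ?b y \<in> V \<longrightarrow> \<bar>cech real_group g y - f y\<bar> \<le> e)"
      if f: "coc f" "\<And>y. y \<in> fibre_lists Y p (Suc (Suc n)) \<Longrightarrow> \<bar>f y\<bar> \<le> M" and M: "0 \<le> M" 
        and s: "s \<in> topspace S" and e: "0 < e" for f M s e
    proof -
      \<comment> \<open>The cone point; surjectivity of \<open>p\<close> enters here.\<close>
      obtain y0 where y0: "y0 \<in> topspace Y" "p y0 = s" using s unfolding p(2)[symmetric] by auto
      define E where "E = {z \<in> topspace P. ?b (evaluate us z) = s}"
      have E: "closedin P E"
        using closedin_continuous_map_preimage[OF cont_base[OF us] closedin_Hausdorff_singleton[OF CHausD(2)[OF S] s]]
        by (simp add: E_def)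
      define PE where "PE = subtopology P E"
      have PE: "PE \<in> \<C>" unfolding PE_def by (rule closed_subspace_CHaus[OF P E])
      have tPE: "topspace PE = E" using closedin_subset[OF E] by (auto simp: PE_def)
      have "continuous_map PE P id" unfolding PE_def by (rule continuous_map_from_subtopology[OF continuous_map_id])
      then have incl: "restrict id E \<in> cmap PE P" using cmap_restrict[of PE P id] tPE by simp
      define ws where "ws = (\<lambda>_\<in>topspace PE. y0) # precomp PE (restrict id E) us"
      have uE: "precomp PE (restrict id E) us \<in> simplices Y p PE (Suc n)"
        by (rule simplices_precomp[OF us incl])
      have cone: "y0 # zs \<in> fibre_lists Y p (Suc (Suc m))" if "zs \<in> fibre_lists Y p (Suc m)" "?b zs = s" for zs m
      proof (rule fibre_listsI)
        have "p y = s" if "y \<in> set (y0 # zs)" for y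
          using that fibre_lists_hd[OF \<open>zs \<in> _\<close>] \<open>?b zs = s\<close> y0(2) by auto
        then show "p y = p z" if "y \<in> set (y0 # zs)" "z \<in> set (y0 # zs)" for y z using that by metis
      qed (use y0(1) fibre_listsD(1,2)[OF that(1)] in auto)
      have ws: "ws \<in> simplices Y p PE (Suc (Suc n))"
      proof -
        have "compose (topspace PE) p u = (\<lambda>_\<in>topspace PE. s)" if u: "u \<in> set (precomp PE (restrict id E) us)" for u
        proof (rule ext)
          fix t
          show "compose (topspace PE) p u t = (\<lambda>_\<in>topspace PE. s) t"
          proof (cases "t \<in> E")
            case True
            obtain v where v: "v \<in> set us" "u = compose (topspace PE) v (restrict id E)" using u by auto
            have ft: "evaluate us t \<in> fibre_lists Y p (Suc n)" using evaluate_simplices[OF us] True by (simp add: E_def)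
            have "us \<noteq> []" using v(1) by auto
            then have "hd (evaluate us t) \<in> set (evaluate us t)" by (cases us) auto
            moreover have "v t \<in> set (evaluate us t)" using v(1) by auto
            ultimately have "p (v t) = ?b (evaluate us t)" using fibre_listsD(3)[OF ft] by blast
            then show ?thesis using True v(2) tPE by (simp add: compose_def E_def)
          qed (simp add: compose_def tPE)
        qed
        moreover have "compose (topspace PE) p (\<lambda>_\<in>topspace PE. y0) = (\<lambda>_\<in>topspace PE. s)"
          using y0 by (auto simp: compose_def)
        ultimately have "compose (topspace PE) p u = (\<lambda>_\<in>topspace PE. s)" if "u \<in> set ws" for u
          using that unfolding ws_def set_simps insert_iff by blast
        then show ?thesis
          using constant_cmap[OF y0(1)] simplicesD[OF uE] by (intro simplicesI) (auto simp: ws_def simp del: set_map)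
      qed
      have evw: "evaluate ws z = y0 # evaluate us z" if "z \<in> E" for z
        using that tPE by (simp add: ws_def compose_def)
      have "continuous_map PE euclideanreal (\<lambda>z. f (evaluate ws z))"
        using f(1) PE ws by (simp add: coc_def continuous_cochain_def)
      then have "continuous_map PE euclideanreal (\<lambda>z. f (y0 # evaluate us z))"
        by (rule continuous_map_eq) (simp add: evw tPE)
      then have cE: "continuous_map (subtopology P E) euclideanreal (\<lambda>z. f (y0 # evaluate us z))"
        by (simp only: PE_def)
      have bE: "(\<lambda>z. f (y0 # evaluate us z)) ` E \<subseteq> {-M..M}"
      proof clarsimp
        fix z assume z: "z \<in> E"
        then have "\<bar>f (y0 # evaluate us z)\<bar> \<le> M"
          using evaluate_simplices[OF us] by (intro f(2) cone) (auto simp: E_def)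
        then show "- M \<le> f (y0 # evaluate us z) \<and> f (y0 # evaluate us z) \<le> M" by linarith
      qed
      have "normal_space P" using CHausD(1,2)[OF P] by (simp add: compact_Hausdorff_or_regular_imp_normal_space)
      \<comment> \<open>Tietze with values in \<open>{-M..M}\<close> is what keeps the constant in
        \<open>approx\<close> equal to 1.\<close>
      obtain h where h: "continuous_map P euclideanreal h" "h ` topspace P \<subseteq> {-M..M}"
        "\<And>z. z \<in> E \<Longrightarrow> h z = f (y0 # evaluate us z)"
      proof (rule Tietze_extension_realinterval[OF \<open>normal_space P\<close> E _ _ cE bE])
        show "is_interval {-M..M}" by (rule is_interval_cc)
        show "{-M..M} \<noteq> {}" using M by simp
        fix g assume g: "continuous_map P euclideanreal g" "g ` topspace P \<subseteq> {-M..M}"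
          "\<And>z. z \<in> E \<Longrightarrow> g z = f (y0 # evaluate us z)"
        show thesis by (rule that[of g]) (simp_all only: g)
      qed
      \<comment> \<open>Inverse of the bijection between the points of \<open>P\<close> and lists of
        points in a fibre, through which the extension \<open>h\<close> becomes a function of
        lists.\<close>
      define \<gamma> where "\<gamma> ys = (SOME z. z \<in> topspace P \<and> evaluate us z = ys)" for ys
      have \<gamma>: "\<gamma> ys \<in> topspace P" "evaluate us (\<gamma> ys) = ys" if "ys \<in> fibre_lists Y p (Suc n)" for ys
      proof -
        have "\<exists>z. z \<in> topspace P \<and> evaluate us z = ys" using universal_points(1)[OF U that] by blast
        from someI_ex[OF this] show "\<gamma> ys \<in> topspace P" "evaluate us (\<gamma> ys) = ys" by (simp_all add: \<gamma>_def)
      qed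
      define g where "g ys = h (\<gamma> ys)" for ys
      have g: "continuous_cochain Y p (Suc n) g"
        unfolding continuous_cochain_def
      proof (intro ballI)
        fix T xs assume T: "T \<in> \<C>" and xs: "xs \<in> simplices Y p T (Suc n)"
        obtain k where k: "k \<in> cmap T P" "precomp T k us = xs" using U xs unfolding universal_def by blast
        have "g (evaluate xs t) = h (k t)" if t: "t \<in> topspace T" for t
        proof -
          have eq: "evaluate xs t = evaluate us (k t)" using evaluate_precomp[OF t, of k us] k(2) by simp
          have "\<gamma> (evaluate us (k t)) = k t"
            using \<gamma>[OF evaluate_simplices[OF us cmap_in[OF k(1) t]]] cmap_in[OF k(1) t]
            by (intro universal_points(2)[OF U]) auto
          then show ?thesis unfolding g_def eq by simp
        qed
        moreover have "continuous_map T euclideanreal (\<lambda>t. h (k t))"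
          using continuous_map_compose[OF cmap_continuous[OF k(1)] h(1)] by (simp add: o_def)
        ultimately show "continuous_map T euclideanreal (\<lambda>t. g (evaluate xs t))"
          by (simp add: continuous_map_eq)
      qed
      \<comment> \<open>The cocycle relation at \<open>y0 # ys\<close>: omitting \<open>y0\<close>
        gives \<open>f ys\<close>, and the other faces are the cones that define \<open>g\<close>
        over \<open>s\<close>.\<close>
      have exact_fibre: "cech real_group g ys = f ys" if ys: "ys \<in> fibre_lists Y p (Suc (Suc n))" "?b ys = s" for ys
      proof -
        have "cech real_group g ys = cech real_group (\<lambda>zs. f (y0 # zs)) ys"
        proof (rule cech_cong)
          fix zs assume zs: "set zs \<subseteq> set ys" "Suc (length zs) = length ys"
          have "zs \<in> fibre_lists Y p (Suc n)" by (rule fibre_lists_face[OF ys(1) zs])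
          then have "\<gamma> zs \<in> E" "evaluate us (\<gamma> zs) = zs"
            using \<gamma> base_face[OF ys(1) zs] ys(2) by (auto simp: E_def)
          then show "g zs = f (y0 # zs)" using h(3) by (simp add: g_def)
        qed
        moreover have "cech real_group f (y0 # ys) = 0"
          using f(1) cone[OF ys] by (simp add: coc_def)
        ultimately show ?thesis by (simp add: cech_real)
      qed
      define W where "W = {z \<in> topspace Q. \<bar>cech real_group g (evaluate vs z) - f (evaluate vs z)\<bar> \<in> {..<e}}"
      have "openin Q W"
        unfolding W_def using continuous_cochain_cech[OF g] f(1) Q vs
        by (intro openin_continuous_map_preimage[where Y = euclideanreal] continuous_map_real_abs continuous_map_diff)
           (auto simp: coc_def continuous_cochain_def)
      \<comment> \<open>\<open>W\<close> is open in \<open>Q\<close> and contains everything over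
        \<open>s\<close>; the tube lemma turns this into a neighbourhood of
        \<open>s\<close>.\<close>
      define N where "N = {t \<in> topspace S. \<forall>z\<in>topspace Q. ?b (evaluate vs z) = t \<longrightarrow> z \<in> W}"
      have "openin S N"
        unfolding N_def using \<open>openin Q W\<close> by (intro openin_fibres_in cont_base[OF vs] CHausD Q S)
      moreover have "s \<in> N"
        using s exact_fibre evaluate_simplices[OF vs] e by (auto simp: N_def W_def)
      moreover have "\<bar>cech real_group g y - f y\<bar> \<le> e" if y: "y \<in> fibre_lists Y p (Suc (Suc n))" "?b y \<in> N" for y
      proof -
        obtain z where "z \<in> topspace Q" "evaluate vs z = y" using universal_points(1)[OF V y(1)] by blast
        then show ?thesis using y(2) by (auto simp: N_def W_def)
      qed
      moreover have "\<bar>g x\<bar> \<le> M" if "x \<in> fibre_lists Y p (Suc n)" for x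
      proof -
        have "h (\<gamma> x) \<in> {-M..M}" using h(2) \<gamma>(1)[OF that] by blast
        then show ?thesis by (auto simp: g_def)
      qed
      ultimately show ?thesis using g by blast
    qed
  qed (use base_in CHausD[OF S] in auto)
  \<comment> \<open>A bound for \<open>f\<close> comes from compactness of \<open>Q\<close>. Only
    existence of \<open>g\<close> is wanted, so the parameter of \<open>exact\<close> is set to
    1.\<close>
  have "compactin euclideanreal ((\<lambda>z. f (evaluate vs z)) ` topspace Q)"
    using f Q vs CHausD(1)[OF Q] by (intro image_compactin[of Q]) (auto simp: compact_space_def continuous_cochain_def)
  then have "bounded ((\<lambda>z. f (evaluate vs z)) ` topspace Q)" by (simp add: compact_imp_bounded)
  then obtain M where M: "\<And>z. z \<in> topspace Q \<Longrightarrow> \<bar>f (evaluate vs z)\<bar> \<le> M" "M > 0"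
    by (auto simp: bounded_pos)
  have "\<bar>f y\<bar> \<le> M" if "y \<in> fibre_lists Y p (Suc (Suc n))" for y
    using universal_points(1)[OF V that] M(1) by blast
  moreover have "coc f" using f df by (simp add: coc_def)
  ultimately show ?thesis using exact[of f M 1] M(2) by fastforce
qed

end

section \<open>Sheaves of functions\<close>

text \<open>
  Injectivity is tested on presheaves with values in \<open>'g\<close> only, so that presheaves on smaller types are
  transported along an injection into \<open>'g\<close>.
\<close>

definition image_monoid :: "('h \<Rightarrow> 'g) \<Rightarrow> 'h monoid \<Rightarrow> 'g monoid"
  where "image_monoid e G = \<lparr>carrier = e ` carrier G, mult = (\<lambda>x y. e (the_inv e x \<otimes>\<^bsub>G\<^esub> the_inv e y)), one = e \<one>\<^bsub>G\<^esub>\<rparr>"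

lemma image_monoid_simps [simp]:
  "carrier (image_monoid e G) = e ` carrier G"
  "x \<otimes>\<^bsub>image_monoid e G\<^esub> y = e (the_inv e x \<otimes>\<^bsub>G\<^esub> the_inv e y)"
  "\<one>\<^bsub>image_monoid e G\<^esub> = e \<one>\<^bsub>G\<^esub>"
  by (simp_all add: image_monoid_def)

lemma comm_group_image_monoid:
  assumes e: "inj e" and G: "comm_group G"
  shows "comm_group (image_monoid e G)"
proof -
  interpret G: comm_group G by (rule G)
  show ?thesis
  proof (rule comm_groupI)
    show "\<exists>y\<in>carrier (image_monoid e G). y \<otimes>\<^bsub>image_monoid e G\<^esub> x = \<one>\<^bsub>image_monoid e G\<^esub>"
      if x: "x \<in> carrier (image_monoid e G)" for x
    proof -
      obtain a where a: "a \<in> carrier G" "x = e a" using x by auto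
      show ?thesis
        by (rule bexI[of _ "e (inv\<^bsub>G\<^esub> a)"]) (use a e in \<open>simp_all add: the_inv_f_f\<close>)
    qed
  qed (use e in \<open>auto simp: the_inv_f_f G.m_ac\<close>)
qed

definition image_presheaf :: "('h \<Rightarrow> 'g) \<Rightarrow> ('a, 'h) presheaf \<Rightarrow> ('a, 'g) presheaf"
  where "image_presheaf e A = \<lparr>sections = (\<lambda>X. image_monoid e (sections A X)),
    pull = (\<lambda>X Y f s. e (pull A X Y f (the_inv e s)))\<rparr>"

lemma image_presheaf_simps [simp]:
  "sections (image_presheaf e A) X = image_monoid e (sections A X)"
  "pull (image_presheaf e A) X Y f s = e (pull A X Y f (the_inv e s))"
  by (simp_all add: image_presheaf_def)

definition function_group :: "'a topology \<Rightarrow> ('a \<Rightarrow> 'b :: ab_group_add) set \<Rightarrow> ('a \<Rightarrow> 'b) monoid"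
  where "function_group X C = \<lparr>carrier = C, mult = (\<lambda>f g. \<lambda>x\<in>topspace X. f x + g x), one = (\<lambda>x\<in>topspace X. 0)\<rparr>"

lemma function_group_simps [simp]:
  "carrier (function_group X C) = C"
  "f \<otimes>\<^bsub>function_group X C\<^esub> g = (\<lambda>x\<in>topspace X. f x + g x)"
  "\<one>\<^bsub>function_group X C\<^esub> = (\<lambda>x\<in>topspace X. 0)"
  by (simp_all add: function_group_def)

definition function_presheaf :: "('a topology \<Rightarrow> ('a \<Rightarrow> 'b :: ab_group_add) set) \<Rightarrow> ('a, 'a \<Rightarrow> 'b) presheaf"
  where "function_presheaf C = \<lparr>sections = (\<lambda>X. function_group X (C X)), pull = (\<lambda>X Y f g. compose (topspace X) g f)\<rparr>"

lemma function_presheaf_simps [simp]: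
  "sections (function_presheaf C) X = function_group X (C X)"
  "pull (function_presheaf C) X Y f g = compose (topspace X) g f"
  by (simp_all add: function_presheaf_def)

lemma comm_group_function_group:
  assumes ext: "C \<subseteq> extensional (topspace X)" and zero: "(\<lambda>x\<in>topspace X. 0) \<in> C"
    and diff: "\<And>f g. f \<in> C \<Longrightarrow> g \<in> C \<Longrightarrow> (\<lambda>x\<in>topspace X. f x - g x) \<in> C"
  shows "comm_group (function_group X C)"
proof -
  have neg: "(\<lambda>x\<in>topspace X. - f x) \<in> C" if "f \<in> C" for f
  proof -
    have "(\<lambda>x\<in>topspace X. (\<lambda>x\<in>topspace X. 0) x - f x) = (\<lambda>x\<in>topspace X. - f x)" by (auto simp: fun_eq_iff)
    then show ?thesis using diff[OF zero that] by simp
  qed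
  have add: "(\<lambda>x\<in>topspace X. f x + g x) \<in> C" if "f \<in> C" "g \<in> C" for f g
  proof -
    have "(\<lambda>x\<in>topspace X. f x - (\<lambda>x\<in>topspace X. - g x) x) = (\<lambda>x\<in>topspace X. f x + g x)" by (auto simp: fun_eq_iff)
    then show ?thesis using diff[OF that(1) neg[OF that(2)]] by simp
  qed
  show ?thesis
  proof (rule comm_groupI)
    show "\<exists>g\<in>carrier (function_group X C). g \<otimes>\<^bsub>function_group X C\<^esub> f = \<one>\<^bsub>function_group X C\<^esub>"
      if "f \<in> carrier (function_group X C)" for f
      by (rule bexI[of _ "\<lambda>x\<in>topspace X. - f x"]) (use neg that in \<open>auto simp: fun_eq_iff\<close>)
    show "\<one>\<^bsub>function_group X C\<^esub> \<otimes>\<^bsub>function_group X C\<^esub> f = f" if "f \<in> carrier (function_group X C)" for f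
      using that ext by (auto simp: fun_eq_iff extensional_def)
  qed (use zero add in \<open>auto simp: fun_eq_iff add.assoc add.commute\<close>)
qed

context cutoff
begin

lemma compatible_familyD:
  assumes "compatible_family \<kappa> F \<U> s" and i: "(Z, f) \<in> \<U>"
  shows "s (Z, f) \<in> carrier (sections F Z)"
    and "(Z', f') \<in> \<U> \<Longrightarrow> W \<in> \<C> \<Longrightarrow> p \<in> cmap W Z \<Longrightarrow> q \<in> cmap W Z' \<Longrightarrow>
      compose (topspace W) f p = compose (topspace W) f' q \<Longrightarrow> pull F W Z p (s (Z, f)) = pull F W Z' q (s (Z', f'))"
proof -
  show "s (Z, f) \<in> carrier (sections F Z)"
    using bspec[OF conjunct1[OF assms(1)[unfolded compatible_family_def]] i] by (simp only: prod.case)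
  have a: "\<forall>(Z', f') \<in> \<U>. \<forall>W \<in> \<C>. \<forall>p \<in> cmap W Z. \<forall>q \<in> cmap W Z'.
      compose (topspace W) f p = compose (topspace W) f' q \<longrightarrow> pull F W Z p (s (Z, f)) = pull F W Z' q (s (Z', f'))"
    using bspec[OF conjunct2[OF assms(1)[unfolded compatible_family_def]] i] by (simp only: prod.case)
  assume i': "(Z', f') \<in> \<U>" and W: "W \<in> \<C>" "p \<in> cmap W Z" "q \<in> cmap W Z'"
      "compose (topspace W) f p = compose (topspace W) f' q"
  have "\<forall>W \<in> \<C>. \<forall>p \<in> cmap W Z. \<forall>q \<in> cmap W Z'.
      compose (topspace W) f p = compose (topspace W) f' q \<longrightarrow> pull F W Z p (s (Z, f)) = pull F W Z' q (s (Z', f'))"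
    using bspec[OF a i'] by (simp only: prod.case)
  from this[rule_format, OF W] show "pull F W Z p (s (Z, f)) = pull F W Z' q (s (Z', f'))" .
qed

lemma condensed_image_presheaf:
  fixes e :: "'h \<Rightarrow> 'g"
  assumes e: "inj e" and A: "condensed_ab \<kappa> A"
  shows "condensed_ab \<kappa> (image_presheaf e A)"
proof -
  note P = condensed_ab_presheaf[OF A]
  have ab: "ab_presheaf \<kappa> (image_presheaf e A)"
    unfolding ab_presheaf_def
  proof (intro conjI ballI)
    show "comm_group (sections (image_presheaf e A) X)" if "X \<in> \<C>" for X
      using comm_group_image_monoid[OF e sections_comm_group[OF P that]] by simp
    show "pull (image_presheaf e A) X Y f \<in> hom (sections (image_presheaf e A) Y) (sections (image_presheaf e A) X)"
      if X: "X \<in> \<C>" "Y \<in> \<C>" "f \<in> cmap X Y" for X Y f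
      using hom_mult[OF pull_hom[OF P X]] pull_closed[OF P X] e
      by (intro homI) (auto simp: the_inv_f_f)
    show "pull (image_presheaf e A) X X (restrict id (topspace X)) s = s"
      if "X \<in> \<C>" "s \<in> carrier (sections (image_presheaf e A) X)" for X s
      using that e pull_id[OF P that(1)] by (auto simp: the_inv_f_f)
    show "pull (image_presheaf e A) X Z (compose (topspace X) g f) s = pull (image_presheaf e A) X Y f (pull (image_presheaf e A) Y Z g s)"
      if "X \<in> \<C>" "Y \<in> \<C>" "Z \<in> \<C>" "f \<in> cmap X Y" "g \<in> cmap Y Z" "s \<in> carrier (sections (image_presheaf e A) Z)" for X Y Z f g s
      using that(6) e pull_compose[OF P that(1-5)] by (auto simp: the_inv_f_f)
  qed
  have glue: "\<exists>!t. t \<in> carrier (sections (image_presheaf e A) X) \<and> (\<forall>(Y, f) \<in> \<U>. pull (image_presheaf e A) Y X f t = s (Y, f))"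
    if X: "X \<in> \<C>" and \<U>: "finite_cover \<kappa> X \<U>" and s: "compatible_family \<kappa> (image_presheaf e A) \<U> s" for X \<U> s
  proof -
    have mem: "s (Z, f) \<in> e ` carrier (sections A Z)" if "(Z, f) \<in> \<U>" for Z f
      using compatible_familyD(1)[OF s that] by simp
    have val: "e (the_inv e (s (Z, f))) = s (Z, f)" "the_inv e (s (Z, f)) \<in> carrier (sections A Z)" if "(Z, f) \<in> \<U>" for Z f
      using mem[OF that] e by (auto simp: the_inv_f_f)
    obtain t where t: "t \<in> carrier (sections A X)" "\<And>Z f. (Z, f) \<in> \<U> \<Longrightarrow> pull A Z X f t = the_inv e (s (Z, f))"
    proof (rule sheaf_glue[OF A X \<U>, of "\<lambda>i. the_inv e (s i)"])
      show "the_inv e (s (Z, f)) \<in> carrier (sections A Z)" if "(Z, f) \<in> \<U>" for Z f by (rule val(2)[OF that])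
      show "pull A W Z p (the_inv e (s (Z, f))) = pull A W Z' q (the_inv e (s (Z', f')))"
        if i: "(Z, f) \<in> \<U>" "(Z', f') \<in> \<U>" and W: "W \<in> \<C>" "p \<in> cmap W Z" "q \<in> cmap W Z'"
          and eq: "compose (topspace W) f p = compose (topspace W) f' q" for Z f Z' f' W p q
      proof -
        have "e (pull A W Z p (the_inv e (s (Z, f)))) = e (pull A W Z' q (the_inv e (s (Z', f'))))"
          using compatible_familyD(2)[OF s i W eq] by simp
        then show ?thesis using e by (simp add: inj_eq)
      qed
      fix t assume "t \<in> carrier (sections A X)" "\<And>Z f. (Z, f) \<in> \<U> \<Longrightarrow> pull A Z X f t = the_inv e (s (Z, f))"
      then show thesis by (rule that)
    qed
    show ?thesis
    proof (rule ex1I[of _ "e t"])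
      show "e t \<in> carrier (sections (image_presheaf e A) X) \<and> (\<forall>(Y, f) \<in> \<U>. pull (image_presheaf e A) Y X f (e t) = s (Y, f))"
        using t val e by (auto simp: the_inv_f_f)
      fix t' assume t': "t' \<in> carrier (sections (image_presheaf e A) X) \<and> (\<forall>(Y, f) \<in> \<U>. pull (image_presheaf e A) Y X f t' = s (Y, f))"
      then obtain u where u: "u \<in> carrier (sections A X)" "t' = e u" by auto
      have "u = t"
      proof (rule sheaf_separated[OF A X \<U> u(1) t(1)])
        fix Z f assume i: "(Z, f) \<in> \<U>"
        have "e (pull A Z X f u) = s (Z, f)" using t' i e by (auto simp: u(2) the_inv_f_f)
        then show "pull A Z X f u = pull A Z X f t" using t(2)[OF i] e by (simp add: the_inv_f_f flip: \<open>e _ = s (Z, f)\<close>)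
      qed
      then show "t' = e t" using u(2) by simp
    qed
  qed
  show ?thesis
    unfolding condensed_ab_def using ab glue by blast
qed

lemma condensed_homD:
  assumes "condensed_hom \<kappa> F G \<phi>"
  shows "X \<in> \<C> \<Longrightarrow> \<phi> X \<in> hom (sections F X) (sections G X)"
    and "X \<in> \<C> \<Longrightarrow> Y \<in> \<C> \<Longrightarrow> f \<in> cmap X Y \<Longrightarrow> s \<in> carrier (sections F Y) \<Longrightarrow> \<phi> X (pull F X Y f s) = pull G X Y f (\<phi> Y s)"
  using assms by (simp_all add: condensed_hom_def)

lemma condensed_hom_closed:
  "condensed_hom \<kappa> F G \<phi> \<Longrightarrow> X \<in> \<C> \<Longrightarrow> s \<in> carrier (sections F X) \<Longrightarrow> \<phi> X s \<in> carrier (sections G X)"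
  by (rule hom_in_carrier[OF condensed_homD(1)])

text \<open>Injectivity against sheaves on another type: \<open>A\<close> and \<open>B\<close> are
  replaced by their copies under \<open>e\<close>, which are again sheaves, and the extension found
  there is composed with \<open>e\<close>.\<close>

lemma injective_extend:
  fixes e :: "'h \<Rightarrow> 'g" and J :: "('a, 'g) presheaf" and A B :: "('a, 'h) presheaf"
  assumes J: "condensed_injective \<kappa> J" and e: "inj e" and A: "condensed_ab \<kappa> A" and B: "condensed_ab \<kappa> B"
    and m: "condensed_mono \<kappa> A B m" and \<phi>: "condensed_hom \<kappa> A J \<phi>"
  obtains \<psi> where "condensed_hom \<kappa> B J \<psi>" "\<And>X s. X \<in> \<C> \<Longrightarrow> s \<in> carrier (sections A X) \<Longrightarrow> \<psi> X (m X s) = \<phi> X s"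
proof -
  let ?A = "image_presheaf e A" and ?B = "image_presheaf e B"
  have mh: "condensed_hom \<kappa> A B m" and mi: "\<And>X. X \<in> \<C> \<Longrightarrow> inj_on (m X) (carrier (sections A X))"
    using m by (auto simp: condensed_mono_def)
  have m': "condensed_mono \<kappa> ?A ?B (\<lambda>X s. e (m X (the_inv e s)))"
    unfolding condensed_mono_def condensed_hom_def
  proof (intro conjI ballI)
    show "(\<lambda>s. e (m X (the_inv e s))) \<in> hom (sections ?A X) (sections ?B X)" if X: "X \<in> \<C>" for X
      using hom_mult[OF condensed_homD(1)[OF mh X]] condensed_hom_closed[OF mh X] e
      by (intro homI) (auto simp: the_inv_f_f)
    show "e (m X (the_inv e (pull ?A X Y f s))) = pull ?B X Y f (e (m Y (the_inv e s)))"
      if "X \<in> \<C>" "Y \<in> \<C>" "f \<in> cmap X Y" "s \<in> carrier (sections ?A Y)" for X Y f s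
      using that(4) condensed_homD(2)[OF mh that(1-3)] e by (auto simp: the_inv_f_f)
    show "inj_on (\<lambda>s. e (m X (the_inv e s))) (carrier (sections ?A X))" if X: "X \<in> \<C>" for X
    proof (rule inj_onI)
      fix s t assume "s \<in> carrier (sections ?A X)" "t \<in> carrier (sections ?A X)"
        and eq: "e (m X (the_inv e s)) = e (m X (the_inv e t))"
      then obtain a b where ab: "a \<in> carrier (sections A X)" "b \<in> carrier (sections A X)" "s = e a" "t = e b" by auto
      have "m X a = m X b" using eq e unfolding ab(3,4) by (simp add: the_inv_f_f inj_eq)
      then show "s = t" using inj_onD[OF mi[OF X] _ ab(1,2)] ab(3,4) by simp
    qed
  qed
  have \<phi>': "condensed_hom \<kappa> ?A J (\<lambda>X s. \<phi> X (the_inv e s))"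
    unfolding condensed_hom_def
  proof (intro conjI ballI)
    show "(\<lambda>s. \<phi> X (the_inv e s)) \<in> hom (sections ?A X) (sections J X)" if X: "X \<in> \<C>" for X
      using hom_mult[OF condensed_homD(1)[OF \<phi> X]] condensed_hom_closed[OF \<phi> X] e
      by (intro homI) (auto simp: the_inv_f_f)
    show "\<phi> X (the_inv e (pull ?A X Y f s)) = pull J X Y f (\<phi> Y (the_inv e s))"
      if "X \<in> \<C>" "Y \<in> \<C>" "f \<in> cmap X Y" "s \<in> carrier (sections ?A Y)" for X Y f s
      using that(4) condensed_homD(2)[OF \<phi> that(1-3)] e by (auto simp: the_inv_f_f)
  qed
  obtain \<psi> where \<psi>: "condensed_hom \<kappa> ?B J \<psi>"
    "\<forall>X\<in>\<C>. \<forall>s\<in>carrier (sections ?A X). \<psi> X (e (m X (the_inv e s))) = \<phi> X (the_inv e s)"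
    using J condensed_image_presheaf[OF e A] condensed_image_presheaf[OF e B] m' \<phi>'
    unfolding condensed_injective_def by blast
  show ?thesis
  proof (rule that[of "\<lambda>X s. \<psi> X (e s)"])
    show "condensed_hom \<kappa> B J (\<lambda>X s. \<psi> X (e s))"
      unfolding condensed_hom_def
    proof (intro conjI ballI)
      show "(\<lambda>s. \<psi> X (e s)) \<in> hom (sections B X) (sections J X)" if X: "X \<in> \<C>" for X
      proof (rule homI)
        show "\<psi> X (e s) \<in> carrier (sections J X)" if "s \<in> carrier (sections B X)" for s
          by (rule condensed_hom_closed[OF \<psi>(1) X]) (use that in simp)
        show "\<psi> X (e (s \<otimes>\<^bsub>sections B X\<^esub> t)) = \<psi> X (e s) \<otimes>\<^bsub>sections J X\<^esub> \<psi> X (e t)"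
          if "s \<in> carrier (sections B X)" "t \<in> carrier (sections B X)" for s t
          using hom_mult[OF condensed_homD(1)[OF \<psi>(1) X], of "e s" "e t"] that e by (simp add: the_inv_f_f)
      qed
      show "\<psi> X (e (pull B X Y f s)) = pull J X Y f (\<psi> Y (e s))"
        if "X \<in> \<C>" "Y \<in> \<C>" "f \<in> cmap X Y" "s \<in> carrier (sections B Y)" for X Y f s
        using condensed_homD(2)[OF \<psi>(1) that(1-3), of "e s"] that(4) e by (simp add: the_inv_f_f)
    qed
    show "\<psi> X (e (m X s)) = \<phi> X s" if "X \<in> \<C>" "s \<in> carrier (sections A X)" for X s
      using \<psi>(2)[rule_format, of X "e s"] that e by (simp add: the_inv_f_f)
  qed
qed

text \<open>Arbitrary functions glue along jointly surjective maps as soon as they agree on points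
  with the same image, so a presheaf of functions is a sheaf once membership in it is a local
  condition.\<close>

lemma condensed_function_presheaf:
  fixes C :: "'a topology \<Rightarrow> ('a \<Rightarrow> 'b :: ab_group_add) set"
  assumes ext: "\<And>X. X \<in> \<C> \<Longrightarrow> C X \<subseteq> extensional (topspace X)"
    and zero: "\<And>X. X \<in> \<C> \<Longrightarrow> (\<lambda>x\<in>topspace X. 0) \<in> C X"
    and diff: "\<And>X f g. X \<in> \<C> \<Longrightarrow> f \<in> C X \<Longrightarrow> g \<in> C X \<Longrightarrow> (\<lambda>x\<in>topspace X. f x - g x) \<in> C X"
    and pull: "\<And>X Y h f. X \<in> \<C> \<Longrightarrow> Y \<in> \<C> \<Longrightarrow> h \<in> cmap X Y \<Longrightarrow> f \<in> C Y \<Longrightarrow> compose (topspace X) f h \<in> C X"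
    and local: "\<And>X f. X \<in> \<C> \<Longrightarrow> f \<in> extensional (topspace X) \<Longrightarrow>
      locally X (\<lambda>Z k. compose (topspace Z) f k \<in> C Z) \<Longrightarrow> f \<in> C X"
  shows "condensed_ab \<kappa> (function_presheaf C)"
proof -
  have ab: "ab_presheaf \<kappa> (function_presheaf C)"
    unfolding ab_presheaf_def
  proof (intro conjI ballI)
    show "comm_group (sections (function_presheaf C) X)" if X: "X \<in> \<C>" for X
      unfolding function_presheaf_simps
    proof (rule comm_group_function_group[OF ext[OF X] zero[OF X]])
      fix f g assume "f \<in> C X" "g \<in> C X"
      then show "(\<lambda>x\<in>topspace X. f x - g x) \<in> C X" by (rule diff[OF X])
    qed
    show "pull (function_presheaf C) X Y f \<in> hom (sections (function_presheaf C) Y) (sections (function_presheaf C) X)"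
      if X: "X \<in> \<C>" "Y \<in> \<C>" "f \<in> cmap X Y" for X Y f
    proof (rule homI)
      show "pull (function_presheaf C) X Y f s \<in> carrier (sections (function_presheaf C) X)"
        if "s \<in> carrier (sections (function_presheaf C) Y)" for s
        using pull[OF X, of s] that by simp
      show "pull (function_presheaf C) X Y f (s \<otimes>\<^bsub>sections (function_presheaf C) Y\<^esub> t) =
          pull (function_presheaf C) X Y f s \<otimes>\<^bsub>sections (function_presheaf C) X\<^esub> pull (function_presheaf C) X Y f t" for s t
        using cmap_in[OF X(3)] by (simp add: compose_def fun_eq_iff)
    qed
    show "pull (function_presheaf C) X X (restrict id (topspace X)) s = s"
      if "X \<in> \<C>" "s \<in> carrier (sections (function_presheaf C) X)" for X s
      using that ext[OF that(1)] by (auto simp: compose_def fun_eq_iff extensional_def)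
    show "pull (function_presheaf C) X Z (compose (topspace X) g f) s = pull (function_presheaf C) X Y f (pull (function_presheaf C) Y Z g s)"
      if "X \<in> \<C>" "Y \<in> \<C>" "Z \<in> \<C>" "f \<in> cmap X Y" "g \<in> cmap Y Z" "s \<in> carrier (sections (function_presheaf C) Z)" for X Y Z f g s
      using cmap_compose_assoc[OF that(4)] by simp
  qed
  have glue: "\<exists>!t. t \<in> carrier (sections (function_presheaf C) X) \<and> (\<forall>(Y, f) \<in> \<U>. pull (function_presheaf C) Y X f t = s (Y, f))"
    if X: "X \<in> \<C>" and \<U>: "finite_cover \<kappa> X \<U>" and s: "compatible_family \<kappa> (function_presheaf C) \<U> s" for X \<U> s
  proof -
    have mem: "s (Z, f) \<in> C Z" if "(Z, f) \<in> \<U>" for Z f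
      using compatible_familyD(1)[OF s that] by simp
    have agree: "s (Z, f) z = s (Z', f') z'"
      if i: "(Z, f) \<in> \<U>" "(Z', f') \<in> \<U>" and z: "z \<in> topspace Z" "z' \<in> topspace Z'" and eq: "f z = f' z'" for Z f Z' f' z z'
    proof -
      \<comment> \<open>Compatibility on a one-point object is agreement of values at the two points
        \<open>z\<close> and \<open>z'\<close>.\<close>
      define W where "W = subtopology Z {z}"
      have W: "W \<in> \<C>" unfolding W_def by (rule singleton_CHaus[OF finite_coverD(2)[OF \<U> i(1)] z(1)])
      have tW: "topspace W = {z}" using z by (simp add: W_def)
      have pq: "(\<lambda>_\<in>topspace W. z) \<in> cmap W Z" "(\<lambda>_\<in>topspace W. z') \<in> cmap W Z'"
        using z by (auto intro: constant_cmap)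
      have "compose (topspace W) f (\<lambda>_\<in>topspace W. z) = compose (topspace W) f' (\<lambda>_\<in>topspace W. z')"
        using eq by (auto simp: compose_def fun_eq_iff)
      then have "compose (topspace W) (s (Z, f)) (\<lambda>_\<in>topspace W. z) = compose (topspace W) (s (Z', f')) (\<lambda>_\<in>topspace W. z')"
        using compatible_familyD(2)[OF s i W pq] by simp
      from fun_cong[OF this, of z] show ?thesis by (simp add: compose_def tW)
    qed
    define good where "good x v \<longleftrightarrow> (\<exists>Z f z. (Z, f) \<in> \<U> \<and> z \<in> topspace Z \<and> f z = x \<and> v = s (Z, f) z)" for x v
    define t where "t = (\<lambda>x\<in>topspace X. SOME v. good x v)"
    have t: "t (f z) = s (Z, f) z" if i: "(Z, f) \<in> \<U>" and z: "z \<in> topspace Z" for Z f z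
    proof -
      have fz: "f z \<in> topspace X" using cmap_in[OF finite_coverD(3)[OF \<U> i] z] .
      have "good (f z) (s (Z, f) z)" unfolding good_def using i z by blast
      then have "good (f z) (SOME v. good (f z) v)" by (rule someI)
      then have "good (f z) (t (f z))" using fz by (simp add: t_def)
      then obtain Z' f' z' where "(Z', f') \<in> \<U>" "z' \<in> topspace Z'" "f' z' = f z" "t (f z) = s (Z', f') z'"
        unfolding good_def by blast
      then show ?thesis using agree[OF i _ z, of Z' f' z'] by simp
    qed
    have ct: "compose (topspace Z) t f = s (Z, f)" if i: "(Z, f) \<in> \<U>" for Z f
    proof (rule extensionalityI)
      show "s (Z, f) \<in> extensional (topspace Z)" using mem[OF i] ext[OF finite_coverD(2)[OF \<U> i]] by blast
    qed (use t[OF i] in \<open>auto simp: compose_def\<close>)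
    show ?thesis
    proof (rule ex1I[of _ t])
      have "t \<in> C X"
        by (rule local[OF X _ locallyI[OF \<U>]]) (use ct mem in \<open>auto simp: t_def\<close>)
      then show "t \<in> carrier (sections (function_presheaf C) X) \<and> (\<forall>(Y, f) \<in> \<U>. pull (function_presheaf C) Y X f t = s (Y, f))"
        using ct by auto
      fix t' assume t': "t' \<in> carrier (sections (function_presheaf C) X) \<and> (\<forall>(Y, f) \<in> \<U>. pull (function_presheaf C) Y X f t' = s (Y, f))"
      show "t' = t"
      proof (rule extensionalityI)
        show "t' \<in> extensional (topspace X)" using t' ext[OF X] by auto
        show "t \<in> extensional (topspace X)" by (simp add: t_def)
        fix x assume "x \<in> topspace X"
        then obtain Z f z where z: "(Z, f) \<in> \<U>" "z \<in> topspace Z" "f z = x" using finite_coverD(4)[OF \<U>] by blast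
        have "compose (topspace Z) t' f = s (Z, f)" using t' z(1) by auto
        from fun_cong[OF this, of z] show "t' x = t x" using t[OF z(1,2)] z(2,3) by (simp add: compose_def)
      qed
    qed
  qed
  show ?thesis
    unfolding condensed_ab_def using ab glue by blast
qed

end

context
  includes cardinal_syntax
begin

text \<open>Lists over the infinite type \<open>'a\<close> and their integral combinations number at
  most \<open>2^|'a|\<close>. A function is determined by its graph, a set of pairs of that many
  kinds, so there are at most \<open>2^(2^|'a|)\<close> functions.\<close>

lemma frag_functions_embed:
  assumes inf: "infinite (UNIV :: 'a set)" and big: "|UNIV :: 'a set set set| \<le>o |UNIV :: 'g set|"
  shows "\<exists>e :: ('a \<Rightarrow> 'a list \<Rightarrow>\<^sub>0 int) \<Rightarrow> 'g. inj e"
proof -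
  let ?A = "|UNIV :: 'a set|" and ?P = "|UNIV :: 'a set set|"
  have AP: "?A \<le>o ?P"
    by (rule card_of_ordLeqI[of "\<lambda>x. {x}"]) auto
  have infP: "infinite (UNIV :: 'a set set)"
    using inf by (simp add: Finite_Set.finite_set)
  have "|UNIV :: nat set| \<le>o ?A" using inf infinite_iff_card_of_nat by blast
  then have "|(UNIV :: nat set) \<times> (UNIV :: 'a set)| \<le>o |(UNIV :: 'a set) \<times> (UNIV :: 'a set)|"
    by (rule card_of_Times_mono1)
  also have "|(UNIV :: 'a set) \<times> (UNIV :: 'a set)| =o ?A" using inf by (rule card_of_Times_same_infinite)
  finally obtain g :: "nat \<times> 'a \<Rightarrow> 'a" where g: "inj g"
    using card_of_ordLeq[of "(UNIV :: nat set) \<times> (UNIV :: 'a set)" "UNIV :: 'a set"] by auto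
  \<comment> \<open>A list is coded by its set of pairs of position and entry, moved into
    \<open>'a\<close> along \<open>g\<close>. This is crude, but subsets of \<open>'a\<close> are
    few enough.\<close>
  have "inj (\<lambda>xs :: 'a list. g ` ((\<lambda>i. (i, xs ! i)) ` {..<length xs}))"
  proof (rule injI)
    fix xs ys :: "'a list"
    assume "g ` ((\<lambda>i. (i, xs ! i)) ` {..<length xs}) = g ` ((\<lambda>i. (i, ys ! i)) ` {..<length ys})"
    then have eq: "(\<lambda>i. (i, xs ! i)) ` {..<length xs} = (\<lambda>i. (i, ys ! i)) ` {..<length ys}"
      by (simp only: inj_image_eq_iff[OF g])
    have "fst ` ((\<lambda>i. (i, xs ! i)) ` {..<length xs}) = fst ` ((\<lambda>i. (i, ys ! i)) ` {..<length ys})" by (simp only: eq)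
    then have "{..<length xs} = {..<length ys}" by (simp add: image_image)
    then have len: "length xs = length ys" by simp
    show "xs = ys"
    proof (rule nth_equalityI[OF len])
      fix i assume "i < length xs"
      then have "(i, xs ! i) \<in> (\<lambda>i. (i, ys ! i)) ` {..<length ys}" unfolding eq[symmetric] by simp
      then show "xs ! i = ys ! i" by auto
    qed
  qed
  then have LP: "|UNIV :: 'a list set| \<le>o ?P" by (intro card_of_ordLeqI) auto
  have "infinite (UNIV :: 'a list set)" by (rule infinite_UNIV_listI)
  then have "carrier (free_Abelian_group (UNIV :: 'a list set)) \<approx> (UNIV :: 'a list set)"
    by (rule eqpoll_free_Abelian_group_infinite)
  moreover have "carrier (free_Abelian_group (UNIV :: 'a list set)) = UNIV" by auto
  ultimately obtain b :: "('a list \<Rightarrow>\<^sub>0 int) \<Rightarrow> 'a list" where "bij_betw b UNIV UNIV"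
    by (auto simp: eqpoll_def)
  then have "|UNIV :: ('a list \<Rightarrow>\<^sub>0 int) set| \<le>o |UNIV :: 'a list set|"
    by (intro card_of_ordLeqI[of b]) (auto simp: bij_betw_def)
  then have FP: "|UNIV :: ('a list \<Rightarrow>\<^sub>0 int) set| \<le>o ?P" using LP by (rule ordLeq_transitive)
  have "|(UNIV :: 'a set) \<times> (UNIV :: ('a list \<Rightarrow>\<^sub>0 int) set)| \<le>o |(UNIV :: 'a set set) \<times> (UNIV :: 'a set set)|"
    by (rule ordLeq_transitive[OF card_of_Times_mono1[OF AP] card_of_Times_mono2[OF FP]])
  also have "|(UNIV :: 'a set set) \<times> (UNIV :: 'a set set)| =o ?P" using infP by (rule card_of_Times_same_infinite)
  finally obtain h :: "'a \<times> ('a list \<Rightarrow>\<^sub>0 int) \<Rightarrow> 'a set" where h: "inj h"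
    using card_of_ordLeq[of "(UNIV :: 'a set) \<times> (UNIV :: ('a list \<Rightarrow>\<^sub>0 int) set)" "UNIV :: 'a set set"] by auto
  obtain k :: "'a set set \<Rightarrow> 'g" where k: "inj k"
    using iffD2[OF card_of_ordLeq big] by blast
  have "inj (\<lambda>f. k (h ` range (\<lambda>x. (x, f x))))"
  proof (rule injI)
    fix f f' :: "'a \<Rightarrow> 'a list \<Rightarrow>\<^sub>0 int"
    assume "k (h ` range (\<lambda>x. (x, f x))) = k (h ` range (\<lambda>x. (x, f' x)))"
    then have "h ` range (\<lambda>x. (x, f x)) = h ` range (\<lambda>x. (x, f' x))" using k by (simp add: inj_eq)
    then have eq: "range (\<lambda>x. (x, f x)) = range (\<lambda>x. (x, f' x))" by (simp only: inj_image_eq_iff[OF h])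
    show "f = f'"
    proof
      fix x
      have "(x, f x) \<in> range (\<lambda>x. (x, f' x))" unfolding eq[symmetric] by simp
      then show "f x = f' x" by auto
    qed
  qed
  then show ?thesis by blast
qed

end

section \<open>Injective sheaves\<close>

lemma free_Abelian_group_hom_eq:
  assumes G: "group G" and h: "h \<in> hom (free_Abelian_group S) G" and k: "k \<in> hom (free_Abelian_group S) G"
    and eq: "\<And>a. a \<in> S \<Longrightarrow> h (frag_of a) = k (frag_of a)" and x: "Poly_Mapping.keys x \<subseteq> S"
  shows "h x = k x"
proof -
  interpret H: group_hom "free_Abelian_group S" G h
    using G h by (simp add: group_hom_def group_hom_axioms_def)
  interpret K: group_hom "free_Abelian_group S" G k
    using G k by (simp add: group_hom_def group_hom_axioms_def)
  show ?thesis
  proof (rule free_Abelian_group_induct[OF x, of "\<lambda>x. h x = k x"])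
    show "h 0 = k 0" using H.hom_one K.hom_one by simp
    show "h (x - y) = k (x - y)"
      if "Poly_Mapping.keys x \<subseteq> S" "Poly_Mapping.keys y \<subseteq> S" "h x = k x" "h y = k y" for x y
    proof -
      have "h (x - y) = h x \<otimes>\<^bsub>G\<^esub> inv\<^bsub>G\<^esub> h y"
        using H.hom_mult[of x "- y"] H.hom_inv[of y] that(1,2) by simp
      moreover have "k (x - y) = k x \<otimes>\<^bsub>G\<^esub> inv\<^bsub>G\<^esub> k y"
        using K.hom_mult[of x "- y"] K.hom_inv[of y] that(1,2) by simp
      ultimately show ?thesis using that(3,4) by simp
    qed
  qed (rule eq)
qed

lemma (in comm_group) free_Abelian_group_hom_exists:
  assumes "f ` S \<subseteq> carrier G"
  shows "\<exists>h. h \<in> hom (free_Abelian_group S) G \<and> (\<forall>x\<in>S. h (frag_of x) = f x)"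
proof (rule free_Abelian_group_universal[OF assms])
  fix h assume "h \<in> hom (free_Abelian_group S) G" "\<And>x. x \<in> S \<Longrightarrow> h (frag_of x) = f x"
  then show ?thesis by (intro exI[of _ h]) simp
qed

lemma frag_extend_hom:
  assumes "\<And>a. a \<in> S \<Longrightarrow> Poly_Mapping.keys (f a) \<subseteq> S'"
  shows "frag_extend f \<in> hom (free_Abelian_group S) (free_Abelian_group S')"
proof (rule homI)
  fix x assume "x \<in> carrier (free_Abelian_group S)"
  then show "frag_extend f x \<in> carrier (free_Abelian_group S')"
    using keys_frag_extend[of f x] assms by fastforce
qed (simp add: frag_extend_add)

text \<open>The simplicial boundary, written as the Cech differential of the tautological cochain,
  so that \<open>cech_hom\<close> turns a homomorphism applied to boundaries into a Cech
  coboundary.\<close>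

definition boundary :: "'a list \<Rightarrow> 'a list \<Rightarrow>\<^sub>0 int"
  where "boundary = cech (free_Abelian_group UNIV) frag_of"

text \<open>Taken point by point, so that different simplices may cancel over points at which their
  vertices coincide.\<close>

definition chain_boundary :: "'a topology \<Rightarrow> (('a \<Rightarrow> 'a) list \<Rightarrow>\<^sub>0 int) \<Rightarrow> 'a \<Rightarrow> 'a list \<Rightarrow>\<^sub>0 int"
  where "chain_boundary T \<xi> = (\<lambda>t\<in>topspace T. frag_extend (\<lambda>us. boundary (evaluate us t)) \<xi>)"

context cutoff
begin

abbreviation chain_precomp :: "'a topology \<Rightarrow> ('a \<Rightarrow> 'a) \<Rightarrow> (('a \<Rightarrow> 'a) list \<Rightarrow>\<^sub>0 int) \<Rightarrow> (('a \<Rightarrow> 'a) list \<Rightarrow>\<^sub>0 int)"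
  where "chain_precomp T h \<equiv> frag_extend (frag_of \<circ> precomp T h)"

lemma chain_precomp_hom:
  "h \<in> cmap T' T \<Longrightarrow> chain_precomp T' h \<in> hom (free_Abelian_group (simplices Y p T m)) (free_Abelian_group (simplices Y p T' m))"
  by (rule frag_extend_hom) (simp add: simplices_precomp)

lemma chain_precomp_keys:
  "h \<in> cmap T' T \<Longrightarrow> Poly_Mapping.keys \<xi> \<subseteq> simplices Y p T m \<Longrightarrow> Poly_Mapping.keys (chain_precomp T' h \<xi>) \<subseteq> simplices Y p T' m"
  using hom_in_carrier[OF chain_precomp_hom, of h T' T \<xi> Y p m] by simp

lemma chain_boundary_precomp:
  assumes "h \<in> cmap T' T"
  shows "chain_boundary T' (chain_precomp T' h \<xi>) = compose (topspace T') (chain_boundary T \<xi>) h"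
proof
  fix t
  show "chain_boundary T' (chain_precomp T' h \<xi>) t = compose (topspace T') (chain_boundary T \<xi>) h t"
  proof (cases "t \<in> topspace T'")
    case True
    have "(\<lambda>us. boundary (evaluate us t)) \<circ> precomp T' h = (\<lambda>us. boundary (evaluate us (h t)))"
      using True by (simp add: fun_eq_iff compose_def o_def)
    then show ?thesis
      using True cmap_in[OF assms True] by (simp add: chain_boundary_def compose_def frag_extend_compose)
  qed (simp add: chain_boundary_def compose_def)
qed

lemma chain_boundary_add:
  "chain_boundary T (\<xi> + \<xi>') = (\<lambda>t\<in>topspace T. chain_boundary T \<xi> t + chain_boundary T \<xi>' t)"
  by (auto simp: chain_boundary_def frag_extend_add fun_eq_iff)

lemma infinite_UNIV_cutoff: "infinite (UNIV :: 'a set)"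
proof
  assume fin: "finite (UNIV :: 'a set)"
  have "ordLeq3 \<kappa> (cardSuc (card_of (UNIV :: 'a set)))" using cutoff by (simp add: cutoff_cardinal_def)
  from card_of_mono2[OF this] have "finite (Field (cardSuc (card_of (UNIV :: 'a set)))) \<Longrightarrow> finite (Field \<kappa>)"
    using card_of_ordLeq_finite by blast
  moreover have "finite (Field (cardSuc (card_of (UNIV :: 'a set))))"
    using fin cardSuc_finite[OF card_of_Card_order] by (simp add: Field_card_of)
  ultimately show False using infinite_cutoff by blast
qed

lemma chain_boundary_diff:
  "chain_boundary T (\<xi> - \<xi>') = (\<lambda>t\<in>topspace T. chain_boundary T \<xi> t - chain_boundary T \<xi>' t)"
  by (auto simp: chain_boundary_def frag_extend_diff fun_eq_iff)

section \<open>Cocycles as functions of the boundary\<close>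

context
  fixes J :: "('a, 'g) presheaf" and Y S :: "'a topology" and p :: "'a \<Rightarrow> 'a" and n :: nat
    and c :: "'a topology \<Rightarrow> ('a \<Rightarrow> 'a) list \<Rightarrow> 'g"
  assumes J: "condensed_ab \<kappa> J" and Y: "Y \<in> \<C>" and S: "S \<in> \<C>" and p: "p \<in> cmap Y S"
    and c: "cochain J Y p (Suc (Suc n)) c"
    and cocycle: "\<And>T us. T \<in> \<C> \<Longrightarrow> us \<in> simplices Y p T (Suc (Suc (Suc n))) \<Longrightarrow>
      cech (sections J T) (c T) us = \<one>\<^bsub>sections J T\<^esub>"
begin

abbreviation "simplex_chains T \<equiv> free_Abelian_group (simplices Y p T (Suc (Suc n)))"

text \<open>A choice of linear extension of \<open>c T\<close>: a homomorphism on
  \<open>simplex_chains T\<close> is determined only on chains supported on simplices.\<close>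

definition lin :: "'a topology \<Rightarrow> (('a \<Rightarrow> 'a) list \<Rightarrow>\<^sub>0 int) \<Rightarrow> 'g"
  where "lin T = (SOME h. h \<in> hom (simplex_chains T) (sections J T) \<and> (\<forall>us\<in>simplices Y p T (Suc (Suc n)). h (frag_of us) = c T us))"

lemmas JP = condensed_ab_presheaf[OF J]

lemma lin:
  assumes T: "T \<in> \<C>"
  shows "lin T \<in> hom (simplex_chains T) (sections J T)"
    and "us \<in> simplices Y p T (Suc (Suc n)) \<Longrightarrow> lin T (frag_of us) = c T us"
proof -
  have "c T ` simplices Y p T (Suc (Suc n)) \<subseteq> carrier (sections J T)" using cochainD(1)[OF c T] by blast
  then have "\<exists>h. h \<in> hom (simplex_chains T) (sections J T) \<and> (\<forall>us\<in>simplices Y p T (Suc (Suc n)). h (frag_of us) = c T us)"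
    by (rule comm_group.free_Abelian_group_hom_exists[OF sections_comm_group[OF JP T]])
  from someI_ex[OF this] show "lin T \<in> hom (simplex_chains T) (sections J T)"
    and "us \<in> simplices Y p T (Suc (Suc n)) \<Longrightarrow> lin T (frag_of us) = c T us"
    by (simp_all add: lin_def)
qed

lemma lin_closed: "T \<in> \<C> \<Longrightarrow> Poly_Mapping.keys \<xi> \<subseteq> simplices Y p T (Suc (Suc n)) \<Longrightarrow> lin T \<xi> \<in> carrier (sections J T)"
  using hom_in_carrier[OF lin(1), of T \<xi>] by simp

lemma lin_precomp:
  assumes T: "T \<in> \<C>" "T' \<in> \<C>" and h: "h \<in> cmap T' T" and \<xi>: "Poly_Mapping.keys \<xi> \<subseteq> simplices Y p T (Suc (Suc n))"
  shows "lin T' (chain_precomp T' h \<xi>) = pull J T' T h (lin T \<xi>)"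
proof -
  have G: "group (sections J T')" using sections_comm_group[OF JP T(2)] by (simp add: comm_group_def)
  have h1: "lin T' \<circ> chain_precomp T' h \<in> hom (simplex_chains T) (sections J T')"
    by (rule hom_compose[OF chain_precomp_hom[OF h] lin(1)[OF T(2)]])
  have h2: "pull J T' T h \<circ> lin T \<in> hom (simplex_chains T) (sections J T')"
    by (rule hom_compose[OF lin(1)[OF T(1)] pull_hom[OF JP T(2,1) h]])
  have "(lin T' \<circ> chain_precomp T' h) \<xi> = (pull J T' T h \<circ> lin T) \<xi>"
  proof (rule free_Abelian_group_hom_eq[OF G h1 h2 _ \<xi>])
    fix us assume us: "us \<in> simplices Y p T (Suc (Suc n))"
    show "(lin T' \<circ> chain_precomp T' h) (frag_of us) = (pull J T' T h \<circ> lin T) (frag_of us)"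
      using lin(2)[OF T(2) simplices_precomp[OF us h]] lin(2)[OF T(1) us] cochainD(2)[OF c T(1) us T(2) h] by simp
  qed
  then show ?thesis by simp
qed

text \<open>
  Over the closed stratum of \<open>T\<close> on which all coincidences of vertices present at \<open>t0\<close> persist,
  everything is determined by the points over \<open>t0\<close>, where coning off each fibre of \<open>p\<close> applies.
\<close>

lemma lin_stratum:
  assumes T: "T \<in> \<C>" and \<xi>: "Poly_Mapping.keys \<xi> \<subseteq> simplices Y p T (Suc (Suc n))" and t0: "t0 \<in> topspace T"
    and zero: "frag_extend (\<lambda>us. boundary (evaluate us t0)) \<xi> = 0"
    and V: "V = \<Union>(set ` Poly_Mapping.keys \<xi>)"
    and Q: "Q \<in> \<C>" and e: "e \<in> cmap Q T"
    and same: "\<And>u v t. u \<in> V \<Longrightarrow> v \<in> V \<Longrightarrow> u t0 = v t0 \<Longrightarrow> t \<in> topspace Q \<Longrightarrow> u (e t) = v (e t)"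
    and same_base: "\<And>u v t. u \<in> V \<Longrightarrow> v \<in> V \<Longrightarrow> p (u t0) = p (v t0) \<Longrightarrow> t \<in> topspace Q \<Longrightarrow> p (u (e t)) = p (v (e t))"
  shows "pull J Q T e (lin T \<xi>) = \<one>\<^bsub>sections J Q\<^esub>"
proof -
  interpret G: comm_group "sections J Q" by (rule sections_comm_group[OF JP Q])
  let ?G = "sections J Q"
  \<comment> \<open>A vertex of the form \<open>u t0\<close> is continued along \<open>Q\<close> by
    following the map \<open>u\<close>; by \<open>same\<close> it does not matter which
    \<open>u\<close> with this value is followed.\<close>
  define \<nu> where "\<nu> y = compose (topspace Q) (SOME u. u \<in> V \<and> u t0 = y) e" for y
  have V_cmap: "u \<in> cmap T Y" if u: "u \<in> V" for u
  proof -
    obtain us where "us \<in> Poly_Mapping.keys \<xi>" "u \<in> set us" using u V by blast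
    then show ?thesis using \<xi> simplicesD(2)[of us Y p T "Suc (Suc n)" u] by blast
  qed
  have \<nu>: "\<nu> (u t0) = compose (topspace Q) u e" if u: "u \<in> V" for u
  proof -
    have "\<exists>w. w \<in> V \<and> w t0 = u t0" using u by blast
    from someI_ex[OF this] have w: "(SOME w. w \<in> V \<and> w t0 = u t0) \<in> V" "(SOME w. w \<in> V \<and> w t0 = u t0) t0 = u t0" by auto
    show ?thesis unfolding \<nu>_def compose_def using same[OF w(1) u w(2)] by (auto simp: fun_eq_iff)
  qed
  define Vt where "Vt = (\<lambda>u. u t0) ` V"
  \<comment> \<open>Lists of vertices over \<open>t0\<close> within one fibre of \<open>p\<close>.
    By \<open>same_base\<close> their continuations stay within one fibre along \<open>Q\<close>, so
    \<open>map \<nu>\<close> turns them into simplices.\<close>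
  define conn where "conn zs \<longleftrightarrow> set zs \<subseteq> Vt \<and> (\<forall>y\<in>set zs. \<forall>z\<in>set zs. p y = p z)" for zs
  have conn_mono: "conn vs" if "conn zs" "set vs \<subseteq> set zs" for vs zs
    using that unfolding conn_def by blast
  have map_simplex: "map \<nu> zs \<in> simplices Y p Q (length zs)" if zs: "conn zs" for zs
  proof (rule simplicesI)
    show "v \<in> cmap Q Y" if v: "v \<in> set (map \<nu> zs)" for v
    proof -
      obtain y where "y \<in> set zs" "v = \<nu> y" using v by auto
      then obtain u where "u \<in> V" "v = \<nu> (u t0)" using zs by (auto simp: conn_def Vt_def)
      then show ?thesis using \<nu> cmap_compose[OF e V_cmap] by simp
    qed
    fix v v' assume "v \<in> set (map \<nu> zs)" "v' \<in> set (map \<nu> zs)"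
    then obtain y y' where y: "y \<in> set zs" "v = \<nu> y" "y' \<in> set zs" "v' = \<nu> y'" by auto
    then have "y \<in> Vt" "y' \<in> Vt" and py: "p y = p y'" using zs unfolding conn_def by blast+
    then obtain u u' where u: "u \<in> V" "y = u t0" "u' \<in> V" "y' = u' t0" unfolding Vt_def by blast
    show "compose (topspace Q) p v = compose (topspace Q) p v'"
      using same_base[OF u(1,3)] py unfolding y(2,4) u(2,4) \<nu>[OF u(1)] \<nu>[OF u(3)]
      by (auto simp: compose_def fun_eq_iff)
  qed simp
  \<comment> \<open>One cone point for each fibre, taken among the vertices present at
    \<open>t0\<close> so that \<open>\<nu>\<close> continues it as well.\<close>
  define apex where "apex s = (SOME y. y \<in> Vt \<and> p y = s)" for s
  have apex: "apex (p y) \<in> Vt" "p (apex (p y)) = p y" if y: "y \<in> Vt" for y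
  proof -
    have "\<exists>z. z \<in> Vt \<and> p z = p y" using y by blast
    from someI_ex[OF this] show "apex (p y) \<in> Vt" "p (apex (p y)) = p y" by (simp_all add: apex_def)
  qed
  have conn_cone: "conn (apex s # zs)" if zs: "conn zs" and y: "y \<in> set zs" "p y = s" for zs y s
  proof -
    have yV: "y \<in> Vt" using zs y unfolding conn_def by blast
    have "p z = s" if z: "z \<in> set (apex s # zs)" for z
    proof -
      consider "z = apex s" | "z \<in> set zs" using z by auto
      then show ?thesis
      proof cases
        case 1
        then show ?thesis using apex(2)[OF yV] y(2) by simp
      next
        case 2
        then have "p z = p y" using zs y(1) unfolding conn_def by blast
        then show ?thesis using y(2) by simp
      qed
    qed
    then show ?thesis using apex(1)[OF yV] zs y(2) unfolding conn_def by (metis insert_subset list.simps(15))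
  qed
  \<comment> \<open>The cone of \<open>c\<close> as a function of lists of points, with the neutral
    value as default, so that it induces a homomorphism \<open>\<Lambda>\<close> on the whole free
    group.\<close>
  define e2 where "e2 zs = (if conn zs \<and> length zs = Suc n then c Q (map \<nu> (apex (p (hd zs)) # zs)) else \<one>\<^bsub>?G\<^esub>)" for zs
  have e2: "e2 zs \<in> carrier ?G" for zs
  proof (cases "conn zs \<and> length zs = Suc n")
    case True
    then have "hd zs \<in> set zs" by (cases zs) auto
    then have "map \<nu> (apex (p (hd zs)) # zs) \<in> simplices Y p Q (Suc (Suc n))"
      using map_simplex[OF conn_cone[OF conjunct1[OF True] _ refl]] True by fastforce
    then show ?thesis using cochainD(1)[OF c Q] True by (simp add: e2_def)
  next
    case False
    then show ?thesis by (auto simp: e2_def)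
  qed
  have "e2 ` UNIV \<subseteq> carrier ?G" using e2 by blast
  then obtain \<Lambda> where \<Lambda>: "\<Lambda> \<in> hom (free_Abelian_group UNIV) ?G" "\<forall>zs\<in>UNIV. \<Lambda> (frag_of zs) = e2 zs"
    using G.free_Abelian_group_hom_exists by blast
  interpret L: group_hom "free_Abelian_group UNIV" ?G \<Lambda>
    using \<Lambda>(1) G.is_group by (simp add: group_hom_def group_hom_axioms_def)
  have gen: "\<Lambda> (boundary (evaluate us t0)) = c Q (precomp Q e us)" if us: "us \<in> Poly_Mapping.keys \<xi>" for us
  proof -
    have us': "us \<in> simplices Y p T (Suc (Suc n))" using us \<xi> by blast
    have usV: "set us \<subseteq> V" using us V by blast
    define ys where "ys = evaluate us t0"
    have fl: "ys \<in> fibre_lists Y p (Suc (Suc n))" unfolding ys_def by (rule evaluate_simplices[OF us' t0])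
    have len: "length ys = Suc (Suc n)" by (rule fibre_listsD(1)[OF fl])
    have cys: "conn ys"
      unfolding conn_def
    proof (intro conjI ballI)
      show "set ys \<subseteq> Vt" using usV by (auto simp: ys_def Vt_def)
      show "p y = p z" if "y \<in> set ys" "z \<in> set ys" for y z by (rule fibre_listsD(3)[OF fl that])
    qed
    define s where "s = p (hd ys)"
    have hdys: "hd ys \<in> set ys" using len by (cases ys) auto
    have ps: "p y = s" if "y \<in> set ys" for y using fibre_listsD(3)[OF fl that hdys] by (simp add: s_def)
    have "\<Lambda> (boundary ys) = cech ?G (\<lambda>vs. \<Lambda> (frag_of vs)) ys"
      unfolding boundary_def by (rule L.cech_hom[OF abelian_free_Abelian_group]) simp
    also have "\<dots> = cech ?G (\<lambda>zs. c Q (map \<nu> (apex s # zs))) ys"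
    proof (rule cech_cong)
      fix zs assume zs: "set zs \<subseteq> set ys" "Suc (length zs) = length ys"
      have "conn zs" by (rule conn_mono[OF cys zs(1)])
      moreover have "length zs = Suc n" using zs(2) len by simp
      moreover have "hd zs \<in> set ys" using zs \<open>length zs = Suc n\<close> by (cases zs) auto
      ultimately show "\<Lambda> (frag_of zs) = c Q (map \<nu> (apex s # zs))" using \<Lambda>(2) ps[of "hd zs"] by (simp add: e2_def)
    qed
    also have "\<dots> = c Q (map \<nu> ys)"
    proof -
      \<comment> \<open>The cocycle relation on the cone over \<open>ys\<close>, read through the
        recursion of \<open>cech\<close>, isolates the value of \<open>c\<close> at
        \<open>map \<nu> ys\<close>.\<close>
      have cone: "conn (apex s # ys)" by (rule conn_cone[OF cys hdys]) (simp add: s_def)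
      have "map \<nu> (apex s # ys) \<in> simplices Y p Q (Suc (Suc (Suc n)))"
        using map_simplex[OF cone] len by simp
      then have "cech ?G (c Q) (map \<nu> (apex s # ys)) = \<one>\<^bsub>?G\<^esub>" by (rule cocycle[OF Q])
      then have one: "c Q (map \<nu> ys) \<otimes>\<^bsub>?G\<^esub> inv\<^bsub>?G\<^esub> cech ?G (\<lambda>zs. c Q (map \<nu> (apex s # zs))) ys = \<one>\<^bsub>?G\<^esub>"
        unfolding cech_map cech.simps .
      have "c Q (map \<nu> ys) \<in> carrier ?G"
        using cochainD(1)[OF c Q] map_simplex[OF cys] len by simp
      moreover have "cech ?G (\<lambda>zs. c Q (map \<nu> (apex s # zs))) ys \<in> carrier ?G"
      proof (rule G.cech_closed)
        fix zs assume zs: "set zs \<subseteq> set ys" "Suc (length zs) = length ys"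
        have "conn (apex s # zs)" by (rule conn_mono[OF cone]) (use zs(1) in auto)
        then show "c Q (map \<nu> (apex s # zs)) \<in> carrier ?G"
          using cochainD(1)[OF c Q] map_simplex[of "apex s # zs"] zs(2) len by simp
      qed
      ultimately show ?thesis using one G.inv_solve_right[OF G.one_closed] by (metis G.l_one)
    qed
    also have "map \<nu> ys = precomp Q e us"
      using usV \<nu> by (auto simp: ys_def)
    finally show ?thesis by (simp add: ys_def)
  qed
  have sub: "Poly_Mapping.keys x \<subseteq> simplices Y p T (Suc (Suc n))" if "Poly_Mapping.keys x \<subseteq> Poly_Mapping.keys \<xi>" for x
    using that \<xi> by blast
  \<comment> \<open>Both sides are homomorphisms in the chain, so \<open>gen\<close> on single
    simplices suffices. The right-hand side sees only the boundary at \<open>t0\<close>, which is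
    zero.\<close>
  have "lin Q (chain_precomp Q e \<xi>) = \<Lambda> (frag_extend (\<lambda>us. boundary (evaluate us t0)) \<xi>)"
  proof (rule free_Abelian_group_hom_eq[where S = "Poly_Mapping.keys \<xi>" and h = "\<lambda>x. lin Q (chain_precomp Q e x)"
        and k = "\<lambda>x. \<Lambda> (frag_extend (\<lambda>us. boundary (evaluate us t0)) x)", OF G.is_group])
    have "chain_precomp Q e \<in> hom (free_Abelian_group (Poly_Mapping.keys \<xi>)) (simplex_chains Q)"
      by (rule frag_extend_hom) (use \<xi> simplices_precomp[OF _ e] in auto)
    from hom_compose[OF this lin(1)[OF Q]]
    show "(\<lambda>x. lin Q (chain_precomp Q e x)) \<in> hom (free_Abelian_group (Poly_Mapping.keys \<xi>)) ?G" by (simp add: o_def)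
    have "frag_extend (\<lambda>us. boundary (evaluate us t0)) \<in> hom (free_Abelian_group (Poly_Mapping.keys \<xi>)) (free_Abelian_group UNIV)"
      by (rule frag_extend_hom) simp
    from hom_compose[OF this \<Lambda>(1)]
    show "(\<lambda>x. \<Lambda> (frag_extend (\<lambda>us. boundary (evaluate us t0)) x)) \<in> hom (free_Abelian_group (Poly_Mapping.keys \<xi>)) ?G"
      by (simp add: o_def)
    fix us assume us: "us \<in> Poly_Mapping.keys \<xi>"
    then have "precomp Q e us \<in> simplices Y p Q (Suc (Suc n))" using \<xi> by (intro simplices_precomp[OF _ e]) blast
    then show "lin Q (chain_precomp Q e (frag_of us)) = \<Lambda> (frag_extend (\<lambda>us. boundary (evaluate us t0)) (frag_of us))"
      using gen[OF us] lin(2)[OF Q] by simp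
  qed simp
  then show ?thesis
    using zero L.hom_one lin_precomp[OF T Q e \<xi>] by simp
qed

text \<open>Only finitely many maps occur in \<open>\<xi>\<close>, hence only finitely many patterns
  of coincidence among their values and among the images of these in \<open>S\<close>. The strata
  belonging to the patterns form a finite closed cover of \<open>T\<close>, and a section of a sheaf
  that is trivial on each member is trivial.\<close>

lemma lin_eq_one:
  assumes T: "T \<in> \<C>" and \<xi>: "Poly_Mapping.keys \<xi> \<subseteq> simplices Y p T (Suc (Suc n))"
    and zero: "chain_boundary T \<xi> = (\<lambda>t\<in>topspace T. 0)"
  shows "lin T \<xi> = \<one>\<^bsub>sections J T\<^esub>"
proof -
  define V where "V = \<Union>(set ` Poly_Mapping.keys \<xi>)"
  have fin: "finite V" by (simp add: V_def)
  have V_cmap: "u \<in> cmap T Y" if u: "u \<in> V" for u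
  proof -
    obtain us where "us \<in> Poly_Mapping.keys \<xi>" "u \<in> set us" using u V_def by blast
    then show ?thesis using \<xi> simplicesD(2)[of us Y p T "Suc (Suc n)" u] by blast
  qed
  define R R' where "R t = {(u, v) \<in> V \<times> V. u t = v t}" and "R' t = {(u, v) \<in> V \<times> V. p (u t) = p (v t)}" for t
  \<comment> \<open>A stratum requires at least the listed coincidences. That is a closed condition
    because \<open>Y\<close> and \<open>S\<close> are Hausdorff; requiring exactly these would not
    be.\<close>
  define stratum where "stratum A B = {t \<in> topspace T. A \<subseteq> R t \<and> B \<subseteq> R' t}" for A B
  define piece where "piece A B = (subtopology T (stratum A B), restrict id (stratum A B))" for A B
  have closed: "closedin T (stratum A B)" if AB: "A \<subseteq> V \<times> V" "B \<subseteq> V \<times> V" for A B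
  proof -
    have eq: "stratum A B = \<Inter>(insert (topspace T) ((\<lambda>(u, v). {t \<in> topspace T. u t = v t}) ` A \<union>
        (\<lambda>(u, v). {t \<in> topspace T. p (u t) = p (v t)}) ` B))"
      using AB by (auto simp: stratum_def R_def R'_def)
    have 1: "closedin T {t \<in> topspace T. u t = v t}" if "u \<in> V" "v \<in> V" for u v
      using that by (intro closedin_continuous_maps_eq[OF CHausD(2)[OF Y]] cmap_continuous V_cmap)
    have 2: "closedin T {t \<in> topspace T. p (u t) = p (v t)}" if "u \<in> V" "v \<in> V" for u v
    proof -
      have "continuous_map T S (\<lambda>t. p (w t))" if "w \<in> V" for w
        using continuous_map_compose[OF cmap_continuous[OF V_cmap[OF that]] cmap_continuous[OF p]] by (simp add: o_def)
      then show ?thesis using that by (intro closedin_continuous_maps_eq[OF CHausD(2)[OF S]])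
    qed
    show ?thesis
      unfolding eq
    proof (rule closedin_Inter)
      fix X assume "X \<in> insert (topspace T) ((\<lambda>(u, v). {t \<in> topspace T. u t = v t}) ` A \<union>
        (\<lambda>(u, v). {t \<in> topspace T. p (u t) = p (v t)}) ` B)"
      then consider "X = topspace T" | u v where "(u, v) \<in> A" "X = {t \<in> topspace T. u t = v t}"
        | u v where "(u, v) \<in> B" "X = {t \<in> topspace T. p (u t) = p (v t)}" by auto
      then show "closedin T X" by cases (use 1 2 AB in auto)
    qed simp
  qed
  have RV: "R t \<subseteq> V \<times> V" "R' t \<subseteq> V \<times> V" for t by (auto simp: R_def R'_def)
  have top: "topspace (fst (piece (R t) (R' t))) = stratum (R t) (R' t)" for t
    using closedin_subset[OF closed[OF RV]] by (auto simp: piece_def)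
  have Q: "fst (piece (R t) (R' t)) \<in> \<C>" for t
    using closed_subspace_CHaus[OF T closed[OF RV]] by (simp add: piece_def)
  have incl: "snd (piece (R t) (R' t)) \<in> cmap (fst (piece (R t) (R' t))) T" for t
  proof -
    have "continuous_map (fst (piece (R t) (R' t))) T id"
      unfolding piece_def fst_conv by (rule continuous_map_from_subtopology[OF continuous_map_id])
    from cmap_restrict[OF this] show ?thesis unfolding top by (simp add: piece_def)
  qed
  define \<U> where "\<U> = (\<lambda>t. piece (R t) (R' t)) ` topspace T"
  have cover: "finite_cover \<kappa> T \<U>"
  proof (rule finite_coverI)
    have "\<U> \<subseteq> (\<lambda>(A, B). piece A B) ` (Pow (V \<times> V) \<times> Pow (V \<times> V))"
      using RV by (force simp: \<U>_def)
    then show "finite \<U>" by (rule finite_subset) (use fin in simp)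
    show "Z \<in> \<C> \<and> f \<in> cmap Z T" if Zf: "(Z, f) \<in> \<U>" for Z f
    proof -
      obtain t where "(Z, f) = piece (R t) (R' t)" using Zf by (auto simp: \<U>_def)
      then show ?thesis using Q[of t] incl[of t] by (metis fst_conv snd_conv)
    qed
    show "\<exists>Z f z. (Z, f) \<in> \<U> \<and> z \<in> topspace Z \<and> f z = t" if t: "t \<in> topspace T" for t
    proof -
      have ts: "t \<in> stratum (R t) (R' t)" using t by (simp add: stratum_def)
      have "(fst (piece (R t) (R' t)), snd (piece (R t) (R' t))) \<in> \<U>" using t by (simp add: \<U>_def)
      moreover have "t \<in> topspace (fst (piece (R t) (R' t)))" unfolding top by (rule ts)
      moreover have "snd (piece (R t) (R' t)) t = t" using ts by (simp add: piece_def)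
      ultimately show ?thesis by blast
    qed
  qed
  interpret G: comm_group "sections J T" by (rule sections_comm_group[OF JP T])
  show ?thesis
  proof (rule sheaf_separated[OF J T cover lin_closed[OF T \<xi>] G.one_closed])
    fix Z f assume "(Z, f) \<in> \<U>"
    then obtain t0 where t0: "t0 \<in> topspace T" and Zf: "(Z, f) = piece (R t0) (R' t0)" by (auto simp: \<U>_def)
    have Z: "Z = fst (piece (R t0) (R' t0))" and f: "f = snd (piece (R t0) (R' t0))" using Zf by (metis fst_conv snd_conv)+
    have ZC: "Z \<in> \<C>" and fc: "f \<in> cmap Z T" using Q[of t0] incl[of t0] by (simp_all add: Z f)
    have ft: "t \<in> stratum (R t0) (R' t0)" "f t = t" if "t \<in> topspace Z" for t
      using that unfolding Z top by (simp_all add: f piece_def)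
    have "pull J Z T f (lin T \<xi>) = \<one>\<^bsub>sections J Z\<^esub>"
    proof (rule lin_stratum[OF T \<xi> t0 _ V_def ZC fc])
      show "frag_extend (\<lambda>us. boundary (evaluate us t0)) \<xi> = 0"
        using fun_cong[OF zero, of t0] t0 by (simp add: chain_boundary_def)
      show "u (f t) = v (f t)" if "u \<in> V" "v \<in> V" "u t0 = v t0" "t \<in> topspace Z" for u v t
      proof -
        have "(u, v) \<in> R t0" using that by (simp add: R_def)
        then have "(u, v) \<in> R t" using ft(1)[OF that(4)] unfolding stratum_def by blast
        then show ?thesis using ft(2)[OF that(4)] by (simp add: R_def)
      qed
      show "p (u (f t)) = p (v (f t))" if "u \<in> V" "v \<in> V" "p (u t0) = p (v t0)" "t \<in> topspace Z" for u v t
      proof -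
        have "(u, v) \<in> R' t0" using that by (simp add: R'_def)
        then have "(u, v) \<in> R' t" using ft(1)[OF that(4)] unfolding stratum_def by blast
        then show ?thesis using ft(2)[OF that(4)] by (simp add: R'_def)
      qed
    qed
    then show "pull J Z T f (lin T \<xi>) = pull J Z T f \<one>\<^bsub>sections J T\<^esub>"
      using group_hom.hom_one[OF pull_group_hom[OF JP ZC T fc]] by simp
  qed
qed

text \<open>The difference of the two chains pulled back to \<open>W\<close> has zero boundary, so
  \<open>lin_eq_one\<close> applies. This makes the value of \<open>c\<close> on a boundary
  independent of the chain.\<close>

lemma lin_compat:
  assumes Z: "Z \<in> \<C>" "Z' \<in> \<C>" and W: "W \<in> \<C>" "h \<in> cmap W Z" "h' \<in> cmap W Z'"
    and \<xi>: "Poly_Mapping.keys \<xi> \<subseteq> simplices Y p Z (Suc (Suc n))" "Poly_Mapping.keys \<xi>' \<subseteq> simplices Y p Z' (Suc (Suc n))"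
    and b: "compose (topspace Z) b f = chain_boundary Z \<xi>" "compose (topspace Z') b f' = chain_boundary Z' \<xi>'"
    and eq: "compose (topspace W) f h = compose (topspace W) f' h'"
  shows "pull J W Z h (lin Z \<xi>) = pull J W Z' h' (lin Z' \<xi>')"
proof -
  let ?x = "chain_precomp W h \<xi>" and ?y = "chain_precomp W h' \<xi>'"
  interpret G: comm_group "sections J W" by (rule sections_comm_group[OF JP W(1)])
  interpret L: group_hom "simplex_chains W" "sections J W" "lin W"
    using lin(1)[OF W(1)] G.is_group by (simp add: group_hom_def group_hom_axioms_def)
  have kx: "Poly_Mapping.keys ?x \<subseteq> simplices Y p W (Suc (Suc n))" by (rule chain_precomp_keys[OF W(2) \<xi>(1)])
  have ky: "Poly_Mapping.keys ?y \<subseteq> simplices Y p W (Suc (Suc n))" by (rule chain_precomp_keys[OF W(3) \<xi>(2)])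
  have "chain_boundary W ?x = chain_boundary W ?y"
    unfolding chain_boundary_precomp[OF W(2)] chain_boundary_precomp[OF W(3)] b[symmetric]
    using cmap_compose_assoc[OF W(2), of b f] cmap_compose_assoc[OF W(3), of b f'] eq by simp
  then have "chain_boundary W (?x - ?y) = (\<lambda>t\<in>topspace W. 0)"
    unfolding chain_boundary_diff by simp
  moreover have "Poly_Mapping.keys (?x - ?y) \<subseteq> simplices Y p W (Suc (Suc n))"
    using keys_diff[of ?x ?y] kx ky by blast
  ultimately have "lin W (?x - ?y) = \<one>\<^bsub>sections J W\<^esub>" using lin_eq_one[OF W(1)] by blast
  moreover have "lin W (?x - ?y) = lin W ?x \<otimes>\<^bsub>sections J W\<^esub> inv\<^bsub>sections J W\<^esub> lin W ?y"
    using L.hom_mult[of ?x "- ?y"] L.hom_inv[of ?y] kx ky by simp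
  ultimately have "lin W ?x = lin W ?y"
    using G.inv_solve_right[OF G.one_closed lin_closed[OF W(1) kx] lin_closed[OF W(1) ky]] lin_closed[OF W(1) ky] by simp
  then show ?thesis using lin_precomp[OF Z(1) W(1,2) \<xi>(1)] lin_precomp[OF Z(2) W(1,3) \<xi>(2)] by simp
qed

section \<open>The sheaf of boundaries and the homomorphism induced by the cocycle\<close>

definition bounds :: "('a \<Rightarrow> 'a list \<Rightarrow>\<^sub>0 int) \<Rightarrow> 'a topology \<Rightarrow> ('a \<Rightarrow> 'a) \<Rightarrow> (('a \<Rightarrow> 'a) list \<Rightarrow>\<^sub>0 int) \<Rightarrow> bool"
  where "bounds b Z f \<xi> \<longleftrightarrow> Poly_Mapping.keys \<xi> \<subseteq> simplices Y p Z (Suc (Suc n)) \<and> compose (topspace Z) b f = chain_boundary Z \<xi>"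

definition bounding :: "('a \<Rightarrow> 'a list \<Rightarrow>\<^sub>0 int) \<Rightarrow> 'a topology \<Rightarrow> ('a \<Rightarrow> 'a) \<Rightarrow> bool"
  where "bounding b Z f \<longleftrightarrow> (\<exists>\<xi>. bounds b Z f \<xi>)"

text \<open>The image sheaf of the boundary map inside all functions: a chain is asked for on the
  members of some cover, not over \<open>T\<close> itself.\<close>

definition boundaries :: "'a topology \<Rightarrow> ('a \<Rightarrow> 'a list \<Rightarrow>\<^sub>0 int) set"
  where "boundaries T = {b \<in> extensional (topspace T). locally T (bounding b)}"

lemma bounding_compose:
  assumes "bounding b Z f" "k \<in> cmap V Z"
  shows "bounding b V (compose (topspace V) f k)"
proof -
  obtain \<xi> where \<xi>: "Poly_Mapping.keys \<xi> \<subseteq> simplices Y p Z (Suc (Suc n))" "compose (topspace Z) b f = chain_boundary Z \<xi>"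
    using assms(1) unfolding bounding_def bounds_def by blast
  have "compose (topspace V) b (compose (topspace V) f k) = chain_boundary V (chain_precomp V k \<xi>)"
    unfolding cmap_compose_assoc[OF assms(2)] \<xi>(2) chain_boundary_precomp[OF assms(2)] ..
  then show ?thesis
    unfolding bounding_def bounds_def using chain_precomp_keys[OF assms(2) \<xi>(1)] by blast
qed

lemma stable_bounding: "stable T (bounding b)"
  unfolding stable_def using bounding_compose by blast

lemma bounding_assoc:
  "g \<in> cmap V Z \<Longrightarrow> bounding (compose (topspace Z) b f) V g \<longleftrightarrow> bounding b V (compose (topspace V) f g)"
  unfolding bounding_def bounds_def by (simp only: cmap_compose_assoc)

lemma condensed_boundaries: "condensed_ab \<kappa> (function_presheaf boundaries)"
proof (rule condensed_function_presheaf)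
  show "boundaries X \<subseteq> extensional (topspace X)" for X by (auto simp: boundaries_def)
  show "(\<lambda>x\<in>topspace X. 0) \<in> boundaries X" if X: "X \<in> \<C>" for X
  proof -
    have "bounds (\<lambda>x\<in>topspace X. 0) X (restrict id (topspace X)) 0"
      by (auto simp: bounds_def chain_boundary_def compose_def fun_eq_iff)
    then show ?thesis
      using locally_id[OF X, of "bounding (\<lambda>x\<in>topspace X. 0)"] by (auto simp: boundaries_def bounding_def)
  qed
  show "(\<lambda>x\<in>topspace X. f x - g x) \<in> boundaries X" if X: "X \<in> \<C>" and fg: "f \<in> boundaries X" "g \<in> boundaries X" for X f g
  proof -
    have "locally X (\<lambda>Z k. bounding f Z k \<and> bounding g Z k)"
      using fg by (intro locally_conj[OF X] stable_bounding) (simp_all add: boundaries_def)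
    then have "locally X (bounding (\<lambda>x\<in>topspace X. f x - g x))"
    proof (rule locally_mono)
      fix Z k assume Z: "Z \<in> \<C>" and k: "k \<in> cmap Z X" and both: "bounding f Z k \<and> bounding g Z k"
      then obtain \<xi> \<xi>' where \<xi>: "bounds f Z k \<xi>" "bounds g Z k \<xi>'" unfolding bounding_def by blast
      have "compose (topspace Z) (\<lambda>x\<in>topspace X. f x - g x) k = chain_boundary Z (\<xi> - \<xi>')"
      proof -
        have e: "chain_boundary Z \<xi> = compose (topspace Z) f k" "chain_boundary Z \<xi>' = compose (topspace Z) g k"
          using \<xi> by (simp_all add: bounds_def)
        show ?thesis unfolding chain_boundary_diff e using cmap_in[OF k] by (auto simp: compose_def fun_eq_iff)
      qed
      then have "bounds (\<lambda>x\<in>topspace X. f x - g x) Z k (\<xi> - \<xi>')"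
        using \<xi> keys_diff[of \<xi> \<xi>'] unfolding bounds_def by blast
      then show "bounding (\<lambda>x\<in>topspace X. f x - g x) Z k" unfolding bounding_def by blast
    qed
    then show ?thesis by (simp add: boundaries_def)
  qed
  show "compose (topspace X) f h \<in> boundaries X"
    if X: "X \<in> \<C>" "X' \<in> \<C>" and h: "h \<in> cmap X X'" and f: "f \<in> boundaries X'" for X X' h f
  proof -
    have "locally X (\<lambda>V g. bounding f V (compose (topspace V) h g))"
      using f by (intro locally_pull[OF X(2,1) h stable_bounding]) (simp add: boundaries_def)
    then have "locally X (bounding (compose (topspace X) f h))"
      by (rule locally_mono) (simp add: bounding_assoc)
    then show ?thesis by (simp add: boundaries_def)
  qed
  show "f \<in> boundaries X"
    if X: "X \<in> \<C>" and f: "f \<in> extensional (topspace X)" and loc: "locally X (\<lambda>Z k. compose (topspace Z) f k \<in> boundaries Z)" for X f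
  proof -
    have "locally X (bounding f)"
    proof (rule locally_trans[OF X], rule locally_mono[OF loc])
      fix Z k assume "Z \<in> \<C>" "k \<in> cmap Z X" "compose (topspace Z) f k \<in> boundaries Z"
      then have "locally Z (bounding (compose (topspace Z) f k))" by (simp add: boundaries_def)
      then show "locally Z (\<lambda>V g. bounding f V (compose (topspace V) k g))"
        by (rule locally_mono) (simp add: bounding_assoc)
    qed
    then show ?thesis using f by (simp add: boundaries_def)
  qed
qed

text \<open>Demanded on every object over \<open>T\<close> where a bounding chain exists, not just
  on one cover; uniqueness and naturality then do not depend on the cover used to construct the
  value.\<close>

definition has_value :: "'a topology \<Rightarrow> ('a \<Rightarrow> 'a list \<Rightarrow>\<^sub>0 int) \<Rightarrow> 'g \<Rightarrow> bool"
  where "has_value T b x \<longleftrightarrow> x \<in> carrier (sections J T) \<and>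
    (\<forall>Z\<in>\<C>. \<forall>f\<in>cmap Z T. \<forall>\<xi>. bounds b Z f \<xi> \<longrightarrow> pull J Z T f x = lin Z \<xi>)"

lemma has_valueD:
  "has_value T b x \<Longrightarrow> x \<in> carrier (sections J T)"
  "has_value T b x \<Longrightarrow> Z \<in> \<C> \<Longrightarrow> f \<in> cmap Z T \<Longrightarrow> bounds b Z f \<xi> \<Longrightarrow> pull J Z T f x = lin Z \<xi>"
  unfolding has_value_def by blast+

text \<open>The values \<open>lin Z \<xi>\<close> glue by \<open>lin_compat\<close>. The same lemma
  over the identity of \<open>Z\<close> shows that every other bounding chain on a member gives the
  same value.\<close>

lemma boundary_glue:
  assumes T: "T \<in> \<C>" and \<U>: "finite_cover \<kappa> T \<U>" and b: "\<And>Z f. (Z, f) \<in> \<U> \<Longrightarrow> bounding b Z f"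
  shows "\<exists>x\<in>carrier (sections J T). \<forall>Z f \<xi>. (Z, f) \<in> \<U> \<longrightarrow> bounds b Z f \<xi> \<longrightarrow> pull J Z T f x = lin Z \<xi>"
proof -
  define \<Xi> where "\<Xi> i = (SOME \<xi>. bounds b (fst i) (snd i) \<xi>)" for i
  have \<Xi>: "bounds b Z f (\<Xi> (Z, f))" if "(Z, f) \<in> \<U>" for Z f
    using someI_ex[OF b[OF that, unfolded bounding_def]] by (simp add: \<Xi>_def)
  have compat: "pull J W Z h (lin Z \<xi>) = pull J W Z' h' (lin Z' \<xi>')"
    if "Z \<in> \<C>" "Z' \<in> \<C>" "bounds b Z f \<xi>" "bounds b Z' f' \<xi>'" "W \<in> \<C>" "h \<in> cmap W Z" "h' \<in> cmap W Z'"
      "compose (topspace W) f h = compose (topspace W) f' h'" for Z Z' f f' \<xi> \<xi>' W h h'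
    using that(3,4) unfolding bounds_def by (intro lin_compat[OF that(1,2,5,6,7) _ _ _ _ that(8)]) auto
  have "\<exists>x. x \<in> carrier (sections J T) \<and> (\<forall>Z f. (Z, f) \<in> \<U> \<longrightarrow> pull J Z T f x = lin Z (\<Xi> (Z, f)))"
  proof (rule sheaf_glue[OF J T \<U>, of "\<lambda>i. lin (fst i) (\<Xi> i)"])
    show "lin (fst (Z, f)) (\<Xi> (Z, f)) \<in> carrier (sections J Z)" if i: "(Z, f) \<in> \<U>" for Z f
      using lin_closed[OF finite_coverD(2)[OF \<U> i]] \<Xi>[OF i] by (simp add: bounds_def)
    show "pull J W Z h (lin (fst (Z, f)) (\<Xi> (Z, f))) = pull J W Z' h' (lin (fst (Z', f')) (\<Xi> (Z', f')))"
      if i: "(Z, f) \<in> \<U>" "(Z', f') \<in> \<U>" and W: "W \<in> \<C>" "h \<in> cmap W Z" "h' \<in> cmap W Z'"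
        and eq: "compose (topspace W) f h = compose (topspace W) f' h'" for Z f Z' f' W h h'
      unfolding fst_conv
      by (rule compat[OF finite_coverD(2)[OF \<U> i(1)] finite_coverD(2)[OF \<U> i(2)] \<Xi>[OF i(1)] \<Xi>[OF i(2)] W eq])
    fix t assume "t \<in> carrier (sections J T)" "\<And>Z f. (Z, f) \<in> \<U> \<Longrightarrow> pull J Z T f t = lin (fst (Z, f)) (\<Xi> (Z, f))"
    then show ?thesis by (intro exI[of _ t]) simp
  qed
  then obtain x where x: "x \<in> carrier (sections J T)" "\<forall>Z f. (Z, f) \<in> \<U> \<longrightarrow> pull J Z T f x = lin Z (\<Xi> (Z, f))" by blast
  have "pull J Z T f x = lin Z \<xi>" if i: "(Z, f) \<in> \<U>" and \<xi>: "bounds b Z f \<xi>" for Z f \<xi>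
  proof -
    have Z: "Z \<in> \<C>" by (rule finite_coverD(2)[OF \<U> i])
    have mem: "lin Z (\<Xi> (Z, f)) \<in> carrier (sections J Z)" "lin Z \<xi> \<in> carrier (sections J Z)"
      using \<Xi>[OF i] \<xi> by (auto simp: bounds_def intro: lin_closed[OF Z])
    have "pull J Z Z (restrict id (topspace Z)) (lin Z (\<Xi> (Z, f))) = pull J Z Z (restrict id (topspace Z)) (lin Z \<xi>)"
      by (rule compat[OF Z Z \<Xi>[OF i] \<xi> Z cmap_id cmap_id refl])
    then show ?thesis using x(2) i pull_id[OF JP Z mem(1)] pull_id[OF JP Z mem(2)] by simp
  qed
  then show ?thesis using x(1) by blast
qed

lemma has_value_ex1:
  assumes T: "T \<in> \<C>" and b: "b \<in> boundaries T"
  shows "\<exists>!x. has_value T b x"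
proof -
  obtain \<U> where \<U>: "finite_cover \<kappa> T \<U>" and U: "\<forall>(Z, f) \<in> \<U>. bounding b Z f"
    using b unfolding boundaries_def by (auto elim: locallyE)
  have bU: "bounding b Z f" if "(Z, f) \<in> \<U>" for Z f using U that by auto
  have unique: "x = y"
    if x: "x \<in> carrier (sections J T)" "\<forall>Z f \<xi>. (Z, f) \<in> \<U> \<longrightarrow> bounds b Z f \<xi> \<longrightarrow> pull J Z T f x = lin Z \<xi>"
      and y: "y \<in> carrier (sections J T)" "\<forall>Z f \<xi>. (Z, f) \<in> \<U> \<longrightarrow> bounds b Z f \<xi> \<longrightarrow> pull J Z T f y = lin Z \<xi>" for x y
  proof (rule sheaf_separated[OF J T \<U> x(1) y(1)])
    fix Z f assume i: "(Z, f) \<in> \<U>"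
    then obtain \<xi> where "bounds b Z f \<xi>" using bU unfolding bounding_def by blast
    then show "pull J Z T f x = pull J Z T f y" using x(2) y(2) i by simp
  qed
  obtain x where x: "x \<in> carrier (sections J T)"
    "\<forall>Z f \<xi>. (Z, f) \<in> \<U> \<longrightarrow> bounds b Z f \<xi> \<longrightarrow> pull J Z T f x = lin Z \<xi>"
    using boundary_glue[OF T \<U> bU] by blast
  have "has_value T b x"
    unfolding has_value_def
  proof (intro conjI ballI allI impI x(1))
    fix Z f \<xi> assume Z: "Z \<in> \<C>" and f: "f \<in> cmap Z T" and \<xi>: "bounds b Z f \<xi>"
    \<comment> \<open>Gluing over the cover enlarged by \<open>(Z, f)\<close> gives a section that
      must coincide with \<open>x\<close>, since both are determined on \<open>\<U>\<close>; so
      \<open>x\<close> has the right value on \<open>Z\<close> too.\<close>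
    have "finite_cover \<kappa> T (insert (Z, f) \<U>)"
    proof (rule finite_coverI)
      show "finite (insert (Z, f) \<U>)" using finite_coverD(1)[OF \<U>] by simp
      show "Z' \<in> \<C> \<and> f' \<in> cmap Z' T" if "(Z', f') \<in> insert (Z, f) \<U>" for Z' f'
        using that Z f finite_coverD(2,3)[OF \<U>, of Z' f'] by auto
      show "\<exists>Z' f' z. (Z', f') \<in> insert (Z, f) \<U> \<and> z \<in> topspace Z' \<and> f' z = t" if "t \<in> topspace T" for t
        using finite_coverD(4)[OF \<U> that] by blast
    qed
    moreover have "bounding b Z' f'" if "(Z', f') \<in> insert (Z, f) \<U>" for Z' f'
      using that bU[of Z' f'] \<xi> by (auto simp: bounding_def)
    ultimately obtain y where y: "y \<in> carrier (sections J T)"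
      "\<forall>Z' f' \<xi>. (Z', f') \<in> insert (Z, f) \<U> \<longrightarrow> bounds b Z' f' \<xi> \<longrightarrow> pull J Z' T f' y = lin Z' \<xi>"
      using boundary_glue[OF T, of "insert (Z, f) \<U>" b] by blast
    have "x = y" by (rule unique[OF x y(1)]) (use y(2) in simp)
    then show "pull J Z T f x = lin Z \<xi>" using y(2) \<xi> by simp
  qed
  moreover have "y = x" if "has_value T b y" for y
  proof (rule unique[OF has_valueD(1)[OF that] _ x])
    show "\<forall>Z f \<xi>. (Z, f) \<in> \<U> \<longrightarrow> bounds b Z f \<xi> \<longrightarrow> pull J Z T f y = lin Z \<xi>"
      using has_valueD(2)[OF that] finite_coverD(2,3)[OF \<U>] by blast
  qed
  ultimately show ?thesis by blast
qed

definition boundary_value :: "'a topology \<Rightarrow> ('a \<Rightarrow> 'a list \<Rightarrow>\<^sub>0 int) \<Rightarrow> 'g"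
  where "boundary_value T b = (THE x. has_value T b x)"

lemma boundary_value: "T \<in> \<C> \<Longrightarrow> b \<in> boundaries T \<Longrightarrow> has_value T b (boundary_value T b)"
  unfolding boundary_value_def by (rule theI'[OF has_value_ex1])

lemma boundary_value_eq: "T \<in> \<C> \<Longrightarrow> b \<in> boundaries T \<Longrightarrow> has_value T b x \<Longrightarrow> boundary_value T b = x"
  using has_value_ex1[of T b] boundary_value[of T b] by blast

lemma boundary_value_hom: "condensed_hom \<kappa> (function_presheaf boundaries) J boundary_value"
  unfolding condensed_hom_def
proof (intro conjI ballI)
  note BP = condensed_ab_presheaf[OF condensed_boundaries]
  fix T assume T: "T \<in> \<C>"
  show "boundary_value T \<in> hom (sections (function_presheaf boundaries) T) (sections J T)"
  proof (rule homI)
    show "boundary_value T b \<in> carrier (sections J T)" if "b \<in> carrier (sections (function_presheaf boundaries) T)" for b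
      using has_valueD(1)[OF boundary_value[OF T]] that by simp
    fix b b' assume b: "b \<in> carrier (sections (function_presheaf boundaries) T)" "b' \<in> carrier (sections (function_presheaf boundaries) T)"
    let ?s = "b \<otimes>\<^bsub>sections (function_presheaf boundaries) T\<^esub> b'"
    have s: "?s \<in> boundaries T"
      using monoid.m_closed[OF comm_monoid.axioms(1)[OF comm_group.axioms(1)[OF sections_comm_group[OF BP T]]] b] by simp
    have bb: "b \<in> boundaries T" "b' \<in> boundaries T" using b by simp_all
    have mem: "boundary_value T b \<in> carrier (sections J T)" "boundary_value T b' \<in> carrier (sections J T)"
      using has_valueD(1)[OF boundary_value[OF T]] bb by blast+
    interpret G: comm_group "sections J T" by (rule sections_comm_group[OF JP T])
    \<comment> \<open>On a common cover both functions bound chains, and there the value is given by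
      \<open>lin\<close>, which is additive.\<close>
    have "locally T (\<lambda>Z k. bounding b Z k \<and> bounding b' Z k)"
      using bb by (intro locally_conj[OF T] stable_bounding) (simp_all add: boundaries_def)
    then obtain \<U> where \<U>: "finite_cover \<kappa> T \<U>" and U: "\<forall>(Z, k) \<in> \<U>. bounding b Z k \<and> bounding b' Z k"
      by (rule locallyE)
    show "boundary_value T ?s = boundary_value T b \<otimes>\<^bsub>sections J T\<^esub> boundary_value T b'"
    proof (rule sheaf_separated[OF J T \<U> has_valueD(1)[OF boundary_value[OF T s]] G.m_closed[OF mem]])
      fix Z k assume i: "(Z, k) \<in> \<U>"
      have Z: "Z \<in> \<C>" and k: "k \<in> cmap Z T" using finite_coverD(2,3)[OF \<U> i] by auto
      obtain \<xi> \<xi>' where \<xi>: "bounds b Z k \<xi>" "bounds b' Z k \<xi>'" using U i unfolding bounding_def by blast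
      have "compose (topspace Z) ?s k = chain_boundary Z (\<xi> + \<xi>')"
      proof -
        have e: "chain_boundary Z \<xi> = compose (topspace Z) b k" "chain_boundary Z \<xi>' = compose (topspace Z) b' k"
          using \<xi> by (simp_all add: bounds_def)
        show ?thesis unfolding chain_boundary_add e using cmap_in[OF k] by (auto simp: compose_def fun_eq_iff)
      qed
      then have "bounds ?s Z k (\<xi> + \<xi>')"
        using \<xi> keys_add[of \<xi> \<xi>'] unfolding bounds_def by blast
      then have "pull J Z T k (boundary_value T ?s) = lin Z (\<xi> + \<xi>')"
        by (rule has_valueD(2)[OF boundary_value[OF T s] Z k])
      also have "\<dots> = lin Z \<xi> \<otimes>\<^bsub>sections J Z\<^esub> lin Z \<xi>'"
        using hom_mult[OF lin(1)[OF Z], of \<xi> \<xi>'] \<xi> by (simp add: bounds_def)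
      also have "\<dots> = pull J Z T k (boundary_value T b) \<otimes>\<^bsub>sections J Z\<^esub> pull J Z T k (boundary_value T b')"
        using has_valueD(2)[OF boundary_value[OF T bb(1)] Z k \<xi>(1)] has_valueD(2)[OF boundary_value[OF T bb(2)] Z k \<xi>(2)] by simp
      also have "\<dots> = pull J Z T k (boundary_value T b \<otimes>\<^bsub>sections J T\<^esub> boundary_value T b')"
        using hom_mult[OF pull_hom[OF JP Z T k] mem] by simp
      finally show "pull J Z T k (boundary_value T ?s) = pull J Z T k (boundary_value T b \<otimes>\<^bsub>sections J T\<^esub> boundary_value T b')" .
    qed
  qed
next
  fix T T' h b assume T: "T' \<in> \<C>" "T \<in> \<C>" and h: "h \<in> cmap T' T" and "b \<in> carrier (sections (function_presheaf boundaries) T)"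
  then have b: "b \<in> boundaries T" by simp
  have hb: "compose (topspace T') b h \<in> boundaries T'"
    using pull_closed[OF condensed_ab_presheaf[OF condensed_boundaries] T h] b by simp
  have "has_value T' (compose (topspace T') b h) (pull J T' T h (boundary_value T b))"
    unfolding has_value_def
  proof (intro conjI ballI allI impI)
    have mem: "boundary_value T b \<in> carrier (sections J T)" by (rule has_valueD(1)[OF boundary_value[OF T(2) b]])
    then show "pull J T' T h (boundary_value T b) \<in> carrier (sections J T')" by (rule pull_closed[OF JP T h])
    fix Z f \<xi> assume Z: "Z \<in> \<C>" and f: "f \<in> cmap Z T'" and "bounds (compose (topspace T') b h) Z f \<xi>"
    then have "bounds b Z (compose (topspace Z) h f) \<xi>" unfolding bounds_def by (simp only: cmap_compose_assoc[OF f])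
    from has_valueD(2)[OF boundary_value[OF T(2) b] Z cmap_compose[OF f h] this]
    show "pull J Z T' f (pull J T' T h (boundary_value T b)) = lin Z \<xi>"
      using pull_compose[OF JP Z T f h mem] by simp
  qed
  then show "boundary_value T' (pull (function_presheaf boundaries) T' T h b) = pull J T' T h (boundary_value T b)"
    using boundary_value_eq[OF T(1) hb] by simp
qed

lemma boundary_value_simplex:
  assumes T: "T \<in> \<C>" and us: "us \<in> simplices Y p T (Suc (Suc n))"
  shows "chain_boundary T (frag_of us) \<in> boundaries T" "boundary_value T (chain_boundary T (frag_of us)) = c T us"
proof -
  let ?b = "chain_boundary T (frag_of us)"
  have bd: "bounds ?b T (restrict id (topspace T)) (frag_of us)"
    using us by (auto simp: bounds_def compose_def chain_boundary_def fun_eq_iff)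
  then show b: "?b \<in> boundaries T"
    using locally_id[OF T, of "bounding ?b"] by (auto simp: boundaries_def bounding_def chain_boundary_def)
  have "pull J T T (restrict id (topspace T)) (boundary_value T ?b) = lin T (frag_of us)"
    by (rule has_valueD(2)[OF boundary_value[OF T b] T cmap_id bd])
  then show "boundary_value T ?b = c T us"
    using pull_id[OF JP T has_valueD(1)[OF boundary_value[OF T b]]] lin(2)[OF T us] by simp
qed

text \<open>The homomorphism on boundaries extends to the sheaf \<open>B\<close> of all functions
  because \<open>J\<close> is injective. Applying the extension to the tautological function that
  sends a point to the list of vertices there gives \<open>b\<close>: the Cech differential of that
  function is the boundary of the simplex, whose value is \<open>c\<close>.\<close>

theorem injective_cech_exact:
  assumes inj: "condensed_injective \<kappa> J" and big: "ordLeq3 (card_of (UNIV :: 'a set set set)) (card_of (UNIV :: 'g set))"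
  shows "\<exists>b. cochain J Y p (Suc n) b \<and>
    (\<forall>T\<in>\<C>. \<forall>us\<in>simplices Y p T (Suc (Suc n)). cech (sections J T) (b T) us = c T us)"
proof -
  obtain e :: "('a \<Rightarrow> 'a list \<Rightarrow>\<^sub>0 int) \<Rightarrow> 'g" where e: "inj e"
    using frag_functions_embed[OF infinite_UNIV_cutoff big] by blast
  define B :: "('a, 'a \<Rightarrow> 'a list \<Rightarrow>\<^sub>0 int) presheaf" where "B = function_presheaf (\<lambda>X. extensional (topspace X))"
  have B: "condensed_ab \<kappa> B"
    unfolding B_def by (rule condensed_function_presheaf) (auto simp: compose_def)
  have mono: "condensed_mono \<kappa> (function_presheaf boundaries) B (\<lambda>X s. s)"
    unfolding condensed_mono_def condensed_hom_def B_def
    by (intro conjI ballI homI) (auto simp: boundaries_def)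
  obtain \<psi> where \<psi>: "condensed_hom \<kappa> B J \<psi>"
    and ext: "\<forall>X\<in>\<C>. \<forall>s\<in>boundaries X. \<psi> X s = boundary_value X s"
  proof (rule injective_extend[OF inj e condensed_boundaries B mono boundary_value_hom])
    fix \<psi> assume 1: "condensed_hom \<kappa> B J \<psi>"
      and 2: "\<And>X s. X \<in> \<C> \<Longrightarrow> s \<in> carrier (sections (function_presheaf boundaries) X) \<Longrightarrow> \<psi> X s = boundary_value X s"
    show thesis by (rule that[OF 1]) (use 2 in simp)
  qed
  \<comment> \<open>The tautological cochain with values in \<open>B\<close>. It is natural in
    \<open>T\<close>, hence so is its image \<open>b\<close>.\<close>
  define pt where "pt T us = (\<lambda>t\<in>topspace T. frag_of (evaluate us t))" for T and us :: "('a \<Rightarrow> 'a) list"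
  have pt: "pt T us \<in> carrier (sections B T)" for T us by (simp add: pt_def B_def)
  define b where "b T us = \<psi> T (pt T us)" for T us
  have "cochain J Y p (Suc n) b"
    unfolding cochain_def
  proof (intro conjI ballI)
    show "b T us \<in> carrier (sections J T)" if "T \<in> \<C>" for T us
      unfolding b_def by (rule condensed_hom_closed[OF \<psi> that pt])
    fix T T' h us assume T: "T \<in> \<C>" "T' \<in> \<C>" and h: "h \<in> cmap T' T"
    have "pt T' (precomp T' h us) = pull B T' T h (pt T us)"
      using cmap_in[OF h] by (auto simp: pt_def B_def compose_def fun_eq_iff o_def)
    then show "b T' (precomp T' h us) = pull J T' T h (b T us)"
      unfolding b_def using condensed_homD(2)[OF \<psi> T(2,1) h pt] by simp
  qed
  moreover have "cech (sections J T) (b T) us = c T us" if T: "T \<in> \<C>" and us: "us \<in> simplices Y p T (Suc (Suc n))" for T us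
  proof -
    have BT: "comm_group (sections B T)" by (rule sections_comm_group[OF condensed_ab_presheaf[OF B] T])
    have JT: "comm_group (sections J T)" by (rule sections_comm_group[OF JP T])
    have hom: "group_hom (sections B T) (sections J T) (\<psi> T)"
      using BT JT condensed_homD(1)[OF \<psi> T] by (simp add: group_hom_def group_hom_axioms_def comm_group_def)
    have "cech (sections J T) (b T) us = \<psi> T (cech (sections B T) (pt T) us)"
      unfolding b_def by (rule group_hom.cech_hom[OF hom BT pt, symmetric])
    also have "cech (sections B T) (pt T) us = chain_boundary T (frag_of us)"
    proof (rule extensionalityI[where A = "topspace T"])
      show "cech (sections B T) (pt T) us \<in> extensional (topspace T)"
        using comm_group.cech_closed[OF BT, of us "pt T"] pt by (simp add: B_def)
      show "chain_boundary T (frag_of us) \<in> extensional (topspace T)" by (simp add: chain_boundary_def)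
      fix t assume t: "t \<in> topspace T"
      \<comment> \<open>Evaluation at \<open>t\<close> is a homomorphism, which reduces the
        comparison with the boundary to the free abelian group.\<close>
      have ev: "group_hom (sections B T) (free_Abelian_group UNIV) (\<lambda>g. g t)"
        using BT t by (auto simp: group_hom_def group_hom_axioms_def comm_group_def B_def intro!: homI)
      have "cech (sections B T) (pt T) us t = cech (free_Abelian_group UNIV) (\<lambda>vs. pt T vs t) us"
        by (rule group_hom.cech_hom[OF ev BT pt])
      also have "\<dots> = chain_boundary T (frag_of us) t"
        using t by (simp add: pt_def chain_boundary_def boundary_def cech_map)
      finally show "cech (sections B T) (pt T) us t = chain_boundary T (frag_of us) t" .
    qed
    also have "\<psi> T (chain_boundary T (frag_of us)) = c T us"
      using ext T boundary_value_simplex[OF T us] by simp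
    finally show ?thesis .
  qed
  ultimately show ?thesis by blast
qed

end

end

section \<open>Cohomology of the real line\<close>

lemma real_condensed_eq: "real_condensed = function_presheaf (\<lambda>X. cmap X euclideanreal)"
  by (simp add: real_condensed_def function_presheaf_def function_group_def real_function_group_def fun_eq_iff)

lemma (in comm_group) quotient_by_self:
  "carrier (G Mod carrier G) = {\<one>\<^bsub>G Mod carrier G\<^esub>}"
proof -
  have "carrier G #> a = carrier G" if "a \<in> carrier G" for a
    using coset_join2[OF that subgroup_self that] .
  then show ?thesis by (auto simp: FactGroup_def RCOSETS_def)
qed

context comm_group
begin

lemma cech_pair:
  assumes "c [u] \<in> carrier G" "c [v] \<in> carrier G"
  shows "cech G c [u, v] = c [v] \<otimes> inv c [u]"
  using assms by (simp add: cech.simps)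

lemma cech_quotient:
  assumes c: "\<And>vs. set vs \<subseteq> set us \<Longrightarrow> Suc (length vs) = length us \<Longrightarrow> c vs \<in> carrier G"
    and e: "\<And>vs. set vs \<subseteq> set us \<Longrightarrow> Suc (length vs) = length us \<Longrightarrow> e vs \<in> carrier G"
  shows "cech G (\<lambda>vs. c vs \<otimes> inv e vs) us = cech G c us \<otimes> inv cech G e us"
proof -
  have "cech G (\<lambda>vs. c vs \<otimes> inv e vs) us = cech G c us \<otimes> cech G (\<lambda>vs. inv e vs) us"
    by (rule cech_mult) (use c e in simp_all)
  also have "cech G (\<lambda>vs. inv e vs) us = inv cech G e us" by (rule cech_inv) (use e in simp)
  finally show ?thesis .
qed

text \<open>Here \<open>a\<close>, \<open>a'\<close> are the values of one 0-cochain at the two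
  points of a pair and \<open>b\<close>, \<open>b'\<close> those of another: if their coboundaries
  agree, the quotient of the cochains takes the same value at both points and can descend.\<close>

lemma swap_quotients:
  assumes "a \<in> carrier G" "a' \<in> carrier G" "b \<in> carrier G" "b' \<in> carrier G"
    and eq: "b' \<otimes> inv b = a' \<otimes> inv a"
  shows "a \<otimes> inv b = a' \<otimes> inv b'"
proof -
  have "a \<otimes> inv b = (b' \<otimes> inv b') \<otimes> (a \<otimes> inv b)" using assms(1-4) by simp
  also have "\<dots> = (b' \<otimes> inv b) \<otimes> (a \<otimes> inv b')" using assms(1-4) by (simp add: m_ac del: r_inv l_inv Units_r_inv Units_l_inv)
  also have "\<dots> = (inv a \<otimes> a) \<otimes> (a' \<otimes> inv b')" unfolding eq using assms(1-4) by (simp add: m_ac del: r_inv l_inv Units_r_inv Units_l_inv)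
  finally show ?thesis using assms(1-4) by simp
qed

end

context cutoff
begin

lemma cochain_quotient:
  assumes F: "ab_presheaf \<kappa> F" and d: "cochain F Y p n d" and e: "cochain F Y p n e"
  shows "cochain F Y p n (\<lambda>T us. d T us \<otimes>\<^bsub>sections F T\<^esub> inv\<^bsub>sections F T\<^esub> e T us)"
  unfolding cochain_def
proof (intro conjI ballI)
  fix T us assume T: "T \<in> \<C>" and us: "us \<in> simplices Y p T n"
  have group: "group (sections F T)" using sections_comm_group[OF F T] by (rule comm_group.axioms(2))
  have el: "d T us \<in> carrier (sections F T)" "e T us \<in> carrier (sections F T)"
    using cochainD(1)[OF d T us] cochainD(1)[OF e T us] by auto
  have ie: "inv\<^bsub>sections F T\<^esub> e T us \<in> carrier (sections F T)" by (rule group.inv_closed[OF group el(2)])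
  show "d T us \<otimes>\<^bsub>sections F T\<^esub> inv\<^bsub>sections F T\<^esub> e T us \<in> carrier (sections F T)"
    by (rule monoid.m_closed[OF group.is_monoid[OF group] el(1) ie])
next
  fix T T' h us assume T: "T \<in> \<C>" "T' \<in> \<C>" and h: "h \<in> cmap T' T" and us: "us \<in> simplices Y p T n"
  have group: "group (sections F T)" using sections_comm_group[OF F T(1)] by (rule comm_group.axioms(2))
  have el: "d T us \<in> carrier (sections F T)" "e T us \<in> carrier (sections F T)"
    using cochainD(1)[OF d T(1) us] cochainD(1)[OF e T(1) us] by auto
  note H = pull_group_hom[OF F T(2,1) h]
  show "d T' (precomp T' h us) \<otimes>\<^bsub>sections F T'\<^esub> inv\<^bsub>sections F T'\<^esub> e T' (precomp T' h us) =
      pull F T' T h (d T us \<otimes>\<^bsub>sections F T\<^esub> inv\<^bsub>sections F T\<^esub> e T us)"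
    using group_hom.hom_mult[OF H el(1) group.inv_closed[OF group el(2)]] group_hom.hom_inv[OF H el(2)]
      cochainD(2)[OF d T(1) us T(2) h] cochainD(2)[OF e T(1) us T(2) h] by simp
qed

text \<open>The empty family covers the empty space, and two sections agree on its members
  vacuously.\<close>

lemma empty_sections:
  assumes F: "condensed_ab \<kappa> F" and X: "X \<in> \<C>" and "topspace X = {}"
    and s: "s \<in> carrier (sections F X)" "t \<in> carrier (sections F X)"
  shows "s = t"
  by (rule sheaf_separated[OF F X _ s, of "{}"]) (use assms(3) in \<open>auto simp: finite_cover_def\<close>)

lemma single_separated:
  assumes F: "condensed_ab \<kappa> F" and X: "X \<in> \<C>" and Y: "Y \<in> \<C>" "q \<in> cmap Y X" "q ` topspace Y = topspace X"
    and s: "s \<in> carrier (sections F X)" "t \<in> carrier (sections F X)" and eq: "pull F Y X q s = pull F Y X q t"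
  shows "s = t"
  by (rule sheaf_separated[OF F X finite_cover_single[OF Y] s]) (use eq in auto)

lemma single_glue:
  assumes F: "condensed_ab \<kappa> F" and X: "X \<in> \<C>" and Y: "Y \<in> \<C>" "q \<in> cmap Y X" "q ` topspace Y = topspace X"
    and s: "s \<in> carrier (sections F Y)"
    and compat: "\<And>W u v. W \<in> \<C> \<Longrightarrow> u \<in> cmap W Y \<Longrightarrow> v \<in> cmap W Y \<Longrightarrow>
      compose (topspace W) q u = compose (topspace W) q v \<Longrightarrow> pull F W Y u s = pull F W Y v s"
  shows "\<exists>t\<in>carrier (sections F X). pull F Y X q t = s"
proof (rule sheaf_glue[OF F X finite_cover_single[OF Y], of "\<lambda>_. s"])
  fix t assume "t \<in> carrier (sections F X)" "\<And>Z f. (Z, f) \<in> {(Y, q)} \<Longrightarrow> pull F Z X f t = s"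
  then show ?thesis by (intro bexI[of _ t]) simp_all
next
  fix Z f Z' f' W u v
  assume "(Z, f) \<in> {(Y, q)}" "(Z', f') \<in> {(Y, q)}" and W: "W \<in> \<C>" "u \<in> cmap W Z" "v \<in> cmap W Z'"
    "compose (topspace W) f u = compose (topspace W) f' v"
  then have eq: "Z = Y" "f = q" "Z' = Y" "f' = q" by auto
  show "pull F W Z u s = pull F W Z' v s" unfolding eq by (rule compat) (use W eq in simp_all)
qed (use s in auto)

text \<open>Continuity is local for finite covers: the preimage of a closed set is a finite union of
  images of closed sets under the maps of the cover, and these are closed maps, from compact to
  Hausdorff spaces.\<close>

lemma condensed_real: "condensed_ab \<kappa> real_condensed"
  unfolding real_condensed_eq
proof (rule condensed_function_presheaf)
  show "cmap X euclideanreal \<subseteq> extensional (topspace X)" for X :: "'a topology" by (auto simp: cmap_def)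
  show "(\<lambda>x\<in>topspace X. 0) \<in> cmap X euclideanreal" for X :: "'a topology" by (rule cmap_restrict) simp
  show "(\<lambda>x\<in>topspace X. f x - g x) \<in> cmap X euclideanreal" if "f \<in> cmap X euclideanreal" "g \<in> cmap X euclideanreal"
    for X :: "'a topology" and f g
    using that by (intro cmap_restrict continuous_map_diff cmap_continuous)
  show "compose (topspace X) f h \<in> cmap X euclideanreal" if "h \<in> cmap X Y" "f \<in> cmap Y euclideanreal"
    for X Y :: "'a topology" and h f
    using that by (rule cmap_compose)
  show "f \<in> cmap X euclideanreal"
    if X: "X \<in> \<C>" and f: "f \<in> extensional (topspace X)"
      and loc: "locally X (\<lambda>Z k. compose (topspace Z) f k \<in> cmap Z euclideanreal)" for X f
  proof -
    obtain \<U> where \<U>: "finite_cover \<kappa> X \<U>" and U: "\<forall>(Z, k) \<in> \<U>. compose (topspace Z) f k \<in> cmap Z euclideanreal"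
      using loc by (rule locallyE)
    have "closedin X {x \<in> topspace X. f x \<in> C}" if C: "closedin euclideanreal C" for C
    proof -
      have "closedin X (k ` {z \<in> topspace Z. f (k z) \<in> C})" if i: "(Z, k) \<in> \<U>" for Z k
      proof -
        have Z: "Z \<in> \<C>" and k: "k \<in> cmap Z X" using finite_coverD(2,3)[OF \<U> i] by auto
        have "compose (topspace Z) f k \<in> cmap Z euclideanreal" using U i by auto
        then have "closedin Z {z \<in> topspace Z. compose (topspace Z) f k z \<in> C}"
          by (intro closedin_continuous_map_preimage[OF cmap_continuous C])
        then have "closedin Z {z \<in> topspace Z. f (k z) \<in> C}" by (simp add: compose_def cong: conj_cong)
        then show ?thesis
          using continuous_imp_closed_map[OF cmap_continuous[OF k] CHausD(1)[OF Z] CHausD(2)[OF X]] by (simp add: closed_map_def)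
      qed
      then have "closedin X (\<Union>i\<in>\<U>. snd i ` {z \<in> topspace (fst i). f (snd i z) \<in> C})"
        using finite_coverD(1)[OF \<U>] by (intro closedin_Union) auto
      moreover have "(\<Union>i\<in>\<U>. snd i ` {z \<in> topspace (fst i). f (snd i z) \<in> C}) = {x \<in> topspace X. f x \<in> C}"
      proof (intro equalityI subsetI)
        fix x assume "x \<in> (\<Union>i\<in>\<U>. snd i ` {z \<in> topspace (fst i). f (snd i z) \<in> C})"
        then obtain Z k z where "(Z, k) \<in> \<U>" "z \<in> topspace Z" "f (k z) \<in> C" "x = k z" by auto
        then show "x \<in> {x \<in> topspace X. f x \<in> C}" using cmap_in[OF finite_coverD(3)[OF \<U>]] by auto
      next
        fix x assume x: "x \<in> {x \<in> topspace X. f x \<in> C}"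
        then obtain Z k z where "(Z, k) \<in> \<U>" "z \<in> topspace Z" "k z = x" using finite_coverD(4)[OF \<U>] by blast
        then show "x \<in> (\<Union>i\<in>\<U>. snd i ` {z \<in> topspace (fst i). f (snd i z) \<in> C})"
          using x by (intro UN_I[of "(Z, k)"]) auto
      qed
      ultimately show ?thesis by simp
    qed
    then have "continuous_map X euclideanreal f" unfolding continuous_map_closedin by simp
    then show ?thesis using f by (simp add: cmap_def)
  qed
qed

text \<open>A natural cochain with values in continuous functions is determined by its values on
  one-point objects, that is, by a function of lists of points in a fibre. This reduces the claim to
  \<open>real_cech_exact\<close>.\<close>

lemma real_cochain_exact:
  assumes Y: "Y \<in> \<C>" and S: "S \<in> \<C>" and p: "p \<in> cmap Y S" "p ` topspace Y = topspace S"
    and f: "cochain real_condensed Y p (Suc (Suc n)) f"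
    and df: "\<And>T us. T \<in> \<C> \<Longrightarrow> us \<in> simplices Y p T (Suc (Suc (Suc n))) \<Longrightarrow>
      cech (sections real_condensed T) (f T) us = \<one>\<^bsub>sections real_condensed T\<^esub>"
  shows "\<exists>g. cochain real_condensed Y p (Suc n) g \<and>
    (\<forall>T\<in>\<C>. \<forall>us\<in>simplices Y p T (Suc (Suc n)). cech (sections real_condensed T) (g T) us = f T us)"
proof -
  note RP = condensed_ab_presheaf[OF condensed_real]
  have sec: "carrier (sections real_condensed T) = cmap T euclideanreal" "\<one>\<^bsub>sections real_condensed T\<^esub> = (\<lambda>x\<in>topspace T. 0)"
    "pull real_condensed T T' h s = compose (topspace T) s h" for T T' :: "'a topology" and h s
    by (simp_all add: real_condensed_eq)
  have cech_at: "cech (sections real_condensed T) d us t = cech real_group (\<lambda>vs. d vs t) us"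
    if T: "T \<in> \<C>" and t: "t \<in> topspace T" and d: "\<And>vs. set vs \<subseteq> set us \<Longrightarrow> Suc (length vs) = length us \<Longrightarrow> d vs \<in> cmap T euclideanreal"
    for T t d and us :: "('a \<Rightarrow> 'a) list"
  proof -
    have ev: "group_hom (sections real_condensed T) real_group (\<lambda>g. g t)"
      using sections_comm_group[OF RP T] comm_group_real_group t
      by (auto simp: group_hom_def group_hom_axioms_def comm_group_def real_condensed_eq intro!: homI)
    show ?thesis by (rule group_hom.cech_hom[OF ev sections_comm_group[OF RP T]]) (simp add: sec d)
  qed
  \<comment> \<open>A one-point object of the site; the subspace of \<open>Y\<close> on the first
    entry is a convenient one.\<close>
  define pt where "pt ys = subtopology Y {hd ys}" for ys
  define F where "F ys = f (pt ys) (map (\<lambda>y. \<lambda>_\<in>topspace (pt ys). y) ys) (hd ys)" for ys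
  have F: "f T us t = F (evaluate us t)" if T: "T \<in> \<C>" and us: "us \<in> simplices Y p T (Suc (Suc n))" and t: "t \<in> topspace T" for T us t
  proof -
    define ys where "ys = evaluate us t"
    have fl: "ys \<in> fibre_lists Y p (Suc (Suc n))" unfolding ys_def by (rule evaluate_simplices[OF us t])
    then have "hd ys \<in> set ys" using fibre_listsD(1)[OF fl] by (cases ys) auto
    then have hY: "hd ys \<in> topspace Y" using fibre_listsD(2)[OF fl] by blast
    have P: "pt ys \<in> \<C>" unfolding pt_def by (rule singleton_CHaus[OF Y hY])
    have tP: "topspace (pt ys) = {hd ys}" using hY by (simp add: pt_def)
    have h: "(\<lambda>_\<in>topspace (pt ys). t) \<in> cmap (pt ys) T" by (rule constant_cmap[OF t])
    have eq: "precomp (pt ys) (\<lambda>_\<in>topspace (pt ys). t) us = map (\<lambda>y. \<lambda>_\<in>topspace (pt ys). y) ys"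
      by (auto simp: ys_def compose_def fun_eq_iff)
    have "f (pt ys) (map (\<lambda>y. \<lambda>_\<in>topspace (pt ys). y) ys) = compose (topspace (pt ys)) (f T us) (\<lambda>_\<in>topspace (pt ys). t)"
      using cochainD(2)[OF f T us P h] unfolding eq sec .
    then show ?thesis by (simp add: F_def compose_def tP flip: ys_def)
  qed
  have contF: "continuous_cochain Y p (Suc (Suc n)) F"
    unfolding continuous_cochain_def
  proof (intro ballI)
    fix T us assume T: "T \<in> \<C>" and us: "us \<in> simplices Y p T (Suc (Suc n))"
    have "continuous_map T euclideanreal (f T us)" using cochainD(1)[OF f T us] by (simp add: sec cmap_def)
    then show "continuous_map T euclideanreal (\<lambda>t. F (evaluate us t))" by (rule continuous_map_eq) (rule F[OF T us])
  qed
  have zeroF: "cech real_group F ys = 0" if ys: "ys \<in> fibre_lists Y p (Suc (Suc (Suc n)))" for ys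
  proof -
    have "hd ys \<in> set ys" using fibre_listsD(1)[OF ys] by (cases ys) auto
    then have hY: "hd ys \<in> topspace Y" using fibre_listsD(2)[OF ys] by blast
    have P: "pt ys \<in> \<C>" unfolding pt_def by (rule singleton_CHaus[OF Y hY])
    have tP: "topspace (pt ys) = {hd ys}" using hY by (simp add: pt_def)
    let ?us = "map (\<lambda>y. \<lambda>_\<in>topspace (pt ys). y) ys"
    have us: "?us \<in> simplices Y p (pt ys) (Suc (Suc (Suc n)))" by (rule constant_simplices[OF ys])
    have ev: "evaluate ?us (hd ys) = ys" by (simp add: tP o_def)
    have "cech (sections real_condensed (pt ys)) (f (pt ys)) ?us (hd ys) = 0"
      using fun_cong[OF df[OF P us], of "hd ys"] tP by (simp add: sec)
    moreover have "cech (sections real_condensed (pt ys)) (f (pt ys)) ?us (hd ys) = cech real_group (\<lambda>vs. f (pt ys) vs (hd ys)) ?us"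
      using cochainD(1)[OF f P simplices_face[OF us]] tP by (intro cech_at[OF P]) (simp_all add: sec)
    moreover have "cech real_group (\<lambda>vs. f (pt ys) vs (hd ys)) ?us = cech real_group (\<lambda>vs. F (evaluate vs (hd ys))) ?us"
      by (rule cech_cong, rule F[OF P simplices_face[OF us]]) (use tP in auto)
    moreover have "cech real_group (\<lambda>vs. F (evaluate vs (hd ys))) ?us = cech real_group F (evaluate ?us (hd ys))"
      by (rule cech_map[symmetric])
    ultimately show ?thesis unfolding ev by simp
  qed
  obtain g where g: "continuous_cochain Y p (Suc n) g" "\<forall>ys\<in>fibre_lists Y p (Suc (Suc n)). cech real_group g ys = F ys"
    using real_cech_exact[OF Y S p contF zeroF] by blast
  define b where "b T us = (\<lambda>t\<in>topspace T. g (evaluate us t))" for T and us :: "('a \<Rightarrow> 'a) list"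
  have bc: "b T us \<in> cmap T euclideanreal" if "T \<in> \<C>" "us \<in> simplices Y p T (Suc n)" for T us
    unfolding b_def using g(1) that by (intro cmap_restrict) (simp add: continuous_cochain_def)
  have "cochain real_condensed Y p (Suc n) b"
    unfolding cochain_def
  proof (intro conjI ballI)
    show "b T us \<in> carrier (sections real_condensed T)" if "T \<in> \<C>" "us \<in> simplices Y p T (Suc n)" for T us
      unfolding sec by (rule bc[OF that])
    fix T T' :: "'a topology" and h us assume h: "h \<in> cmap T' T"
    show "b T' (precomp T' h us) = pull real_condensed T' T h (b T us)"
      unfolding sec using cmap_in[OF h] by (auto simp: b_def compose_def fun_eq_iff o_def)
  qed
  moreover have "cech (sections real_condensed T) (b T) us = f T us" if T: "T \<in> \<C>" and us: "us \<in> simplices Y p T (Suc (Suc n))" for T us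
  proof (rule cmap_eqI[of _ T euclideanreal])
    have bf: "b T vs \<in> cmap T euclideanreal" if "set vs \<subseteq> set us" "Suc (length vs) = length us" for vs
      by (rule bc[OF T simplices_face[OF us that]])
    show "cech (sections real_condensed T) (b T) us \<in> cmap T euclideanreal"
      using comm_group.cech_closed[OF sections_comm_group[OF RP T], of us "b T"] bf by (simp add: sec)
    show "f T us \<in> cmap T euclideanreal" using cochainD(1)[OF f T us] by (simp add: sec)
    fix t assume t: "t \<in> topspace T"
    have "cech (sections real_condensed T) (b T) us t = cech real_group (\<lambda>vs. b T vs t) us" by (rule cech_at[OF T t bf])
    also have "\<dots> = cech real_group g (evaluate us t)" using t by (simp add: b_def cech_map)
    also have "\<dots> = f T us t" using g(2) evaluate_simplices[OF us t] F[OF T us t] by simp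
    finally show "cech (sections real_condensed T) (b T) us t = f T us t" .
  qed
  ultimately show ?thesis by blast
qed

section \<open>Cech acyclicity of the kernels and dimension shifting\<close>

context
  fixes I :: "nat \<Rightarrow> ('a, 'g) presheaf" and \<delta> \<eta>
  assumes res: "injective_resolution \<kappa> real_condensed I \<delta> \<eta>"
    and big: "ordLeq3 (card_of (UNIV :: 'a set set set)) (card_of (UNIV :: 'g set))"
begin

lemma I_injective: "condensed_injective \<kappa> (I m)"
  using res by (simp add: injective_resolution_def)

lemma I_sheaf: "condensed_ab \<kappa> (I m)"
  using I_injective by (simp add: condensed_injective_def)

lemmas I_presheaf = condensed_ab_presheaf[OF I_sheaf]

lemma \<delta>_hom: "condensed_hom \<kappa> (I m) (I (Suc m)) (\<delta> m)"
  using res by (simp add: injective_resolution_def)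

lemma \<eta>_hom: "condensed_hom \<kappa> real_condensed (I 0) \<eta>"
  and \<eta>_inj: "X \<in> \<C> \<Longrightarrow> inj_on (\<eta> X) (cmap X euclideanreal)"
  using res by (simp_all add: injective_resolution_def condensed_mono_def real_condensed_eq)

lemma \<delta>_exact: "condensed_exact \<kappa> (I m) (I (Suc m)) (I (Suc (Suc m))) (\<delta> m) (\<delta> (Suc m))"
  and \<eta>_exact: "condensed_exact \<kappa> real_condensed (I 0) (I 1) \<eta> (\<delta> 0)"
  using res by (simp_all add: injective_resolution_def)

lemma \<delta>_\<delta>: "X \<in> \<C> \<Longrightarrow> s \<in> carrier (sections (I m) X) \<Longrightarrow> \<delta> (Suc m) X (\<delta> m X s) = \<one>\<^bsub>sections (I (Suc (Suc m))) X\<^esub>"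
  using \<delta>_exact[of m] by (simp add: condensed_exact_def)

lemma \<delta>_\<eta>: "X \<in> \<C> \<Longrightarrow> f \<in> cmap X euclideanreal \<Longrightarrow> \<delta> 0 X (\<eta> X f) = \<one>\<^bsub>sections (I (Suc 0)) X\<^esub>"
  using \<eta>_exact by (simp add: condensed_exact_def real_condensed_eq)

lemma \<delta>_group_hom: "X \<in> \<C> \<Longrightarrow> group_hom (sections (I m) X) (sections (I (Suc m)) X) (\<delta> m X)"
  using condensed_homD(1)[OF \<delta>_hom] sections_comm_group[OF I_presheaf]
  by (simp add: group_hom_def group_hom_axioms_def comm_group_def)

lemma \<eta>_group_hom: "X \<in> \<C> \<Longrightarrow> group_hom (sections real_condensed X) (sections (I 0) X) (\<eta> X)"
  using condensed_homD(1)[OF \<eta>_hom] sections_comm_group[OF I_presheaf] sections_comm_group[OF condensed_ab_presheaf[OF condensed_real]]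
  by (simp add: group_hom_def group_hom_axioms_def comm_group_def)

lemma \<delta>_local:
  assumes "X \<in> \<C>" "t \<in> carrier (sections (I (Suc m)) X)" "\<delta> (Suc m) X t = \<one>\<^bsub>sections (I (Suc (Suc m))) X\<^esub>"
  shows "\<exists>\<U>. finite_cover \<kappa> X \<U> \<and> (\<forall>(Y, f) \<in> \<U>. pull (I (Suc m)) Y X f t \<in> \<delta> m Y ` carrier (sections (I m) Y))"
  using \<delta>_exact[of m] assms unfolding condensed_exact_def by blast

text \<open>Left exactness: local preimages under the injective \<open>\<eta>\<close> are unique, so
  they agree on overlaps and glue.\<close>

lemma kernel_\<delta>_0:
  assumes X: "X \<in> \<C>" and s: "s \<in> carrier (sections (I 0) X)" and ds: "\<delta> 0 X s = \<one>\<^bsub>sections (I (Suc 0)) X\<^esub>"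
  shows "\<exists>f\<in>cmap X euclideanreal. \<eta> X f = s"
proof -
  note RP = condensed_ab_presheaf[OF condensed_real]
  have sec: "carrier (sections real_condensed T) = cmap T euclideanreal" for T :: "'a topology" by (simp add: real_condensed_eq)
  have "\<exists>\<U>. finite_cover \<kappa> X \<U> \<and> (\<forall>(Y, f) \<in> \<U>. pull (I 0) Y X f s \<in> \<eta> Y ` carrier (sections real_condensed Y))"
    using \<eta>_exact X s ds unfolding condensed_exact_def One_nat_def by blast
  then obtain \<U> where \<U>: "finite_cover \<kappa> X \<U>" and U: "\<forall>(Y, f) \<in> \<U>. pull (I 0) Y X f s \<in> \<eta> Y ` carrier (sections real_condensed Y)"
    by blast
  define r where "r i = (SOME g. g \<in> cmap (fst i) euclideanreal \<and> \<eta> (fst i) g = pull (I 0) (fst i) X (snd i) s)" for i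
  have r: "r (Z, f) \<in> cmap Z euclideanreal" "\<eta> Z (r (Z, f)) = pull (I 0) Z X f s" if i: "(Z, f) \<in> \<U>" for Z f
  proof -
    have "pull (I 0) Z X f s \<in> \<eta> Z ` cmap Z euclideanreal" using bspec[OF U i] by (simp add: sec)
    then have "\<exists>g. g \<in> cmap Z euclideanreal \<and> \<eta> Z g = pull (I 0) Z X f s" by (metis imageE)
    from someI_ex[OF this] show "r (Z, f) \<in> cmap Z euclideanreal" "\<eta> Z (r (Z, f)) = pull (I 0) Z X f s" by (simp_all add: r_def)
  qed
  have "\<exists>g. g \<in> carrier (sections real_condensed X) \<and> (\<forall>Z f. (Z, f) \<in> \<U> \<longrightarrow> pull real_condensed Z X f g = r (Z, f))"
  proof (rule sheaf_glue[OF condensed_real X \<U>, of r])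
    show "r (Z, f) \<in> carrier (sections real_condensed Z)" if "(Z, f) \<in> \<U>" for Z f unfolding sec by (rule r(1)[OF that])
    show "pull real_condensed W Z u (r (Z, f)) = pull real_condensed W Z' v (r (Z', f'))"
      if i: "(Z, f) \<in> \<U>" "(Z', f') \<in> \<U>" and W: "W \<in> \<C>" "u \<in> cmap W Z" "v \<in> cmap W Z'"
        and eq: "compose (topspace W) f u = compose (topspace W) f' v" for Z f Z' f' W u v
    proof -
      have Z: "Z \<in> \<C>" "f \<in> cmap Z X" "Z' \<in> \<C>" "f' \<in> cmap Z' X" using finite_coverD(2,3)[OF \<U>] i by auto
      have rc: "r (Z, f) \<in> carrier (sections real_condensed Z)" "r (Z', f') \<in> carrier (sections real_condensed Z')"
        unfolding sec using r(1) i by auto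
      have "\<eta> W (pull real_condensed W Z u (r (Z, f))) = pull (I 0) W X (compose (topspace W) f u) s"
        using condensed_homD(2)[OF \<eta>_hom W(1) Z(1) W(2) rc(1)] r(2)[OF i(1)] pull_compose[OF I_presheaf W(1) Z(1) X W(2) Z(2) s] by simp
      also have "\<dots> = \<eta> W (pull real_condensed W Z' v (r (Z', f')))"
        unfolding eq using condensed_homD(2)[OF \<eta>_hom W(1) Z(3) W(3) rc(2)] r(2)[OF i(2)] pull_compose[OF I_presheaf W(1) Z(3) X W(3) Z(4) s] by simp
      finally show ?thesis
        by (rule inj_onD[OF \<eta>_inj[OF W(1)]])
          (use pull_closed[OF RP W(1) Z(1) W(2) rc(1)] pull_closed[OF RP W(1) Z(3) W(3) rc(2)] in \<open>simp_all add: sec\<close>)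
    qed
    fix t assume "t \<in> carrier (sections real_condensed X)" "\<And>Z f. (Z, f) \<in> \<U> \<Longrightarrow> pull real_condensed Z X f t = r (Z, f)"
    then show ?thesis by (intro exI[of _ t]) simp
  qed
  then obtain g where g: "g \<in> carrier (sections real_condensed X)" "\<forall>Z f. (Z, f) \<in> \<U> \<longrightarrow> pull real_condensed Z X f g = r (Z, f)" by blast
  have "\<eta> X g = s"
  proof (rule sheaf_separated[OF I_sheaf X \<U> condensed_hom_closed[OF \<eta>_hom X g(1)] s])
    fix Z f assume i: "(Z, f) \<in> \<U>"
    show "pull (I 0) Z X f (\<eta> X g) = pull (I 0) Z X f s"
      using condensed_homD(2)[OF \<eta>_hom finite_coverD(2)[OF \<U> i] X finite_coverD(3)[OF \<U> i] g(1)] g(2) i r(2)[OF i] by simp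
  qed
  then show ?thesis using g(1) unfolding sec by blast
qed

definition killed :: "nat \<Rightarrow> 'a topology \<Rightarrow> ('a \<Rightarrow> 'a) \<Rightarrow> nat \<Rightarrow> ('a topology \<Rightarrow> ('a \<Rightarrow> 'a) list \<Rightarrow> 'g) \<Rightarrow> bool"
  where "killed m Y p n c \<longleftrightarrow> (\<forall>T\<in>\<C>. \<forall>us\<in>simplices Y p T n. \<delta> m T (c T us) = \<one>\<^bsub>sections (I (Suc m)) T\<^esub>)"

definition cocycle :: "nat \<Rightarrow> 'a topology \<Rightarrow> ('a \<Rightarrow> 'a) \<Rightarrow> nat \<Rightarrow> ('a topology \<Rightarrow> ('a \<Rightarrow> 'a) list \<Rightarrow> 'g) \<Rightarrow> bool"
  where "cocycle m Y p n c \<longleftrightarrow> cochain (I m) Y p n c \<and>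
    (\<forall>T\<in>\<C>. \<forall>us\<in>simplices Y p T (Suc n). cech (sections (I m) T) (c T) us = \<one>\<^bsub>sections (I m) T\<^esub>)"

text \<open>Acyclicity of the kernel of \<open>\<delta> m\<close>, whose cochains are those of
  \<open>I m\<close> singled out by \<open>killed\<close>. Lists of length
  \<open>Suc (Suc n)\<close> mean degree n + 1, so all positive degrees are covered. All surjections
  are treated at once because the induction also needs those onto fibre powers.\<close>

definition cech_acyclic :: "nat \<Rightarrow> bool"
  where "cech_acyclic m \<longleftrightarrow> (\<forall>Y S p n c. Y \<in> \<C> \<longrightarrow> S \<in> \<C> \<longrightarrow> p \<in> cmap Y S \<longrightarrow> p ` topspace Y = topspace S \<longrightarrow>
    cocycle m Y p (Suc (Suc n)) c \<longrightarrow> killed m Y p (Suc (Suc n)) c \<longrightarrow>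
    (\<exists>b. cochain (I m) Y p (Suc n) b \<and> killed m Y p (Suc n) b \<and>
      (\<forall>T\<in>\<C>. \<forall>us\<in>simplices Y p T (Suc (Suc n)). cech (sections (I m) T) (b T) us = c T us)))"

lemma cech_\<delta>:
  assumes c: "cochain (I m) Y p n c" and T: "T \<in> \<C>" and us: "us \<in> simplices Y p T (Suc n)"
  shows "\<delta> m T (cech (sections (I m) T) (c T) us) = cech (sections (I (Suc m)) T) (\<lambda>vs. \<delta> m T (c T vs)) us"
  by (rule group_hom.cech_hom[OF \<delta>_group_hom[OF T] sections_comm_group[OF I_presheaf T]])
     (rule cochainD(1)[OF c T simplices_face[OF us]])

lemma cochain_\<delta>:
  assumes c: "cochain (I m) Y p n c"
  shows "cochain (I (Suc m)) Y p n (\<lambda>T us. \<delta> m T (c T us))"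
  unfolding cochain_def
proof (intro conjI ballI)
  show "\<delta> m T (c T us) \<in> carrier (sections (I (Suc m)) T)" if "T \<in> \<C>" "us \<in> simplices Y p T n" for T us
    by (rule condensed_hom_closed[OF \<delta>_hom that(1) cochainD(1)[OF c that]])
  fix T T' h us assume T: "T \<in> \<C>" "T' \<in> \<C>" and h: "h \<in> cmap T' T" and us: "us \<in> simplices Y p T n"
  show "\<delta> m T' (c T' (precomp T' h us)) = pull (I (Suc m)) T' T h (\<delta> m T (c T us))"
    unfolding cochainD(2)[OF c T(1) us T(2) h] by (rule condensed_homD(2)[OF \<delta>_hom T(2,1) h cochainD(1)[OF c T(1) us]])
qed

text \<open>By \<open>kernel_\<delta>_0\<close> the kernel of \<open>\<delta> 0\<close> is the image
  of the real-valued functions under \<open>\<eta>\<close>. Injectivity of \<open>\<eta>\<close>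
  makes the preimage of a killed cocycle natural and closed, and the real case solves it.\<close>

lemma cech_acyclic_0: "cech_acyclic 0"
  unfolding cech_acyclic_def
proof (intro allI impI)
  fix Y S p n c
  assume Y: "Y \<in> \<C>" and S: "S \<in> \<C>" and p: "p \<in> cmap Y S" "p ` topspace Y = topspace S"
    and coc: "cocycle 0 Y p (Suc (Suc n)) c" and kill: "killed 0 Y p (Suc (Suc n)) c"
  have c: "cochain (I 0) Y p (Suc (Suc n)) c" using coc by (simp add: cocycle_def)
  have sec: "carrier (sections real_condensed T) = cmap T euclideanreal" for T :: "'a topology" by (simp add: real_condensed_eq)
  note RP = condensed_ab_presheaf[OF condensed_real]
  define f where "f T us = (SOME g. g \<in> cmap T euclideanreal \<and> \<eta> T g = c T us)" for T us
  have f: "f T us \<in> cmap T euclideanreal" "\<eta> T (f T us) = c T us" if T: "T \<in> \<C>" and us: "us \<in> simplices Y p T (Suc (Suc n))" for T us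
  proof -
    have "\<delta> 0 T (c T us) = \<one>\<^bsub>sections (I (Suc 0)) T\<^esub>" using kill T us by (simp add: killed_def)
    then have "\<exists>g. g \<in> cmap T euclideanreal \<and> \<eta> T g = c T us"
      using kernel_\<delta>_0[OF T cochainD(1)[OF c T us]] by blast
    from someI_ex[OF this] show "f T us \<in> cmap T euclideanreal" "\<eta> T (f T us) = c T us" by (simp_all add: f_def)
  qed
  have fc: "cochain real_condensed Y p (Suc (Suc n)) f"
    unfolding cochain_def
  proof (intro conjI ballI)
    show "f T us \<in> carrier (sections real_condensed T)" if "T \<in> \<C>" "us \<in> simplices Y p T (Suc (Suc n))" for T us
      unfolding sec by (rule f(1)[OF that])
    fix T T' h us assume T: "T \<in> \<C>" "T' \<in> \<C>" and h: "h \<in> cmap T' T" and us: "us \<in> simplices Y p T (Suc (Suc n))"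
    have fT: "f T us \<in> carrier (sections real_condensed T)" unfolding sec by (rule f(1)[OF T(1) us])
    have us': "precomp T' h us \<in> simplices Y p T' (Suc (Suc n))" by (rule simplices_precomp[OF us h])
    have "\<eta> T' (f T' (precomp T' h us)) = \<eta> T' (pull real_condensed T' T h (f T us))"
      using f(2)[OF T(2) us'] cochainD(2)[OF c T(1) us T(2) h] condensed_homD(2)[OF \<eta>_hom T(2,1) h fT] f(2)[OF T(1) us] by simp
    then show "f T' (precomp T' h us) = pull real_condensed T' T h (f T us)"
      by (rule inj_onD[OF \<eta>_inj[OF T(2)]]) (use f(1)[OF T(2) us'] pull_closed[OF RP T(2,1) h fT] in \<open>simp_all add: sec\<close>)
  qed
  have face: "f T vs \<in> carrier (sections real_condensed T)"
    if "T \<in> \<C>" "us \<in> simplices Y p T (Suc (Suc (Suc n)))" "set vs \<subseteq> set us" "Suc (length vs) = length us" for T us vs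
    unfolding sec by (rule f(1)[OF that(1) simplices_face[OF that(2-4)]])
  have df: "cech (sections real_condensed T) (f T) us = \<one>\<^bsub>sections real_condensed T\<^esub>"
    if T: "T \<in> \<C>" and us: "us \<in> simplices Y p T (Suc (Suc (Suc n)))" for T us
  proof (rule inj_onD[OF \<eta>_inj[OF T]])
    have "\<eta> T (cech (sections real_condensed T) (f T) us) = cech (sections (I 0) T) (\<lambda>vs. \<eta> T (f T vs)) us"
      by (rule group_hom.cech_hom[OF \<eta>_group_hom[OF T] sections_comm_group[OF RP T] face[OF T us]])
    also have "\<dots> = cech (sections (I 0) T) (c T) us"
      by (rule cech_cong) (rule f(2)[OF T simplices_face[OF us]])
    also have "\<dots> = \<one>\<^bsub>sections (I 0) T\<^esub>" using coc T us by (simp add: cocycle_def)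
    also have "\<dots> = \<eta> T \<one>\<^bsub>sections real_condensed T\<^esub>" using group_hom.hom_one[OF \<eta>_group_hom[OF T]] by simp
    finally show "\<eta> T (cech (sections real_condensed T) (f T) us) = \<eta> T \<one>\<^bsub>sections real_condensed T\<^esub>" .
    show "cech (sections real_condensed T) (f T) us \<in> cmap T euclideanreal"
      using comm_group.cech_closed[OF sections_comm_group[OF RP T] face[OF T us]] by (simp add: sec)
    show "\<one>\<^bsub>sections real_condensed T\<^esub> \<in> cmap T euclideanreal"
      using monoid.one_closed[OF comm_monoid.axioms(1)[OF comm_group.axioms(1)[OF sections_comm_group[OF RP T]]]] by (simp add: sec)
  qed
  obtain g where g: "cochain real_condensed Y p (Suc n) g"
    and dg: "\<forall>T\<in>\<C>. \<forall>us\<in>simplices Y p T (Suc (Suc n)). cech (sections real_condensed T) (g T) us = f T us"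
    using real_cochain_exact[OF Y S p fc df] by blast
  have "cochain (I 0) Y p (Suc n) (\<lambda>T us. \<eta> T (g T us))"
    unfolding cochain_def
  proof (intro conjI ballI)
    show "\<eta> T (g T us) \<in> carrier (sections (I 0) T)" if "T \<in> \<C>" "us \<in> simplices Y p T (Suc n)" for T us
      by (rule condensed_hom_closed[OF \<eta>_hom that(1) cochainD(1)[OF g that]])
    fix T T' h us assume T: "T \<in> \<C>" "T' \<in> \<C>" and h: "h \<in> cmap T' T" and us: "us \<in> simplices Y p T (Suc n)"
    show "\<eta> T' (g T' (precomp T' h us)) = pull (I 0) T' T h (\<eta> T (g T us))"
      unfolding cochainD(2)[OF g T(1) us T(2) h] by (rule condensed_homD(2)[OF \<eta>_hom T(2,1) h cochainD(1)[OF g T(1) us]])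
  qed
  moreover have "killed 0 Y p (Suc n) (\<lambda>T us. \<eta> T (g T us))"
    unfolding killed_def using \<delta>_\<eta> cochainD(1)[OF g] by (simp add: sec)
  moreover have "cech (sections (I 0) T) (\<lambda>us. \<eta> T (g T us)) us = c T us"
    if T: "T \<in> \<C>" and us: "us \<in> simplices Y p T (Suc (Suc n))" for T us
  proof -
    have "cech (sections (I 0) T) (\<lambda>us. \<eta> T (g T us)) us = \<eta> T (cech (sections real_condensed T) (g T) us)"
      by (rule group_hom.cech_hom[OF \<eta>_group_hom[OF T] sections_comm_group[OF RP T], symmetric])
         (rule cochainD(1)[OF g T simplices_face[OF us]])
    then show ?thesis using dg T us f(2)[OF T us] by simp
  qed
  ultimately show "\<exists>b. cochain (I 0) Y p (Suc n) b \<and> killed 0 Y p (Suc n) b \<and>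
      (\<forall>T\<in>\<C>. \<forall>us\<in>simplices Y p T (Suc (Suc n)). cech (sections (I 0) T) (b T) us = c T us)"
    by (intro exI[of _ "\<lambda>T us. \<eta> T (g T us)"]) simp
qed

text \<open>The obstruction to a global preimage of \<open>t\<close> is a Cech class of degree 1.
  Preimages on a cover are assembled to one section \<open>y\<close> over its disjoint union
  \<open>Y\<close>; the quotient of the two pullbacks of \<open>y\<close> to pairs of points with
  equal image is killed by \<open>\<delta> m\<close>, hence is the coboundary of a killed
  \<open>b\<close>. Dividing \<open>y\<close> by \<open>b\<close> does not change its image under
  \<open>\<delta> m\<close> and lets it descend to \<open>X\<close>.\<close>

lemma kernel_\<delta>_Suc:
  assumes acyc: "cech_acyclic m" and X: "X \<in> \<C>" and t: "t \<in> carrier (sections (I (Suc m)) X)"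
    and dt: "\<delta> (Suc m) X t = \<one>\<^bsub>sections (I (Suc (Suc m))) X\<^esub>"
  shows "\<exists>x\<in>carrier (sections (I m) X). \<delta> m X x = t"
proof -
  obtain \<U> where \<U>: "finite_cover \<kappa> X \<U>"
    and loc: "\<forall>(Z, f) \<in> \<U>. pull (I (Suc m)) Z X f t \<in> \<delta> m Z ` carrier (sections (I m) Z)"
    using \<delta>_local[OF X t dt] by blast
  define r where "r i = (SOME x. x \<in> carrier (sections (I m) (fst i)) \<and> \<delta> m (fst i) x = pull (I (Suc m)) (fst i) X (snd i) t)" for i
  have r: "r (Z, f) \<in> carrier (sections (I m) Z)" "\<delta> m Z (r (Z, f)) = pull (I (Suc m)) Z X f t" if i: "(Z, f) \<in> \<U>" for Z f
  proof -
    have "pull (I (Suc m)) Z X f t \<in> \<delta> m Z ` carrier (sections (I m) Z)" using bspec[OF loc i] by simp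
    then have "\<exists>x. x \<in> carrier (sections (I m) Z) \<and> \<delta> m Z x = pull (I (Suc m)) Z X f t" by (metis imageE)
    from someI_ex[OF this] show "r (Z, f) \<in> carrier (sections (I m) Z)" "\<delta> m Z (r (Z, f)) = pull (I (Suc m)) Z X f t"
      by (simp_all add: r_def)
  qed
  obtain Y q j where Y: "Y \<in> \<C>" and du: "is_disjoint_union \<U> X Y q j" by (rule disjoint_union[OF X \<U>])
  have q: "q \<in> cmap Y X" "q ` topspace Y = topspace X"
    and jq: "\<forall>(Z, f) \<in> \<U>. j (Z, f) \<in> cmap Z Y \<and> compose (topspace Z) q (j (Z, f)) = f"
    and disj: "\<forall>(Z, f) \<in> \<U>. \<forall>(Z', f') \<in> \<U>. \<forall>z\<in>topspace Z. \<forall>z'\<in>topspace Z'. j (Z, f) z = j (Z', f') z' \<longrightarrow> Z = Z' \<and> f = f' \<and> z = z'"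
    and cov: "\<forall>y\<in>topspace Y. \<exists>Z f z. (Z, f) \<in> \<U> \<and> z \<in> topspace Z \<and> y = j (Z, f) z"
    using du unfolding is_disjoint_union_def by blast+
  have j: "j (Z, f) \<in> cmap Z Y" "compose (topspace Z) q (j (Z, f)) = f" if "(Z, f) \<in> \<U>" for Z f
    using bspec[OF jq that] by auto
  define \<V> where "\<V> = (\<lambda>i. (fst i, j i)) ` \<U>"
  have mem: "\<exists>f. (Z, f) \<in> \<U> \<and> g = j (Z, f) \<and> compose (topspace Z) q g = f" if "(Z, g) \<in> \<V>" for Z g
    using that j(2) by (force simp: \<V>_def)
  have \<V>: "finite_cover \<kappa> Y \<V>"
  proof (rule finite_coverI)
    show "finite \<V>" using finite_coverD(1)[OF \<U>] by (simp add: \<V>_def)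
    show "Z \<in> \<C> \<and> g \<in> cmap Z Y" if "(Z, g) \<in> \<V>" for Z g
      using mem[OF that] j(1) finite_coverD(2)[OF \<U>] by blast
    fix y assume "y \<in> topspace Y"
    then obtain Z f z where z: "(Z, f) \<in> \<U>" "z \<in> topspace Z" "y = j (Z, f) z" using cov by blast
    have "(Z, j (Z, f)) \<in> \<V>" using z(1) unfolding \<V>_def by force
    then show "\<exists>Z g z. (Z, g) \<in> \<V> \<and> z \<in> topspace Z \<and> g z = y" using z(2,3) by blast
  qed
  \<comment> \<open>The members of \<open>\<V>\<close> map to \<open>Y\<close> instead of
    \<open>X\<close>; composing with \<open>q\<close> recovers the member of \<open>\<U>\<close> for
    which \<open>r\<close> was chosen.\<close>
  define r' where "r' i = r (fst i, compose (topspace (fst i)) q (snd i))" for i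
  have r': "r' (Z, g) \<in> carrier (sections (I m) Z)" "\<delta> m Z (r' (Z, g)) = pull (I (Suc m)) Z X (compose (topspace Z) q g) t"
    if "(Z, g) \<in> \<V>" for Z g
    using mem[OF that] r by (auto simp: r'_def)
  have "\<exists>y. y \<in> carrier (sections (I m) Y) \<and> (\<forall>Z g. (Z, g) \<in> \<V> \<longrightarrow> pull (I m) Z Y g y = r' (Z, g))"
  proof (rule sheaf_glue[OF I_sheaf Y \<V>, of r'])
    fix y assume "y \<in> carrier (sections (I m) Y)" "\<And>Z g. (Z, g) \<in> \<V> \<Longrightarrow> pull (I m) Z Y g y = r' (Z, g)"
    then show ?thesis by (intro exI[of _ y]) simp
  next
    fix Z g Z' g' W u v
    assume i: "(Z, g) \<in> \<V>" "(Z', g') \<in> \<V>" and W: "W \<in> \<C>" and u: "u \<in> cmap W Z" and v: "v \<in> cmap W Z'"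
      and eq: "compose (topspace W) g u = compose (topspace W) g' v"
    have Z: "Z \<in> \<C>" "Z' \<in> \<C>" using finite_coverD(2)[OF \<V>] i by auto
    obtain f f' where f: "(Z, f) \<in> \<U>" "g = j (Z, f)" "(Z', f') \<in> \<U>" "g' = j (Z', f')" using mem i by metis
    have same: "Z = Z' \<and> f = f' \<and> u w = v w" if w: "w \<in> topspace W" for w
    proof -
      have "j (Z, f) (u w) = j (Z', f') (v w)" using fun_cong[OF eq, of w] w by (simp add: compose_def f)
      then show ?thesis using disj f cmap_in[OF u w] cmap_in[OF v w] by fast
    qed
    \<comment> \<open>A point of \<open>W\<close> forces both members of the cover to be the same
      summand. For empty \<open>W\<close> no such point exists, but there all sections
      coincide.\<close>
    show "pull (I m) W Z u (r' (Z, g)) = pull (I m) W Z' v (r' (Z', g'))"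
    proof (cases "topspace W = {}")
      case True
      show ?thesis
        by (rule empty_sections[OF I_sheaf W True pull_closed[OF I_presheaf W Z(1) u r'(1)[OF i(1)]] pull_closed[OF I_presheaf W Z(2) v r'(1)[OF i(2)]]])
    next
      case False
      then obtain w where "w \<in> topspace W" by blast
      then have ZZ: "Z = Z'" "f = f'" using same by blast+
      have "u = v" by (rule cmap_eqI[OF u]) (use v same ZZ in auto)
      then show ?thesis using ZZ f by simp
    qed
  qed (rule r'(1))
  then obtain y where y: "y \<in> carrier (sections (I m) Y)" and yV: "\<forall>Z g. (Z, g) \<in> \<V> \<longrightarrow> pull (I m) Z Y g y = r' (Z, g)" by blast
  have qt: "pull (I (Suc m)) Y X q t \<in> carrier (sections (I (Suc m)) Y)" by (rule pull_closed[OF I_presheaf Y X q(1) t])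
  have dy: "\<delta> m Y y = pull (I (Suc m)) Y X q t"
  proof (rule sheaf_separated[OF I_sheaf Y \<V> condensed_hom_closed[OF \<delta>_hom Y y] qt])
    fix Z g assume i: "(Z, g) \<in> \<V>"
    have Z: "Z \<in> \<C>" "g \<in> cmap Z Y" using finite_coverD(2,3)[OF \<V> i] by auto
    have "pull (I (Suc m)) Z Y g (\<delta> m Y y) = \<delta> m Z (r' (Z, g))"
      using condensed_homD(2)[OF \<delta>_hom Z(1) Y Z(2) y] yV i by simp
    also have "\<dots> = pull (I (Suc m)) Z Y g (pull (I (Suc m)) Y X q t)"
      unfolding r'(2)[OF i] by (rule pull_compose[OF I_presheaf Z(1) Y X Z(2) q(1) t])
    finally show "pull (I (Suc m)) Z Y g (\<delta> m Y y) = pull (I (Suc m)) Z Y g (pull (I (Suc m)) Y X q t)" .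
  qed
  \<comment> \<open>The section \<open>y\<close> regarded as a cochain on lists of length
    one.\<close>
  define a where "a T us = pull (I m) T Y (hd us) y" for T and us :: "('a \<Rightarrow> 'a) list"
  have hd: "hd us \<in> cmap T Y \<and> us \<noteq> []" if "us \<in> simplices Y q T (Suc 0)" for T us
    using simplicesD[OF that] by (cases us) auto
  have a: "cochain (I m) Y q (Suc 0) a"
    unfolding cochain_def
  proof (intro conjI ballI)
    show "a T us \<in> carrier (sections (I m) T)" if "T \<in> \<C>" "us \<in> simplices Y q T (Suc 0)" for T us
      unfolding a_def using hd[OF that(2)] by (intro pull_closed[OF I_presheaf that(1) Y _ y]) simp
    fix T T' h us assume T: "T \<in> \<C>" "T' \<in> \<C>" and h: "h \<in> cmap T' T" and us: "us \<in> simplices Y q T (Suc 0)"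
    show "a T' (precomp T' h us) = pull (I m) T' T h (a T us)"
      using pull_compose[OF I_presheaf T(2,1) Y h _ y] hd[OF us] by (simp add: a_def hd_map)
  qed
  have single: "[u] \<in> simplices Y q T (Suc 0)" if "u \<in> cmap T Y" for u T
    using that by (intro simplicesI) auto
  have c: "cochain (I m) Y q (Suc (Suc 0)) (\<lambda>T. cech (sections (I m) T) (a T))"
    by (rule cochain_cech[OF I_presheaf a])
  have coc: "cocycle m Y q (Suc (Suc 0)) (\<lambda>T. cech (sections (I m) T) (a T))"
    unfolding cocycle_def
  proof (intro conjI ballI c)
    fix T us assume T: "T \<in> \<C>" and us: "us \<in> simplices Y q T (Suc (Suc (Suc 0)))"
    show "cech (sections (I m) T) (cech (sections (I m) T) (a T)) us = \<one>\<^bsub>sections (I m) T\<^esub>"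
    proof (rule comm_group.cech_cech[OF sections_comm_group[OF I_presheaf T]])
      fix vs assume vs: "set vs \<subseteq> set us" "Suc (Suc (length vs)) = length us"
      have "vs \<in> simplices Y q T (Suc 0)" using us vs unfolding simplices_def by auto
      then show "a T vs \<in> carrier (sections (I m) T)" by (rule cochainD(1)[OF a T])
    qed
  qed
  have da: "\<delta> m T (a T [u]) = pull (I (Suc m)) T X (compose (topspace T) q u) t" if T: "T \<in> \<C>" and u: "u \<in> cmap T Y" for T u
    using condensed_homD(2)[OF \<delta>_hom T Y u y] dy pull_compose[OF I_presheaf T Y X u q(1) t] by (simp add: a_def)
  have kill: "killed m Y q (Suc (Suc 0)) (\<lambda>T. cech (sections (I m) T) (a T))"
    unfolding killed_def
  proof (intro ballI)
    fix T us assume T: "T \<in> \<C>" and us: "us \<in> simplices Y q T (Suc (Suc 0))"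
    note G = sections_comm_group[OF I_presheaf T]
    obtain u v where uv: "us = [u, v]" using simplicesD(1)[OF us] by (auto simp: length_Suc_conv)
    have u: "u \<in> cmap T Y" "v \<in> cmap T Y" using simplicesD(2)[OF us] uv by auto
    have "compose (topspace T) q u = compose (topspace T) q v" using simplices_base[OF us] uv by simp
    then have eq: "\<delta> m T (a T [v]) = \<delta> m T (a T [u])" using da[OF T] u by simp
    have cl: "\<delta> m T (a T [u]) \<in> carrier (sections (I (Suc m)) T)"
      by (rule condensed_hom_closed[OF \<delta>_hom T cochainD(1)[OF a T single[OF u(1)]]])
    have "\<delta> m T (cech (sections (I m) T) (a T) us) = cech (sections (I (Suc m)) T) (\<lambda>vs. \<delta> m T (a T vs)) [u, v]"
      using cech_\<delta>[OF a T us] uv by simp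
    also have "\<dots> = \<delta> m T (a T [v]) \<otimes>\<^bsub>sections (I (Suc m)) T\<^esub> inv\<^bsub>sections (I (Suc m)) T\<^esub> \<delta> m T (a T [u])"
      by (rule comm_group.cech_pair[OF G]) (use cl eq in simp_all)
    also have "\<dots> = \<one>\<^bsub>sections (I (Suc m)) T\<^esub>"
      unfolding eq by (rule group.r_inv[OF comm_group.axioms(2)[OF G] cl])
    finally show "\<delta> m T (cech (sections (I m) T) (a T) us) = \<one>\<^bsub>sections (I (Suc m)) T\<^esub>" .
  qed
  obtain b where b: "cochain (I m) Y q (Suc 0) b" and kb: "killed m Y q (Suc 0) b"
    and cb: "\<forall>T\<in>\<C>. \<forall>us\<in>simplices Y q T (Suc (Suc 0)). cech (sections (I m) T) (b T) us = cech (sections (I m) T) (a T) us"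
    using acyc[unfolded cech_acyclic_def, rule_format, OF Y X q coc kill] by blast
  \<comment> \<open>Conversely the cochain \<open>b\<close> is read as a section over
    \<open>Y\<close>, by evaluating it at the identity.\<close>
  define \<beta> where "\<beta> = b Y [restrict id (topspace Y)]"
  have \<beta>: "\<beta> \<in> carrier (sections (I m) Y)" unfolding \<beta>_def by (rule cochainD(1)[OF b Y single[OF cmap_id]])
  have b\<beta>: "b W [u] = pull (I m) W Y u \<beta>" if W: "W \<in> \<C>" and u: "u \<in> cmap W Y" for W u
    using cochainD(2)[OF b Y single[OF cmap_id] W u] cmap_id_compose[OF u] by (simp add: \<beta>_def)
  note GY = group_hom.axioms(1)[OF \<delta>_group_hom[OF Y, of m]]
  define z where "z = y \<otimes>\<^bsub>sections (I m) Y\<^esub> inv\<^bsub>sections (I m) Y\<^esub> \<beta>"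
  have i\<beta>: "inv\<^bsub>sections (I m) Y\<^esub> \<beta> \<in> carrier (sections (I m) Y)" using group.inv_closed[OF GY \<beta>] .
  have z: "z \<in> carrier (sections (I m) Y)"
    unfolding z_def by (rule monoid.m_closed[OF group.is_monoid[OF GY] y i\<beta>])
  have pz: "pull (I m) W Y u z = a W [u] \<otimes>\<^bsub>sections (I m) W\<^esub> inv\<^bsub>sections (I m) W\<^esub> b W [u]" if W: "W \<in> \<C>" and u: "u \<in> cmap W Y" for W u
    using group_hom.hom_mult[OF pull_group_hom[OF I_presheaf W Y u] y i\<beta>] group_hom.hom_inv[OF pull_group_hom[OF I_presheaf W Y u] \<beta>] b\<beta>[OF W u]
    by (simp add: z_def a_def)
  have "\<exists>x\<in>carrier (sections (I m) X). pull (I m) Y X q x = z"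
  proof (rule single_glue[OF I_sheaf X Y q z])
    fix W u v assume W: "W \<in> \<C>" and u: "u \<in> cmap W Y" and v: "v \<in> cmap W Y"
      and eq: "compose (topspace W) q u = compose (topspace W) q v"
    note G = sections_comm_group[OF I_presheaf W, of m]
    have s: "[u, v] \<in> simplices Y q W (Suc (Suc 0))" using u v eq by (intro simplicesI) auto
    have cl: "a W [u] \<in> carrier (sections (I m) W)" "a W [v] \<in> carrier (sections (I m) W)"
      "b W [u] \<in> carrier (sections (I m) W)" "b W [v] \<in> carrier (sections (I m) W)"
      using cochainD(1)[OF a W single] cochainD(1)[OF b W single] u v by auto
    have "cech (sections (I m) W) (b W) [u, v] = cech (sections (I m) W) (a W) [u, v]" using cb W s by blast
    then show "pull (I m) W Y u z = pull (I m) W Y v z"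
      unfolding pz[OF W u] pz[OF W v] comm_group.cech_pair[OF G cl(1,2)] comm_group.cech_pair[OF G cl(3,4)]
      by (rule comm_group.swap_quotients[OF G cl])
  qed
  then obtain x where x: "x \<in> carrier (sections (I m) X)" and qx: "pull (I m) Y X q x = z" by blast
  have "\<delta> m X x = t"
  proof (rule single_separated[OF I_sheaf X Y q condensed_hom_closed[OF \<delta>_hom X x] t])
    note GS = group_hom.axioms(2)[OF \<delta>_group_hom[OF Y, of m]]
    have "\<delta> m Y \<beta> = \<one>\<^bsub>sections (I (Suc m)) Y\<^esub>"
      using kb Y single[OF cmap_id] unfolding killed_def \<beta>_def by blast
    then have "\<delta> m Y z = pull (I (Suc m)) Y X q t"
      using group_hom.hom_mult[OF \<delta>_group_hom[OF Y] y i\<beta>] group_hom.hom_inv[OF \<delta>_group_hom[OF Y] \<beta>] dy qt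
        monoid.inv_one[OF group.is_monoid[OF GS]] monoid.r_one[OF group.is_monoid[OF GS]] by (simp add: z_def)
    then show "pull (I (Suc m)) Y X q (\<delta> m X x) = pull (I (Suc m)) Y X q t"
      using condensed_homD(2)[OF \<delta>_hom Y X q(1) x] qx by simp
  qed
  then show ?thesis using x by blast
qed

text \<open>Dimension shifting for the kernel of \<open>\<delta> m\<close>, the sheaf
  \<open>I m\<close> and the kernel of \<open>\<delta> (Suc m)\<close>. A lift \<open>d\<close> of
  \<open>c\<close> to \<open>I m\<close> has a coboundary in the kernel of
  \<open>\<delta> m\<close>, which by hypothesis is the coboundary of a killed \<open>e\<close>. The
  quotient \<open>g\<close> still lifts \<open>c\<close> and is a cocycle of the injective sheaf
  \<open>I m\<close>, hence the coboundary of some \<open>b\<close>; its image under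
  \<open>\<delta> m\<close> is the solution.\<close>

lemma cech_acyclic_Suc:
  assumes acyc: "cech_acyclic m"
  shows "cech_acyclic (Suc m)"
  unfolding cech_acyclic_def
proof (intro allI impI)
  fix Y S p n c
  assume Y: "Y \<in> \<C>" and S: "S \<in> \<C>" and p: "p \<in> cmap Y S" "p ` topspace Y = topspace S"
    and coc: "cocycle (Suc m) Y p (Suc (Suc n)) c" and kill: "killed (Suc m) Y p (Suc (Suc n)) c"
  have c: "cochain (I (Suc m)) Y p (Suc (Suc n)) c" using coc by (simp add: cocycle_def)
  \<comment> \<open>Lifting each \<open>c T vs\<close> separately would not be natural in
    \<open>T\<close>. A single lift over the fibre power \<open>P\<close> is pulled back along the
    classifying maps instead.\<close>
  obtain P us where P: "P \<in> \<C>" and U: "universal Y p (Suc (Suc n)) P us"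
    using universal_exists[OF Y S p(1), of "Suc n"] by blast
  have us: "us \<in> simplices Y p P (Suc (Suc n))" using U by (simp add: universal_def)
  have "\<delta> (Suc m) P (c P us) = \<one>\<^bsub>sections (I (Suc (Suc m))) P\<^esub>" using kill P us by (simp add: killed_def)
  then obtain x where x: "x \<in> carrier (sections (I m) P)" and dx: "\<delta> m P x = c P us"
    using kernel_\<delta>_Suc[OF acyc P cochainD(1)[OF c P us]] by blast
  define h where "h T vs = (SOME k. k \<in> cmap T P \<and> precomp T k us = vs)" for T vs
  have h: "h T vs \<in> cmap T P" "precomp T (h T vs) us = vs" if vs: "vs \<in> simplices Y p T (Suc (Suc n))" for T vs
  proof -
    have "\<exists>k. k \<in> cmap T P \<and> precomp T k us = vs" using U vs unfolding universal_def by blast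
    from someI_ex[OF this] show "h T vs \<in> cmap T P" "precomp T (h T vs) us = vs" by (simp_all add: h_def)
  qed
  \<comment> \<open>Uniqueness of classifying maps is what makes \<open>d\<close> natural.\<close>
  have huniq: "k = l" if "k \<in> cmap T P" "l \<in> cmap T P" "precomp T k us = precomp T l us" for k l T
    using U that unfolding universal_def by blast
  define d where "d T vs = pull (I m) T P (h T vs) x" for T vs
  have d: "cochain (I m) Y p (Suc (Suc n)) d"
    unfolding cochain_def
  proof (intro conjI ballI)
    show "d T vs \<in> carrier (sections (I m) T)" if "T \<in> \<C>" "vs \<in> simplices Y p T (Suc (Suc n))" for T vs
      unfolding d_def by (rule pull_closed[OF I_presheaf that(1) P h(1)[OF that(2)] x])
    fix T T' k vs assume T: "T \<in> \<C>" "T' \<in> \<C>" and k: "k \<in> cmap T' T" and vs: "vs \<in> simplices Y p T (Suc (Suc n))"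
    have "h T' (precomp T' k vs) = compose (topspace T') (h T vs) k"
    proof (rule huniq)
      show "h T' (precomp T' k vs) \<in> cmap T' P" by (rule h(1)[OF simplices_precomp[OF vs k]])
      show "compose (topspace T') (h T vs) k \<in> cmap T' P" by (rule cmap_compose[OF k h(1)[OF vs]])
      have "precomp T' (h T' (precomp T' k vs)) us = precomp T' k vs" by (rule h(2)[OF simplices_precomp[OF vs k]])
      also have "\<dots> = precomp T' k (precomp T (h T vs) us)" unfolding h(2)[OF vs] ..
      also have "\<dots> = precomp T' (compose (topspace T') (h T vs) k) us" by (rule precomp_precomp[OF k])
      finally show "precomp T' (h T' (precomp T' k vs)) us = precomp T' (compose (topspace T') (h T vs) k) us" .
    qed
    then show "d T' (precomp T' k vs) = pull (I m) T' T k (d T vs)"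
      using pull_compose[OF I_presheaf T(2,1) P k h(1)[OF vs] x] by (simp add: d_def)
  qed
  have \<delta>d: "\<delta> m T (d T vs) = c T vs" if T: "T \<in> \<C>" and vs: "vs \<in> simplices Y p T (Suc (Suc n))" for T vs
    using condensed_homD(2)[OF \<delta>_hom T P h(1)[OF vs] x] cochainD(2)[OF c P us T h(1)[OF vs]] unfolding dx h(2)[OF vs] d_def by simp
  have cd: "cochain (I m) Y p (Suc (Suc (Suc n))) (\<lambda>T. cech (sections (I m) T) (d T))"
    by (rule cochain_cech[OF I_presheaf d])
  have coc_d: "cocycle m Y p (Suc (Suc (Suc n))) (\<lambda>T. cech (sections (I m) T) (d T))"
    unfolding cocycle_def
  proof (intro conjI ballI cd)
    fix T us assume T: "T \<in> \<C>" and us: "us \<in> simplices Y p T (Suc (Suc (Suc (Suc n))))"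
    show "cech (sections (I m) T) (cech (sections (I m) T) (d T)) us = \<one>\<^bsub>sections (I m) T\<^esub>"
    proof (rule comm_group.cech_cech[OF sections_comm_group[OF I_presheaf T]])
      fix vs assume vs: "set vs \<subseteq> set us" "Suc (Suc (length vs)) = length us"
      have "vs \<in> simplices Y p T (Suc (Suc n))" using us vs unfolding simplices_def by auto
      then show "d T vs \<in> carrier (sections (I m) T)" by (rule cochainD(1)[OF d T])
    qed
  qed
  have kill_d: "killed m Y p (Suc (Suc (Suc n))) (\<lambda>T. cech (sections (I m) T) (d T))"
    unfolding killed_def
  proof (intro ballI)
    fix T us assume T: "T \<in> \<C>" and us: "us \<in> simplices Y p T (Suc (Suc (Suc n)))"
    have "\<delta> m T (cech (sections (I m) T) (d T) us) = cech (sections (I (Suc m)) T) (\<lambda>vs. \<delta> m T (d T vs)) us"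
      by (rule cech_\<delta>[OF d T us])
    also have "\<dots> = cech (sections (I (Suc m)) T) (c T) us" by (rule cech_cong) (rule \<delta>d[OF T simplices_face[OF us]])
    also have "\<dots> = \<one>\<^bsub>sections (I (Suc m)) T\<^esub>" using coc T us by (simp add: cocycle_def)
    finally show "\<delta> m T (cech (sections (I m) T) (d T) us) = \<one>\<^bsub>sections (I (Suc m)) T\<^esub>" .
  qed
  obtain e where e: "cochain (I m) Y p (Suc (Suc n)) e" and ke: "killed m Y p (Suc (Suc n)) e"
    and ce: "\<forall>T\<in>\<C>. \<forall>us\<in>simplices Y p T (Suc (Suc (Suc n))). cech (sections (I m) T) (e T) us = cech (sections (I m) T) (d T) us"
    using acyc[unfolded cech_acyclic_def, rule_format, OF Y S p coc_d kill_d] by blast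
  define g where "g T vs = d T vs \<otimes>\<^bsub>sections (I m) T\<^esub> inv\<^bsub>sections (I m) T\<^esub> e T vs" for T vs
  have g: "cochain (I m) Y p (Suc (Suc n)) g"
    unfolding g_def by (rule cochain_quotient[OF I_presheaf d e])
  have cg: "cech (sections (I m) T) (g T) us = \<one>\<^bsub>sections (I m) T\<^esub>"
    if T: "T \<in> \<C>" and us: "us \<in> simplices Y p T (Suc (Suc (Suc n)))" for T us
  proof -
    note G = sections_comm_group[OF I_presheaf T, of m]
    have dc: "cech (sections (I m) T) (d T) us \<in> carrier (sections (I m) T)" by (rule cochainD(1)[OF cd T us])
    have "cech (sections (I m) T) (\<lambda>vs. d T vs \<otimes>\<^bsub>sections (I m) T\<^esub> inv\<^bsub>sections (I m) T\<^esub> e T vs) us =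
        cech (sections (I m) T) (d T) us \<otimes>\<^bsub>sections (I m) T\<^esub> inv\<^bsub>sections (I m) T\<^esub> cech (sections (I m) T) (e T) us"
      by (rule comm_group.cech_quotient[OF G]) (rule cochainD(1)[OF d T simplices_face[OF us]] cochainD(1)[OF e T simplices_face[OF us]]; assumption)+
    also have "\<dots> = \<one>\<^bsub>sections (I m) T\<^esub>"
      using ce[rule_format, OF T us] group.r_inv[OF comm_group.axioms(2)[OF G] dc] by simp
    finally show ?thesis unfolding g_def .
  qed
  obtain b where b: "cochain (I m) Y p (Suc n) b"
    and cb: "\<forall>T\<in>\<C>. \<forall>us\<in>simplices Y p T (Suc (Suc n)). cech (sections (I m) T) (b T) us = g T us"
    using injective_cech_exact[OF I_sheaf Y S p(1) g cg I_injective big] by blast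
  have "killed (Suc m) Y p (Suc n) (\<lambda>T us. \<delta> m T (b T us))"
    unfolding killed_def by (intro ballI \<delta>_\<delta> cochainD(1)[OF b])
  moreover have "cech (sections (I (Suc m)) T) (\<lambda>vs. \<delta> m T (b T vs)) vs = c T vs"
    if T: "T \<in> \<C>" and vs: "vs \<in> simplices Y p T (Suc (Suc n))" for T vs
  proof -
    note H = \<delta>_group_hom[OF T, of m]
    note GS = group.is_monoid[OF group_hom.axioms(2)[OF H]]
    have el: "e T vs \<in> carrier (sections (I m) T)" "d T vs \<in> carrier (sections (I m) T)"
      using cochainD(1)[OF e T vs] cochainD(1)[OF d T vs] by auto
    have ie: "inv\<^bsub>sections (I m) T\<^esub> e T vs \<in> carrier (sections (I m) T)" by (rule group.inv_closed[OF group_hom.axioms(1)[OF H] el(1)])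
    have "\<delta> m T (e T vs) = \<one>\<^bsub>sections (I (Suc m)) T\<^esub>" using ke T vs by (simp add: killed_def)
    then have "\<delta> m T (g T vs) = c T vs"
      using group_hom.hom_mult[OF H el(2) ie] group_hom.hom_inv[OF H el(1)] \<delta>d[OF T vs] monoid.inv_one[OF GS]
        monoid.r_one[OF GS cochainD(1)[OF c T vs]] by (simp add: g_def)
    then show ?thesis using cech_\<delta>[OF b T vs] cb T vs by simp
  qed
  ultimately show "\<exists>b. cochain (I (Suc m)) Y p (Suc n) b \<and> killed (Suc m) Y p (Suc n) b \<and>
      (\<forall>T\<in>\<C>. \<forall>us\<in>simplices Y p T (Suc (Suc n)). cech (sections (I (Suc m)) T) (b T) us = c T us)"
    using cochain_\<delta>[OF b] by (intro exI[of _ "\<lambda>T us. \<delta> m T (b T us)"]) simp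
qed

lemma cech_acyclic: "cech_acyclic m"
  by (induction m) (rule cech_acyclic_0, rule cech_acyclic_Suc)

section \<open>The cohomology groups of the real line\<close>

lemma cocycles_carrier: "carrier (cocycles I \<delta> S i) = {s \<in> carrier (sections (I i) S). \<delta> i S s = \<one>\<^bsub>sections (I (Suc i)) S\<^esub>}"
  by (simp add: cocycles_def kernel_def)

lemma comm_group_cocycles: "S \<in> \<C> \<Longrightarrow> comm_group (cocycles I \<delta> S i)"
proof -
  assume S: "S \<in> \<C>"
  interpret A: comm_group "sections (I i) S" by (rule sections_comm_group[OF I_presheaf S])
  have sub: "subgroup (kernel (sections (I i) S) (sections (I (Suc i)) S) (\<delta> i S)) (sections (I i) S)"
    by (rule group_hom.subgroup_kernel[OF \<delta>_group_hom[OF S]])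
  show ?thesis
    unfolding cocycles_def
    by (rule group.group_comm_groupI[OF subgroup.subgroup_is_group[OF sub A.is_group]])
      (use subgroup.subset[OF sub] in \<open>auto intro!: A.m_comm\<close>)
qed

text \<open>Exactness on global sections: acyclicity feeds \<open>kernel_\<delta>_Suc\<close> over
  \<open>S\<close>, so every cocycle is a coboundary and the quotient is by the whole group.\<close>

lemma cohomology_Suc:
  assumes S: "S \<in> \<C>"
  shows "carrier (cohomology I \<delta> S (Suc m)) = {\<one>\<^bsub>cohomology I \<delta> S (Suc m)\<^esub>}"
proof -
  have "coboundaries I \<delta> S (Suc m) = carrier (cocycles I \<delta> S (Suc m))"
    using kernel_\<delta>_Suc[OF cech_acyclic S] \<delta>_\<delta>[OF S] condensed_hom_closed[OF \<delta>_hom S] by (fastforce simp: cocycles_carrier)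
  then show ?thesis
    unfolding cohomology_def using comm_group.quotient_by_self[OF comm_group_cocycles[OF S]] by simp
qed

text \<open>In degree 0 the coboundaries are trivial, so classes are singletons, and
  \<open>kernel_\<delta>_0\<close> together with injectivity identifies the cocycles with the
  continuous functions.\<close>

lemma cohomology_0:
  assumes S: "S \<in> \<C>"
  shows "(\<lambda>f. cohomology_class I \<delta> S 0 (\<eta> S f)) \<in> iso (real_function_group S) (cohomology I \<delta> S 0)"
proof -
  let ?G = "cocycles I \<delta> S 0"
  have one: "\<one>\<^bsub>sections (I 0) S\<^esub> = \<one>\<^bsub>?G\<^esub>" by (simp add: cocycles_def)
  have group: "group ?G" using comm_group_cocycles[OF S] by (rule comm_group.axioms(2))
  have H: "cohomology I \<delta> S 0 = ?G Mod {\<one>\<^bsub>?G\<^esub>}" by (simp add: cohomology_def one)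
  have coset: "{\<one>\<^bsub>?G\<^esub>} #>\<^bsub>?G\<^esub> s = {s}" if "s \<in> carrier ?G" for s
    using monoid.l_one[OF group.is_monoid[OF group] that] by (simp add: r_coset_def)
  have \<eta>: "\<eta> S f \<in> carrier ?G" if "f \<in> cmap S euclideanreal" for f
    using condensed_hom_closed[OF \<eta>_hom S, of f] \<delta>_\<eta>[OF S that] that by (simp add: cocycles_carrier real_condensed_eq)
  have cls: "cohomology_class I \<delta> S 0 (\<eta> S f) = {\<eta> S f}" if "f \<in> cmap S euclideanreal" for f
    using coset[OF \<eta>[OF that]] by (simp add: cohomology_class_def one)
  have R: "carrier (real_function_group S) = cmap S euclideanreal" "sections real_condensed S = real_function_group S"
    by (simp_all add: real_function_group_def real_condensed_def)
  have carr: "carrier (?G Mod {\<one>\<^bsub>?G\<^esub>}) = (\<lambda>s. {s}) ` carrier ?G"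
    using coset by (auto simp: FactGroup_def RCOSETS_def)
  have img: "\<eta> S ` cmap S euclideanreal = carrier ?G"
    using \<eta> kernel_\<delta>_0[OF S] by (fastforce simp: cocycles_carrier)
  have "(\<lambda>f. cohomology_class I \<delta> S 0 (\<eta> S f)) \<in> hom (real_function_group S) (?G Mod {\<one>\<^bsub>?G\<^esub>})"
  proof (rule homI)
    show "cohomology_class I \<delta> S 0 (\<eta> S f) \<in> carrier (?G Mod {\<one>\<^bsub>?G\<^esub>})" if "f \<in> carrier (real_function_group S)" for f
      using that cls \<eta> by (simp add: R carr)
    fix f g assume fg: "f \<in> carrier (real_function_group S)" "g \<in> carrier (real_function_group S)"
    have cl: "f \<otimes>\<^bsub>real_function_group S\<^esub> g \<in> cmap S euclideanreal"
      using monoid.m_closed[OF group.is_monoid[OF group_hom.axioms(1)[OF \<eta>_group_hom[OF S]]], of f g] fg by (simp add: R)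
    have "\<eta> S (f \<otimes>\<^bsub>real_function_group S\<^esub> g) = \<eta> S f \<otimes>\<^bsub>?G\<^esub> \<eta> S g"
      using group_hom.hom_mult[OF \<eta>_group_hom[OF S], of f g] fg by (simp add: R cocycles_def)
    then show "cohomology_class I \<delta> S 0 (\<eta> S (f \<otimes>\<^bsub>real_function_group S\<^esub> g)) =
        cohomology_class I \<delta> S 0 (\<eta> S f) \<otimes>\<^bsub>?G Mod {\<one>\<^bsub>?G\<^esub>}\<^esub> cohomology_class I \<delta> S 0 (\<eta> S g)"
      using cls[OF cl] cls[of f] cls[of g] fg by (simp add: R FactGroup_def set_mult_def)
  qed
  moreover have "bij_betw (\<lambda>f. cohomology_class I \<delta> S 0 (\<eta> S f)) (cmap S euclideanreal) ((\<lambda>s. {s}) ` carrier ?G)"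
  proof (rule bij_betw_imageI)
    show "inj_on (\<lambda>f. cohomology_class I \<delta> S 0 (\<eta> S f)) (cmap S euclideanreal)"
      using \<eta>_inj[OF S] cls by (simp add: inj_on_def)
    have "(\<lambda>f. cohomology_class I \<delta> S 0 (\<eta> S f)) ` cmap S euclideanreal = (\<lambda>f. {\<eta> S f}) ` cmap S euclideanreal"
      by (rule image_cong[OF refl cls])
    then show "(\<lambda>f. cohomology_class I \<delta> S 0 (\<eta> S f)) ` cmap S euclideanreal = (\<lambda>s. {s}) ` carrier ?G"
      unfolding img[symmetric] by (simp add: image_image)
  qed
  ultimately show ?thesis unfolding iso_def H by (simp add: R carr)
qed

end

end

text \<open>The cohomology is taken from an arbitrary injective resolution with values in a
  sufficiently large type, and the isomorphism in degree 0 is the one induced by the augmentation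
  \<open>\<eta>\<close>. In the second part \<open>level A (Suc i)\<close> is \<open>S_i\<close>, so
  \<open>i = 0\<close> asks for a function on \<open>S\<close> itself.\<close>

theorem theorem3p3:
  fixes S :: "'a topology"
  assumes "compact_space S" and "Hausdorff_space S"
  shows
    "(\<forall>(\<kappa> :: 'a set rel) (I :: nat \<Rightarrow> ('a, 'g) presheaf) \<delta> \<eta>.
        ordLeq3 (card_of (UNIV :: 'a set set set)) (card_of (UNIV :: 'g set)) \<and>
        cutoff_cardinal \<kappa> \<and> S \<in> CHaus \<kappa> \<and> injective_resolution \<kappa> real_condensed I \<delta> \<eta> \<longrightarrow>
        (\<forall>i>0. carrier (cohomology I \<delta> S i) = {\<one>\<^bsub>cohomology I \<delta> S i\<^esub>}) \<and>
        (\<lambda>f. cohomology_class I \<delta> S 0 (\<eta> S f)) \<in> iso (real_function_group S) (cohomology I \<delta> S 0))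
     \<and>
     (\<forall>A. hypercover S A \<and> (\<forall>n. profinite_space (level A (Suc n))) \<longrightarrow>
        (\<forall>i. \<forall>f \<in> cmap (level A (Suc i)) euclideanreal. \<forall>\<epsilon>>0.
           differential A (Suc i) f = (\<lambda>x\<in>topspace (level A (Suc (Suc i))). 0) \<longrightarrow>
           (\<exists>g \<in> cmap (level A i) euclideanreal.
              differential A i g = f \<and>
              sup_norm (level A i) g \<le> (1 + \<epsilon>) * sup_norm (level A (Suc i)) f)))"
proof (intro conjI allI impI ballI)
  fix \<kappa> :: "'a set rel" and I :: "nat \<Rightarrow> ('a, 'g) presheaf" and \<delta> \<eta>
  assume "ordLeq3 (card_of (UNIV :: 'a set set set)) (card_of (UNIV :: 'g set)) \<and>
    cutoff_cardinal \<kappa> \<and> S \<in> CHaus \<kappa> \<and> injective_resolution \<kappa> real_condensed I \<delta> \<eta>"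
  then have big: "ordLeq3 (card_of (UNIV :: 'a set set set)) (card_of (UNIV :: 'g set))"
    and \<kappa>: "cutoff_cardinal \<kappa>" and S: "S \<in> CHaus \<kappa>"
    and res: "injective_resolution \<kappa> real_condensed I \<delta> \<eta>" by auto
  interpret cutoff \<kappa> using \<kappa> by unfold_locales
  show "carrier (cohomology I \<delta> S i) = {\<one>\<^bsub>cohomology I \<delta> S i\<^esub>}" if "0 < i" for i
    using cohomology_Suc[OF res big S, of "i - 1"] that by simp
  show "(\<lambda>f. cohomology_class I \<delta> S 0 (\<eta> S f)) \<in> iso (real_function_group S) (cohomology I \<delta> S 0)"
    by (rule cohomology_0[OF res big S])
next
  fix A i f and \<epsilon> :: real
  assume A: "hypercover S A \<and> (\<forall>n. profinite_space (level A (Suc n)))"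
    and f: "f \<in> cmap (level A (Suc i)) euclideanreal" "0 < \<epsilon>"
      "differential A (Suc i) f = (\<lambda>x\<in>topspace (level A (Suc (Suc i))). 0)"
  show "\<exists>g\<in>cmap (level A i) euclideanreal. differential A i g = f \<and>
      sup_norm (level A i) g \<le> (1 + \<epsilon>) * sup_norm (level A (Suc i)) f"
    using hypercover_complex_exact[OF assms _ _ f(1,3,2)] A by blast
qed


end
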